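(* Let $d\ge2$ be an integer and let $G=\{g_0,g_1,\dots,g_{d-1}\}$ be a finite Abelian group of order $d$. Consider the group multiplication add urn (GAU) model on $G$ described in the context, with random draw sizes $(M_i)_{i\ge1}$ satisfying Assumptions 1 and 2 of the context, started from a finite number $n_0\ge1$ of balls whose labels generate $G$. For $n\ge0$ let $\mathbf S_n=(S_{n,g_0},\dots,S_{n,g_{d-1}})$, where $S_{n,g}$ is the number of balls labeled $g$ in the urn after $n$ stages. Then, as $n\to\infty$, $$\frac1{\sqrt n}\Big(\mathbf S_n-\frac nd\mathbf 1_d\Big)\to N_d(0,\Sigma)\quad\text{in distribution},\qquad \Sigma=\frac1d\mathbf I_d-\frac1{d^2}\mathbf 1_d\mathbf 1_d^T,$$ where $\mathbf I_d$ is the $d\times d$ identity matrix, $\mathbf 1_d$ is the $d$-dimensional all-ones vector, and $N_d(0,\Sigma)$ is the (degenerate) centered $d$-dimensional Gaussian law with covariance matrix $\Sigma$.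
   Context: The GAU model. Let $\ast$ denote the group operation of the finite Abelian group $G$ of order $d$. The urn contains balls labeled by elements of $G$. Initially it contains $S_{0,g}$ balls labeled $g$ for $g\in G$ (deterministic nonnegative integers), with $\sum_{g\in G}S_{0,g}=n_0\ge1$, and the set of labels present, $\{g:S_{0,g}>0\}$, generates $G$. At each stage $i=1,2,\dots$, a random number $M_i$ of balls is drawn one at a time with replacement; if their labels are $X_{i1},\dots,X_{iM_i}$, then one new ball with label $Z_i=X_{i1}\ast X_{i2}\ast\dots\ast X_{iM_i}$ is added to the urn (the drawn balls are all returned). Thus $S_{n,g}=S_{0,g}+\sum_{i=1}^n\mathbf 1\{Z_i=g\}$, and the urn contains $n+n_0$ balls after $n$ stages. Let $\mathcal F_n$ be the $\sigma$-field generated by $\{(X_{i1},\dots,X_{iM_i}):i=1,\dots,n\}$ (so $M_1,\dots,M_n$ are $\mathcal F_n$-measurable). Assumption 1. At each stage $i$, conditionally on $\mathcal F_{i-1}$, the draws are independent of $M_i$, and given $M_i=m$ the labels $X_{i1},\dots,X_{im}$ are conditionally independent, each equal to $g\in G$ with probability $S_{i-1,g}/(i-1+n_0)$. That is, for every possible value $m$ of $M_i$ and all $x_1,\dots,x_m\in G$, $$P(M_i=m,X_{i1}=x_1,\dots,X_{im}=x_m\mid\mathcal F_{i-1})=P(M_i=m)\prod_{l=1}^m\frac{S_{i-1,x_l}}{i-1+n_0}.$$ Assumption 2. There are integers $c\ge1$, $C\ge2$ and $2\le m_1<m_2<\dots<m_c\le C$ such that $(M_i)_{i\ge1}$ are i.i.d.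 with $P(M_i=m_s)=p_s>0$ for $s=1,\dots,c$ and $\sum_{s=1}^c p_s=1$. Moreover there is at least one $s\in\{1,\dots,c\}$ with $\gcd(m_s-1,d)=1$. *)

theory Defs
  imports "HOL-Probability.Probability" "HOL-Algebra.Generated_Groups"
begin

text \<open>
  The draws of stage \<open>i \<ge> 1\<close> form a random list \<open>X i \<omega> = [X\<^sub>i\<^sub>1, \<dots>, X\<^sub>i\<^sub>M]\<close> of group elements,
  so that the random draw size \<open>M\<^sub>i\<close> is its length.  The value of \<open>X\<close> at stage 0 is never used.
\<close>

definition draw_size :: "(nat \<Rightarrow> 'w \<Rightarrow> 'a list) \<Rightarrow> nat \<Rightarrow> 'w \<Rightarrow> nat" where
  "draw_size X i \<omega> = length (X i \<omega>)"

definition added_label :: "('a, 'b) monoid_scheme \<Rightarrow> (nat \<Rightarrow> 'w \<Rightarrow> 'a list) \<Rightarrow> nat \<Rightarrow> 'w \<Rightarrow> 'a" where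
  "added_label G X i \<omega> = foldr (\<otimes>\<^bsub>G\<^esub>) (X i \<omega>) \<one>\<^bsub>G\<^esub>"

definition urn_count ::
  "('a, 'b) monoid_scheme \<Rightarrow> ('a \<Rightarrow> nat) \<Rightarrow> (nat \<Rightarrow> 'w \<Rightarrow> 'a list) \<Rightarrow> nat \<Rightarrow> 'a \<Rightarrow> 'w \<Rightarrow> nat" where
  "urn_count G S0 X n h \<omega> = S0 h + (\<Sum>i = 1..n. if added_label G X i \<omega> = h then 1 else 0)"

definition draw_history ::
  "'w measure \<Rightarrow> ('a, 'b) monoid_scheme \<Rightarrow> (nat \<Rightarrow> 'w \<Rightarrow> 'a list) \<Rightarrow> nat \<Rightarrow> 'w measure" where
  "draw_history P G X n =
     sigma (space P) {X i -` A \<inter> space P | i A. i \<in> {1..n} \<and> A \<subseteq> lists (carrier G)}"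

text \<open>
  Conditionally on \<open>\<F>\<^sub>i\<^sub>-\<^sub>1\<close>, the draws of stage \<open>i\<close> are independent of \<open>M\<^sub>i\<close> and, given \<open>M\<^sub>i = m\<close>, they
  are \<open>m\<close> independent uniform picks with replacement from the urn.  The conditional probability
  of the event \<open>M\<^sub>i = m, X\<^sub>i\<^sub>1 = xs ! 0, \<dots>, X\<^sub>i\<^sub>m = xs ! (m - 1)\<close> is the conditional expectation of
  its indicator; for lists, this event is \<open>X i \<omega> = xs\<close> with \<open>length xs = m\<close>.
\<close>

definition uniform_draws ::
  "'w measure \<Rightarrow> ('a, 'b) monoid_scheme \<Rightarrow> ('a \<Rightarrow> nat) \<Rightarrow> (nat \<Rightarrow> 'w \<Rightarrow> 'a list) \<Rightarrow> bool" where
  "uniform_draws P G S0 X \<longleftrightarrow>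
     (\<forall>i\<ge>1. \<forall>m. measure P {\<omega> \<in> space P. draw_size X i \<omega> = m} > 0 \<longrightarrow>
       (\<forall>xs\<in>lists (carrier G). length xs = m \<longrightarrow>
         (AE \<omega> in P.
            real_cond_exp P (draw_history P G X (i - 1))
              (indicator {\<omega> \<in> space P. X i \<omega> = xs}) \<omega> =
            measure P {\<omega> \<in> space P. draw_size X i \<omega> = m} *
              (\<Prod>l<m. real (urn_count G S0 X (i - 1) (xs ! l) \<omega>) /
                      real (i - 1 + (\<Sum>h\<in>carrier G. S0 h))))))"

text \<open>Convergence in distribution of random elements of a topological space; the library's
  \<^const>\<open>weak_conv_m\<close> is specific to the real line.\<close>

definition converges_in_distribution ::
  "'w measure \<Rightarrow> (nat \<Rightarrow> 'w \<Rightarrow> 'c::topological_space) \<Rightarrow> 'c measure \<Rightarrow> bool" where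
  "converges_in_distribution P Y \<mu> \<longleftrightarrow>
     (\<forall>f :: 'c \<Rightarrow> real. continuous_on UNIV f \<longrightarrow> bounded (range f) \<longrightarrow>
       (\<lambda>n. integral\<^sup>L (distr P borel (Y n)) f) \<longlonglongrightarrow> integral\<^sup>L \<mu> f)"

text \<open>The normal law on the real line with mean \<open>m\<close> and variance \<open>v \<ge> 0\<close>; a point mass if \<open>v = 0\<close>.\<close>

definition real_normal_law :: "real \<Rightarrow> real \<Rightarrow> real measure" where
  "real_normal_law m v =
     (if v = 0 then return borel m else density lborel (normal_density m (sqrt v)))"

text \<open>
  A law on \<open>\<real>\<^sup>n\<close> is Gaussian if all its one-dimensional projections are normal, possibly
  degenerate; together with its mean vector and covariance matrix this determines the law.
\<close>

definition gaussian_law :: "(real^'n) measure \<Rightarrow> bool" where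
  "gaussian_law \<mu> \<longleftrightarrow> prob_space \<mu> \<and> sets \<mu> = sets borel \<and>
     (\<forall>a. \<exists>m v. v \<ge> 0 \<and> distr \<mu> borel (\<lambda>x. a \<bullet> x) = real_normal_law m v)"

definition multivariate_normal :: "real^'n \<Rightarrow> real^'n^'n \<Rightarrow> (real^'n) measure \<Rightarrow> bool" where
  "multivariate_normal m \<Sigma> \<mu> \<longleftrightarrow> gaussian_law \<mu> \<and>
     (\<forall>i. (\<integral>x. x $ i \<partial>\<mu>) = m $ i) \<and>
     (\<forall>i j. (\<integral>x. (x $ i - m $ i) * (x $ j - m $ j) \<partial>\<mu>) = \<Sigma> $ i $ j)"

end

theory Submission
  imports Defs "HOL-Algebra.Multiplicative_Group" "HOL-Real_Asymp.Real_Asymp"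
begin

text \<open>
  Let \<open>\<pi>\<close> be the composition of the urn and \<open>U\<close> the squared \<open>L\<^sup>2\<close> distance of \<open>\<pi>\<close> to the uniform law on \<open>G\<close>.
  The next label is distributed as the mixture of the convolution powers \<open>\<pi>\<^sup>*\<^sup>m\<close>, and as \<open>m \<ge> 2\<close>,
  this law is within \<open>card G * U\<close> of the uniform law in \<open>L\<^sup>1\<close>.  There is therefore no first-order drift,
  and a martingale-like telescoping of characteristic functions compares the urn with a sum of
  independent uniform labels, up to \<open>1 / sqrt n\<close> times the sum of the \<open>U\<^sub>k\<close> with \<open>k < n\<close>.

  Once \<open>U\<close> stays small its mean is of order \<open>1 / n\<close>, so that this error vanishes.  That \<open>U\<close> becomes small
  follows from a contraction of \<open>U\<close> by convolution with \<open>\<pi>\<close>, which is uniform unless \<open>\<pi>\<close> nearly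
  concentrates on a coset of a proper subgroup.  Such a concentration is unstable:
  near a subgroup \<open>H\<close> the outside is replenished at twice the rate needed to survive, as a single
  draw from outside \<open>H\<close> suffices for the product to leave \<open>H\<close>; near a coset \<open>c H \<noteq> H\<close> the product of
  \<open>m\<close> draws lies in \<open>c\<^sup>m H\<close>, which differs from \<open>c H\<close> when \<open>m - 1\<close> is coprime to the order of \<open>G\<close>.
\<close>

text \<open>The obstacle is the rate of \<open>U\<close>. Contraction by convolution is quantitative
  only away from cosets of proper subgroups, and nothing confines the urn to that region for ever.
  No such confinement is asked for: at every late time the urn is within \<open>r\<close> of such a
  coset with probability \<open>O(sqrt r)\<close>. With \<open>N\<close> the number of balls,
  \<open>U + 1 / N\<close> is a supermartingale, and this bound makes its mean lose a multiple of
  \<open>1 / N\<close> per stage as long as that mean is not small, so the divergent harmonic series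
  forces it to 0. A maximal inequality then keeps \<open>U\<close> at most
  \<open>1 / (16 d)\<close>, where \<open>d\<close> is the group order, from some stage on with
  probability near 1. There the quadratic bound multiplies \<open>U\<close> by about
  \<open>1 - 3 / (2 N)\<close> per stage, against noise \<open>1 / N^2\<close>; since
  \<open>3 / 2 > 1\<close>, the mean of \<open>U\<close> on this event reaches order
  \<open>1 / N\<close>, and the error in the characteristic function is \<open>ln n / sqrt n\<close>
  up to the small probability of leaving the region. Expectations are finite sums over label
  histories; the probability space enters only to identify the law of these histories.\<close>

section \<open>Levy continuity in several dimensions\<close>

text \<open>The class to which pointwise convergence of characteristic functions extends by
  linearity alone. Products stay inside it because frequencies add.\<close>

inductive trig_poly :: "('a::real_inner \<Rightarrow> complex) \<Rightarrow> bool" where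
  base: "trig_poly (\<lambda>x. c * iexp (t \<bullet> x))"
| add: "trig_poly f \<Longrightarrow> trig_poly g \<Longrightarrow> trig_poly (\<lambda>x. f x + g x)"

lemma trig_poly_const: "trig_poly (\<lambda>x. c)"
  using trig_poly.base[of c 0] by simp

lemma trig_poly_mult:
  assumes "trig_poly f" "trig_poly g"
  shows "trig_poly (\<lambda>x. f x * g x)"
  using assms(1)
proof induction
  case (base c t)
  show ?case using assms(2)
  proof induction
    case (base c' t')
    have "(\<lambda>x. c * iexp (t \<bullet> x) * (c' * iexp (t' \<bullet> x))) = (\<lambda>x. (c * c') * iexp ((t + t') \<bullet> x))"
      by (auto simp: inner_add_left exp_add algebra_simps)
    then show ?case using trig_poly.base by metis
  next
    case (add f g)
    then show ?case using trig_poly.add[OF add.IH] by (simp add: distrib_left)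
  qed
next
  case (add f g')
  then show ?case using trig_poly.add[OF add.IH] by (simp add: distrib_right)
qed

lemma trig_poly_sum:
  assumes "finite A" "\<And>a. a \<in> A \<Longrightarrow> trig_poly (f a)"
  shows "trig_poly (\<lambda>x. \<Sum>a\<in>A. f a x)"
  using assms by (induction) (auto intro: trig_poly_const trig_poly.add)

lemma trig_poly_sin: "trig_poly (\<lambda>x. of_real (sin (t \<bullet> x)))"
proof -
  have "(\<lambda>x. complex_of_real (sin (t \<bullet> x))) =
      (\<lambda>x. (1 / (2 * \<i>)) * iexp (t \<bullet> x) + (- 1 / (2 * \<i>)) * iexp ((- t) \<bullet> x))"
    by (auto simp: sin_exp_eq sin_of_real[symmetric] field_simps)
  then show ?thesis using trig_poly.add[OF trig_poly.base trig_poly.base] by metis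
qed

text \<open>A substitute for truncation: close to the identity on a fixed cube when \<open>L\<close>
  is large, bounded by \<open>L\<close> in each coordinate everywhere, and such that a polynomial
  evaluated at it is a trigonometric polynomial.\<close>

definition sine_clamp :: "real \<Rightarrow> 'a::euclidean_space \<Rightarrow> 'a" where
  "sine_clamp L x = (\<Sum>b\<in>Basis. (L * sin ((x \<bullet> b) / L)) *\<^sub>R b)"

lemma sine_clamp_inner: "b \<in> Basis \<Longrightarrow> sine_clamp L x \<bullet> b = L * sin ((x \<bullet> b) / L)"
  unfolding sine_clamp_def by (simp add: inner_sum_left inner_Basis if_distrib cong: if_cong)

lemma trig_poly_sine_clamp:
  fixes h :: "'a::euclidean_space \<Rightarrow> real"
  assumes "real_polynomial_function h"
  shows "trig_poly (\<lambda>x. of_real (h (sine_clamp L x)))"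
  using assms
proof induction
  case (linear f)
  interpret bounded_linear f by fact
  have "(\<lambda>x. complex_of_real (f (sine_clamp L x))) =
     (\<lambda>x. \<Sum>b\<in>Basis. of_real (L * f b) * of_real (sin ((b /\<^sub>R L) \<bullet> x)))"
    unfolding sine_clamp_def
    by (auto simp: sum scaleR inner_commute divide_inverse algebra_simps)
  moreover have "trig_poly (\<lambda>x. \<Sum>b\<in>Basis. of_real (L * f b) * of_real (sin ((b /\<^sub>R L) \<bullet> x)))"
    by (intro trig_poly_sum trig_poly_mult trig_poly_const trig_poly_sin finite_Basis)
  ultimately show ?case by (simp only:)
qed (auto intro: trig_poly_const trig_poly.add trig_poly_mult)

lemma trig_poly_bounded: "trig_poly f \<Longrightarrow> \<exists>B. \<forall>x. norm (f x) \<le> B"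
proof (induction rule: trig_poly.induct)
  case (base c t)
  show ?case by (rule exI[of _ "norm c"]) (auto simp: norm_mult)
next
  case (add f g)
  then obtain B C where "\<forall>x. norm (f x) \<le> B" "\<forall>x. norm (g x) \<le> C" by auto
  then have "\<forall>x. norm (f x + g x) \<le> B + C" by (meson add_mono norm_triangle_ineq order_trans)
  then show ?case by blast
qed

lemma trig_poly_measurable: "trig_poly f \<Longrightarrow> f \<in> borel_measurable (borel :: 'a::euclidean_space measure)"
  by (induction rule: trig_poly.induct) auto

lemma abs_sin_le_abs: "\<bar>sin x\<bar> \<le> \<bar>x::real\<bar>"
  using abs_sin_x_le_abs_x by blast

lemma abs_sin_diff_le:
  fixes x :: real shows "\<bar>sin x - x\<bar> \<le> x\<^sup>2"
proof -
  have "norm (iexp x - (\<Sum>k\<le>1. (\<i> * of_real x)^k / fact k)) \<le> \<bar>x\<bar>^(Suc 1) / fact (Suc 1)"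
    by (rule iexp_approx1)
  then have a: "norm (iexp x - (1 + \<i> * x)) \<le> x\<^sup>2 / 2" by (simp add: numeral_2_eq_2)
  have "\<bar>Im (iexp x - (1 + \<i> * x))\<bar> \<le> x\<^sup>2 / 2" using abs_Im_le_cmod a order_trans by blast
  moreover have "Im (iexp x - (1 + \<i> * x)) = sin x - x" by (simp add: Im_exp)
  ultimately show ?thesis by (smt (verit) field_sum_of_halves zero_le_power2)
qed

lemma sine_clamp_dist:
  fixes x :: "'a::euclidean_space"
  assumes "L > 0" "\<And>b. b \<in> Basis \<Longrightarrow> \<bar>x \<bullet> b\<bar> \<le> R"
  shows "dist (sine_clamp L x) x \<le> DIM('a) * (R\<^sup>2 / L)"
proof -
  have "norm (sine_clamp L x - x) \<le> (\<Sum>b\<in>Basis. \<bar>(sine_clamp L x - x) \<bullet> b\<bar>)" by (rule norm_le_l1)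
  also have "\<dots> \<le> (\<Sum>b\<in>(Basis::'a set). R\<^sup>2 / L)"
  proof (rule sum_mono)
    fix b :: 'a assume b: "b \<in> Basis"
    have "\<bar>(sine_clamp L x - x) \<bullet> b\<bar> = \<bar>L * (sin ((x \<bullet> b) / L) - (x \<bullet> b) / L)\<bar>"
      using assms b by (simp add: inner_diff_left sine_clamp_inner right_diff_distrib)
    also have "\<dots> \<le> L * ((x \<bullet> b) / L)\<^sup>2"
      using abs_sin_diff_le[of "(x \<bullet> b) / L"] assms by (simp add: abs_mult)
    also have "\<dots> = (x \<bullet> b)\<^sup>2 / L" using assms by (simp add: power2_eq_square)
    also have "\<dots> \<le> R\<^sup>2 / L" using assms(1) assms(2)[OF b]
      by (intro divide_right_mono) (auto simp: abs_le_square_iff[symmetric])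
    finally show "\<bar>(sine_clamp L x - x) \<bullet> b\<bar> \<le> R\<^sup>2 / L" .
  qed
  finally show ?thesis by (simp add: dist_norm)
qed

lemma compact_cube: "compact {x::'a::euclidean_space. \<forall>b\<in>Basis. \<bar>x \<bullet> b\<bar> \<le> R}"
proof -
  have "{x::'a. \<forall>b\<in>Basis. \<bar>x \<bullet> b\<bar> \<le> R} = cbox (\<Sum>b\<in>Basis. (-R) *\<^sub>R b) (\<Sum>b\<in>Basis. R *\<^sub>R b)"
    unfolding set_eq_iff mem_box mem_Collect_eq
    by (intro allI ball_cong refl) (simp only: inner_sum_left_Basis abs_le_iff, linarith)
  then show ?thesis by simp
qed

lemma (in prob_space) trig_poly_tendsto:
  fixes Y :: "nat \<Rightarrow> 'a \<Rightarrow> 'b::euclidean_space"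
  assumes [measurable]: "\<And>n. Y n \<in> borel_measurable M"
    and \<mu>: "prob_space \<mu>" "sets \<mu> = sets borel"
    and char: "\<And>t. (\<lambda>n. \<integral>\<omega>. iexp (t \<bullet> Y n \<omega>) \<partial>M) \<longlonglongrightarrow> (\<integral>x. iexp (t \<bullet> x) \<partial>\<mu>)"
    and "trig_poly f"
  shows "(\<lambda>n. \<integral>\<omega>. f (Y n \<omega>) \<partial>M) \<longlonglongrightarrow> (\<integral>x. f x \<partial>\<mu>)"
  using assms(5)
proof induction
  case (base c t)
  then show ?case using tendsto_mult[OF tendsto_const[of c] char[of t]] by simp
next
  case (add f g)
  interpret \<mu>: prob_space \<mu> by fact
  have i: "integrable M (\<lambda>\<omega>. h (Y n \<omega>))" "integrable \<mu> h" if h: "trig_poly h" for h n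
  proof -
    obtain B where B: "\<And>x. norm (h x) \<le> B" using trig_poly_bounded[OF h] by blast
    have [measurable]: "h \<in> borel_measurable borel" by (rule trig_poly_measurable) fact
    show "integrable M (\<lambda>\<omega>. h (Y n \<omega>))" by (rule integrable_const_bound[of _ B]) (auto simp: B)
    show "integrable \<mu> h" using trig_poly_measurable[OF h] \<mu>(2)
      by (intro \<mu>.integrable_const_bound[of _ B]) (auto simp: B cong: measurable_cong_sets)
  qed
  show ?case using tendsto_add[OF add.IH] by (simp add: i add.hyps)
qed

text \<open>Tightness one direction at a time: along a fixed \<open>b\<close> the hypothesis is
  convergence of characteristic functions on the line, where Levy's theorem applies.\<close>

lemma (in prob_space) coordinate_tail:
  fixes Y :: "nat \<Rightarrow> 'a \<Rightarrow> 'b::euclidean_space"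
  assumes [measurable]: "\<And>n. Y n \<in> borel_measurable M"
    and \<mu>: "prob_space \<mu>" and [measurable_cong]: "sets \<mu> = sets borel"
    and char: "\<And>t. (\<lambda>n. \<integral>\<omega>. iexp (t \<bullet> Y n \<omega>) \<partial>M) \<longlonglongrightarrow> (\<integral>x. iexp (t \<bullet> x) \<partial>\<mu>)"
    and "e > 0"
  shows "\<exists>R>0. (\<forall>\<^sub>F n in sequentially. prob {\<omega>\<in>space M. \<bar>b \<bullet> Y n \<omega>\<bar> > R} < e) \<and>
           measure \<mu> {x\<in>space \<mu>. \<bar>b \<bullet> x\<bar> > R} < e"
proof -
  interpret \<mu>: prob_space \<mu> by fact
  let ?D = "\<lambda>n. distr M borel (\<lambda>\<omega>. b \<bullet> Y n \<omega>)" and ?D' = "distr \<mu> borel (\<lambda>x. b \<bullet> x)"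
  have wc: "weak_conv_m ?D ?D'"
  proof (rule levy_continuity)
    show "real_distribution (?D n)" for n by (rule real_distribution_distr) simp
    show "real_distribution ?D'" by (rule \<mu>.real_distribution_distr) simp
    show "(\<lambda>n. char (?D n) t) \<longlonglongrightarrow> char ?D' t" for t
      using char[of "t *\<^sub>R b"] by (simp add: char_def integral_distr)
  qed
  have "(\<lambda>k. measure \<mu> {x\<in>space \<mu>. \<bar>b \<bullet> x\<bar> > real k}) \<longlonglongrightarrow> measure \<mu> (\<Inter>k. {x\<in>space \<mu>. \<bar>b \<bullet> x\<bar> > real k})"
    by (rule \<mu>.finite_Lim_measure_decseq) (auto simp: decseq_def)
  moreover have "(\<Inter>k. {x\<in>space \<mu>. \<bar>b \<bullet> x\<bar> > real k}) = {}"
    using reals_Archimedean2 by (auto dest: less_asym)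
  ultimately have "(\<lambda>k. measure \<mu> {x\<in>space \<mu>. \<bar>b \<bullet> x\<bar> > real k}) \<longlonglongrightarrow> 0" by simp
  from order_tendstoD(2)[OF this \<open>e > 0\<close>] obtain k where k: "measure \<mu> {x\<in>space \<mu>. \<bar>b \<bullet> x\<bar> > real k} < e"
    by (auto simp: eventually_sequentially)
  \<comment> \<open>A continuous ramp between the indicators of \<open>|y| > k + 1\<close> and
    \<open>|y| > k\<close>. Weak convergence applies to it and transfers the tail bound of the limit
    to the sequence, at the cost of enlarging the radius by 1.\<close>
  define \<phi> :: "real \<Rightarrow> real" where "\<phi> y = min 1 (max 0 (\<bar>y\<bar> - k))" for y
  have [measurable]: "\<phi> \<in> borel_measurable borel" unfolding \<phi>_def by measurable
  have \<phi>: "0 \<le> \<phi> y" "\<phi> y \<le> 1" "isCont \<phi> y" "norm (\<phi> y) \<le> 1" for y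
    unfolding \<phi>_def by (auto intro!: continuous_intros)
  have lim: "(\<lambda>n. integral\<^sup>L (?D n) \<phi>) \<longlonglongrightarrow> integral\<^sup>L ?D' \<phi>"
    by (rule weak_conv_imp_integral_bdd_continuous_conv[OF _ _ wc, of \<phi> 1])
       (auto simp: \<phi> \<mu>.real_distribution_distr)
  have "integral\<^sup>L ?D' \<phi> = (\<integral>x. \<phi> (b \<bullet> x) \<partial>\<mu>)" by (rule integral_distr) auto
  also have "\<dots> \<le> (\<integral>x. indicator {x\<in>space \<mu>. \<bar>b \<bullet> x\<bar> > real k} x \<partial>\<mu>)"
  proof (rule integral_mono)
    show "integrable \<mu> (\<lambda>x. \<phi> (b \<bullet> x))"
      by (rule \<mu>.integrable_const_bound[of _ 1]) (use \<phi> in auto)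
    show "\<phi> (b \<bullet> x) \<le> indicator {x\<in>space \<mu>. \<bar>b \<bullet> x\<bar> > real k} x" if "x \<in> space \<mu>" for x
      using that by (auto simp: \<phi>_def indicator_def)
  qed (auto intro!: \<mu>.integrable_const_bound[of _ 1])
  also have "\<dots> < e" using k by simp
  finally have "\<forall>\<^sub>F n in sequentially. integral\<^sup>L (?D n) \<phi> < e" using order_tendstoD(2)[OF lim] by blast
  then have "\<forall>\<^sub>F n in sequentially. prob {\<omega>\<in>space M. \<bar>b \<bullet> Y n \<omega>\<bar> > real k + 1} < e"
  proof eventually_elim
    case (elim n)
    have "prob {\<omega>\<in>space M. \<bar>b \<bullet> Y n \<omega>\<bar> > real k + 1} = (\<integral>\<omega>. indicator {\<omega>\<in>space M. \<bar>b \<bullet> Y n \<omega>\<bar> > real k + 1} \<omega> \<partial>M)"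
      by simp
    also have "\<dots> \<le> (\<integral>\<omega>. \<phi> (b \<bullet> Y n \<omega>) \<partial>M)"
    proof (rule integral_mono)
      show "integrable M (\<lambda>\<omega>. \<phi> (b \<bullet> Y n \<omega>))"
        by (rule integrable_const_bound[of _ 1]) (use \<phi> in auto)
      show "indicator {\<omega>\<in>space M. \<bar>b \<bullet> Y n \<omega>\<bar> > real k + 1} \<omega> \<le> \<phi> (b \<bullet> Y n \<omega>)" if "\<omega> \<in> space M" for \<omega>
        using that by (auto simp: \<phi>_def indicator_def)
    qed (auto intro!: integrable_const_bound[of _ 1])
    also have "\<dots> = integral\<^sup>L (?D n) \<phi>" by (rule integral_distr[symmetric]) auto
    finally show ?case using elim by simp
  qed
  moreover have "measure \<mu> {x\<in>space \<mu>. \<bar>b \<bullet> x\<bar> > real k + 1} < e"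
    by (rule le_less_trans[OF \<mu>.finite_measure_mono k]) auto
  ultimately show ?thesis by (intro exI[of _ "real k + 1"]) auto
qed

text \<open>Used under the limit law and along the sequence alike: a uniform error \<open>e\<close>,
  and a crude additional \<open>K\<close> on an exceptional set.\<close>

lemma (in prob_space) integral_close:
  fixes F H :: "'a \<Rightarrow> real"
  assumes [measurable]: "F \<in> borel_measurable M" "H \<in> borel_measurable M" "A \<in> events"
    and "\<And>x. x \<in> space M \<Longrightarrow> \<bar>F x\<bar> \<le> B" "\<And>x. x \<in> space M \<Longrightarrow> \<bar>H x\<bar> \<le> C"
    and d: "\<And>x. x \<in> space M \<Longrightarrow> \<bar>F x - H x\<bar> \<le> e + K * indicator A x"
  shows "\<bar>(\<integral>x. F x \<partial>M) - (\<integral>x. H x \<partial>M)\<bar> \<le> e + K * prob A"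
proof -
  have i: "integrable M F" "integrable M H"
    using integrable_const_bound[of F B] integrable_const_bound[of H C] assms(4,5) by (auto intro: AE_I2)
  have "\<bar>(\<integral>x. F x \<partial>M) - (\<integral>x. H x \<partial>M)\<bar> = \<bar>\<integral>x. F x - H x \<partial>M\<bar>" using i by simp
  also have "\<dots> \<le> (\<integral>x. \<bar>F x - H x\<bar> \<partial>M)" by (rule integral_abs_bound)
  also have "\<dots> \<le> (\<integral>x. e + K * indicator A x \<partial>M)"
    using d i by (intro integral_mono) (auto intro!: integrable_add integrable_mult_right integrable_const_bound[of "indicator A" 1])
  also have "\<dots> = e + K * prob A"
    using integrable_const_bound[of "indicator A :: _ \<Rightarrow> real" 1] by (subst Bochner_Integration.integral_add) (auto simp: prob_space)
  finally show ?thesis .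
qed

text \<open>A bounded continuous \<open>f\<close> is compared with \<open>f \<circ> sine_clamp L\<close>: the latter is uniformly close, on the
  whole space, to a trigonometric polynomial, because \<^const>\<open>sine_clamp\<close> takes values in a compact cube.\<close>

theorem (in prob_space) converges_in_distribution_charI:
  fixes Y :: "nat \<Rightarrow> 'a \<Rightarrow> 'b::euclidean_space"
  assumes Y[measurable]: "\<And>n. Y n \<in> borel_measurable M"
    and \<mu>: "prob_space \<mu>" and sets_\<mu>[measurable_cong]: "sets \<mu> = sets borel"
    and char: "\<And>t. (\<lambda>n. \<integral>\<omega>. iexp (t \<bullet> Y n \<omega>) \<partial>M) \<longlonglongrightarrow> (\<integral>x. iexp (t \<bullet> x) \<partial>\<mu>)"
  shows "converges_in_distribution M Y \<mu>"
  unfolding converges_in_distribution_def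
proof (intro allI impI)
  fix f :: "'b \<Rightarrow> real" assume f: "continuous_on UNIV f" "bounded (range f)"
  interpret \<mu>: prob_space \<mu> by fact
  have fm[measurable]: "f \<in> borel_measurable borel" using f(1) by (rule borel_measurable_continuous_onI)
  obtain B where B: "B > 0" "\<And>x. \<bar>f x\<bar> \<le> B" using f(2) unfolding bounded_pos by auto
  have "(\<lambda>n. \<integral>\<omega>. f (Y n \<omega>) \<partial>M) \<longlonglongrightarrow> integral\<^sup>L \<mu> f"
  proof (rule metric_LIMSEQ_I)
    fix e :: real assume e: "e > 0"
    \<comment> \<open>Error budget: replacing \<open>f\<close> by \<open>T\<close> costs
      \<open>3 * r\<close> under each of the two laws, and convergence for \<open>T\<close> costs
      \<open>r\<close>; the total stays below \<open>10 * r\<close>. The tail level \<open>s\<close>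
      makes the union over all coordinates weigh at most \<open>r / (2 * B)\<close>.\<close>
    define r where "r = e / 10"
    define s where "s = r / (2 * B * DIM('b))"
    have r: "r > 0" and s: "s > 0" using e B by (auto simp: r_def s_def)
    have "\<forall>b. \<exists>R>0. (\<forall>\<^sub>F n in sequentially. prob {\<omega>\<in>space M. \<bar>b \<bullet> Y n \<omega>\<bar> > R} < s) \<and>
           measure \<mu> {x\<in>space \<mu>. \<bar>b \<bullet> x\<bar> > R} < s"
      by (rule allI) (rule coordinate_tail[OF Y \<mu> sets_\<mu> char s])
    from choice[OF this] obtain R where R': "\<forall>b. R b > 0 \<and>
        (\<forall>\<^sub>F n in sequentially. prob {\<omega>\<in>space M. \<bar>b \<bullet> Y n \<omega>\<bar> > R b} < s) \<and>
        measure \<mu> {x\<in>space \<mu>. \<bar>b \<bullet> x\<bar> > R b} < s" ..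
    have R: "R b > 0" "\<forall>\<^sub>F n in sequentially. prob {\<omega>\<in>space M. \<bar>b \<bullet> Y n \<omega>\<bar> > R b} < s"
        "measure \<mu> {x\<in>space \<mu>. \<bar>b \<bullet> x\<bar> > R b} < s" for b using R' by simp_all
    define R0 where "R0 = Max (R ` Basis)"
    have R0: "R b \<le> R0" if "b \<in> Basis" for b using that unfolding R0_def by (intro Max_ge) auto
    have R0pos: "R0 > 0" using less_le_trans[OF R(1) R0[OF SOME_Basis]] .
    define Q where "Q = {x::'b. \<forall>b\<in>Basis. \<bar>x \<bullet> b\<bar> \<le> R0}"
    have Qm[measurable]: "Q \<in> sets borel" unfolding Q_def by measurable
    have out: "x \<in> (\<Union>b\<in>Basis. {x. \<bar>b \<bullet> x\<bar> > R b})" if "x \<notin> Q" for x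
      using that R0 unfolding Q_def by (force simp: inner_commute)
    have "uniformly_continuous_on Q f"
      unfolding Q_def by (rule compact_uniformly_continuous[OF continuous_on_subset[OF f(1)] compact_cube]) simp
    then obtain \<eta> where \<eta>: "\<eta> > 0" "\<And>x y. x \<in> Q \<Longrightarrow> y \<in> Q \<Longrightarrow> dist y x < \<eta> \<Longrightarrow> \<bar>f y - f x\<bar> < r"
      unfolding uniformly_continuous_on_def dist_real_def using r by blast
    \<comment> \<open>Large enough for the clamp to displace points of the cube \<open>Q\<close> by
      at most \<open>\<eta> / 2\<close>.\<close>
    define L where "L = DIM('b) * R0\<^sup>2 / (\<eta> / 2)"
    have L: "L > 0" using R0pos \<eta> by (auto simp: L_def)
    have near: "\<bar>f (sine_clamp L x) - f x\<bar> < r" if x: "x \<in> Q" for x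
    proof -
      have "dist (sine_clamp L x) x \<le> DIM('b) * (R0\<^sup>2 / L)"
        using x by (intro sine_clamp_dist[OF L]) (auto simp: Q_def)
      also have "\<dots> = \<eta> / 2" using R0pos \<eta> by (simp add: L_def field_simps)
      finally have dd: "dist (sine_clamp L x) x < \<eta>" using \<eta> by simp
      \<comment> \<open>Since \<open>|sin y| \<le> |y|\<close>, the clamp does not leave
        \<open>Q\<close>, the set on which \<open>f\<close> is known to be uniformly
        continuous.\<close>
      have "sine_clamp L x \<in> Q" unfolding Q_def
      proof (intro CollectI ballI)
        fix b :: 'b assume b: "b \<in> Basis"
        have "\<bar>sine_clamp L x \<bullet> b\<bar> = L * \<bar>sin ((x \<bullet> b) / L)\<bar>"
          using L by (simp add: sine_clamp_inner[OF b] abs_mult)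
        also have "\<dots> \<le> L * \<bar>(x \<bullet> b) / L\<bar>"
          using L by (intro mult_left_mono abs_sin_le_abs) auto
        also have "\<dots> = \<bar>x \<bullet> b\<bar>" using L by simp
        also have "\<dots> \<le> R0" using x b by (simp add: Q_def)
        finally show "\<bar>sine_clamp L x \<bullet> b\<bar> \<le> R0" .
      qed
      then show ?thesis using x dd by (intro \<eta>(2))
    qed
    define W where "W = {x::'b. \<forall>b\<in>Basis. \<bar>x \<bullet> b\<bar> \<le> L}"
    have inW: "sine_clamp L x \<in> W" for x
      unfolding W_def using L by (auto simp: sine_clamp_inner abs_mult mult_left_le)
    obtain h where h: "real_polynomial_function h" "\<And>x. x \<in> W \<Longrightarrow> \<bar>f x - h x\<bar> < r"
      using Stone_Weierstrass_real_polynomial_function[of W f r] continuous_on_subset[OF f(1)] r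
      compact_cube[of L] unfolding W_def by auto
    define T where "T x = h (sine_clamp L x)" for x
    have Tp: "trig_poly (\<lambda>x. of_real (T x))" unfolding T_def by (rule trig_poly_sine_clamp) fact
    have Tm[measurable]: "T \<in> borel_measurable borel"
      using measurable_compose[OF trig_poly_measurable[OF Tp] borel_measurable_Re] by simp
    have Tclose: "\<bar>f (sine_clamp L x) - T x\<bar> < r" for x unfolding T_def by (rule h(2)[OF inW])
    have Tb: "\<bar>T x\<bar> \<le> B + r" for x using Tclose[of x] B(2)[of "sine_clamp L x"] by linarith
    have d: "\<bar>f x - T x\<bar> \<le> 2 * r + 2 * B * indicator (- Q) x" for x
      using Tclose[of x] near[of x] B(2)[of "sine_clamp L x"] B(2)[of x] r
      by (cases "x \<in> Q") auto
    have "(\<lambda>n. \<integral>\<omega>. of_real (T (Y n \<omega>)) \<partial>M) \<longlonglongrightarrow> (\<integral>x. of_real (T x) \<partial>\<mu> :: complex)"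
      by (rule trig_poly_tendsto[OF Y \<mu> sets_\<mu> char Tp])
    then have "(\<lambda>n. \<integral>\<omega>. T (Y n \<omega>) \<partial>M) \<longlonglongrightarrow> (\<integral>x. T x \<partial>\<mu>)"
      by (simp only: integral_complex_of_real tendsto_of_real_iff)
    from tendstoD[OF this r] have evT: "\<forall>\<^sub>F n in sequentially. \<bar>(\<integral>\<omega>. T (Y n \<omega>) \<partial>M) - (\<integral>x. T x \<partial>\<mu>)\<bar> < r"
      by (simp add: dist_real_def)
    have m1: "\<bar>(\<integral>x. f x \<partial>\<mu>) - (\<integral>x. T x \<partial>\<mu>)\<bar> \<le> 2 * r + 2 * B * measure \<mu> (- Q)"
      by (rule \<mu>.integral_close[where B=B and C="B + r"]) (use B(2) Tb d in auto)
    have "measure \<mu> (- Q) \<le> measure \<mu> (\<Union>b\<in>Basis. {x\<in>space \<mu>. \<bar>b \<bullet> x\<bar> > R b})"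
      using out sets_eq_imp_space_eq[OF sets_\<mu>] by (intro \<mu>.finite_measure_mono) auto
    also have "\<dots> \<le> (\<Sum>b\<in>Basis. measure \<mu> {x\<in>space \<mu>. \<bar>b \<bullet> x\<bar> > R b})"
      by (rule \<mu>.finite_measure_subadditive_finite) auto
    also have "\<dots> \<le> (\<Sum>b\<in>(Basis::'b set). s)" using R(3) by (intro sum_mono less_imp_le) 
    finally have m2: "2 * B * measure \<mu> (- Q) \<le> r" using B(1) by (simp add: s_def field_simps)
    have evQ: "\<forall>\<^sub>F n in sequentially. \<forall>b\<in>Basis. prob {\<omega>\<in>space M. \<bar>b \<bullet> Y n \<omega>\<bar> > R b} < s"
      using R(2) by (intro eventually_ball_finite) auto
    have "\<forall>\<^sub>F n in sequentially. dist (\<integral>\<omega>. f (Y n \<omega>) \<partial>M) (integral\<^sup>L \<mu> f) < e"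
      using evT evQ
    proof eventually_elim
      case (elim n)
      let ?A = "{\<omega>\<in>space M. Y n \<omega> \<notin> Q}"
      have n1: "\<bar>(\<integral>\<omega>. f (Y n \<omega>) \<partial>M) - (\<integral>\<omega>. T (Y n \<omega>) \<partial>M)\<bar> \<le> 2 * r + 2 * B * prob ?A"
        using B(2) Tb d
        by (intro integral_close[where B=B and C="B + r"]) (auto simp: indicator_def split: if_splits)
      have "prob ?A \<le> prob (\<Union>b\<in>Basis. {\<omega>\<in>space M. \<bar>b \<bullet> Y n \<omega>\<bar> > R b})"
        using out by (intro finite_measure_mono) auto
      also have "\<dots> \<le> (\<Sum>b\<in>Basis. prob {\<omega>\<in>space M. \<bar>b \<bullet> Y n \<omega>\<bar> > R b})"
        by (rule finite_measure_subadditive_finite) auto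
      also have "\<dots> \<le> (\<Sum>b\<in>(Basis::'b set). s)" using elim by (intro sum_mono less_imp_le) auto
      finally have "2 * B * prob ?A \<le> r" using B(1) by (simp add: s_def field_simps)
      moreover have "e = 10 * r" by (simp add: r_def)
      ultimately show ?case using n1 m1 m2 elim(1) r unfolding dist_real_def by linarith
    qed
    then show "\<exists>no. \<forall>n\<ge>no. dist (\<integral>\<omega>. f (Y n \<omega>) \<partial>M) (integral\<^sup>L \<mu> f) < e"
      by (simp add: eventually_sequentially)
  qed
  then show "(\<lambda>n. integral\<^sup>L (distr M borel (Y n)) f) \<longlonglongrightarrow> integral\<^sup>L \<mu> f"
    by (simp add: integral_distr)
qed

section \<open>Multivariate normal laws\<close>

abbreviation std_normal_product :: "('n::finite \<Rightarrow> real) measure" where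
  "std_normal_product \<equiv> PiM UNIV (\<lambda>_. std_normal_distribution)"

lemma prob_space_std_normal: "prob_space std_normal_distribution"
  using real_dist_normal_dist by (simp add: real_distribution_def)

lemma char_distr_cmult:
  assumes "real_distribution M"
  shows "char (distr M borel (\<lambda>x. s * x)) t = char M (s * t)"
proof -
  interpret real_distribution M by fact
  show ?thesis by (simp add: char_def integral_distr mult_ac)
qed

text \<open>Rotational invariance of the standard Gaussian: the exponents of the characteristic
  functions of the summands add up to a multiple of the squared norm of \<open>b\<close>.\<close>

lemma distr_std_normal_combination:
  fixes b :: "real^'n"
  shows "distr std_normal_product borel (\<lambda>\<omega>. \<Sum>i\<in>UNIV. b $ i * \<omega> i) =
    distr std_normal_distribution borel (\<lambda>x. norm b * x)"
proof (rule Levy_uniqueness)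
  interpret S: prob_space std_normal_distribution by (rule prob_space_std_normal)
  interpret P: prob_space "std_normal_product :: ('n \<Rightarrow> real) measure"
    by (intro prob_space_PiM prob_space_std_normal)
  have comp: "distr std_normal_product borel (\<lambda>\<omega>. c * \<omega> i) = distr std_normal_distribution borel (\<lambda>x. c * x)"
    for c and i :: 'n
  proof -
    have "distr (distr std_normal_product std_normal_distribution (\<lambda>\<omega>. \<omega> i)) borel (\<lambda>x. c * x) =
        distr (std_normal_product :: ('n \<Rightarrow> real) measure) borel ((\<lambda>x. c * x) \<circ> (\<lambda>\<omega>. \<omega> i))"
      by (rule distr_distr) auto
    then show ?thesis
      by (subst (asm) distr_PiM_component) (auto simp: o_def prob_space_std_normal)
  qed
  \<comment> \<open>Independence is checked on the joint law. The coordinates taken together are the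
    identity map, so only the marginals need computing.\<close>
  have "distr std_normal_product std_normal_distribution (\<lambda>\<omega>. \<omega> i) = std_normal_distribution" for i :: 'n
    by (rule distr_PiM_component) (auto simp: prob_space_std_normal)
  then have "P.indep_vars (\<lambda>i. std_normal_distribution) (\<lambda>i \<omega>. \<omega> i) (UNIV :: 'n set)"
    by (subst P.indep_vars_iff_distr_eq_PiM)
      (auto simp: restrict_UNIV distr_id2)
  then have ind: "P.indep_vars (\<lambda>i. borel) (\<lambda>i \<omega>. b $ i * \<omega> i) UNIV"
    by (rule P.indep_vars_compose2) simp
  have m[measurable]: "(\<lambda>\<omega>. \<Sum>i\<in>UNIV. b $ i * \<omega> i) \<in> borel_measurable (std_normal_product :: ('n \<Rightarrow> real) measure)"
    using ind unfolding P.indep_vars_def by (intro borel_measurable_sum) auto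
  show "real_distribution (distr std_normal_product borel (\<lambda>\<omega>. \<Sum>i\<in>UNIV. b $ i * \<omega> i))"
    by (rule P.real_distribution_distr) simp
  show "real_distribution (distr std_normal_distribution borel (\<lambda>x. norm b * x))"
    by (rule S.real_distribution_distr) simp
  show "char (distr std_normal_product borel (\<lambda>\<omega>. \<Sum>i\<in>UNIV. b $ i * \<omega> i)) =
      char (distr std_normal_distribution borel (\<lambda>x. norm b * x))"
  proof
    fix t
    have "char (distr std_normal_product borel (\<lambda>\<omega>. \<Sum>i\<in>UNIV. b $ i * \<omega> i)) t =
        (\<Prod>i\<in>UNIV. char (distr std_normal_product borel (\<lambda>\<omega>. b $ i * \<omega> i)) t)"
      by (rule P.char_distr_sum[OF ind])
    also have "\<dots> = (\<Prod>i\<in>UNIV. of_real (exp (- ((b $ i * t)\<^sup>2) / 2)))"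
      by (simp only: comp char_distr_cmult[OF real_dist_normal_dist] char_std_normal_distribution)
    also have "\<dots> = of_real (exp (\<Sum>i\<in>UNIV. - ((b $ i * t)\<^sup>2) / 2))"
      by (simp only: of_real_prod exp_sum[OF finite])
    also have "(\<Sum>i\<in>UNIV. - ((b $ i * t)\<^sup>2) / 2) = - ((norm b * t)\<^sup>2) / 2"
      by (simp add: norm_vec_def L2_set_def sum_nonneg power_mult_distrib sum_negf sum_divide_distrib sum_distrib_right)
    also have "of_real (exp (- ((norm b * t)\<^sup>2) / 2)) = char (distr std_normal_distribution borel (\<lambda>x. norm b * x)) t"
      by (simp only: char_distr_cmult[OF real_dist_normal_dist] char_std_normal_distribution)
    finally show "char (distr std_normal_product borel (\<lambda>\<omega>. \<Sum>i\<in>UNIV. b $ i * \<omega> i)) t =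
      char (distr std_normal_distribution borel (\<lambda>x. norm b * x)) t" .
  qed
qed

lemma distr_std_normal_scale:
  assumes "s \<ge> 0"
  shows "distr std_normal_distribution borel (\<lambda>x. s * x) = real_normal_law 0 (s\<^sup>2)"
proof (cases "s = 0")
  case True
  interpret S: prob_space std_normal_distribution by (rule prob_space_std_normal)
  show ?thesis using True by (simp add: real_normal_law_def S.distr_const)
next
  case False
  interpret S: prob_space std_normal_distribution by (rule prob_space_std_normal)
  have s: "s > 0" using False assms by simp
  have "distributed std_normal_distribution lborel (\<lambda>x. x) std_normal_density"
    by (auto simp: distributed_def distr_id2)
  then have "distributed std_normal_distribution lborel (\<lambda>x. s * x) (normal_density 0 s)"
    using s by (subst S.normal_standard_normal_convert[OF s]) simp
  then have "distr std_normal_distribution lborel (\<lambda>x. s * x) = density lborel (normal_density 0 s)"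
    by (simp add: distributed_def)
  moreover have "distr std_normal_distribution lborel (\<lambda>x. s * x) = distr std_normal_distribution borel (\<lambda>x. s * x)"
    by (rule distr_cong) auto
  ultimately show ?thesis using s by (simp add: real_normal_law_def)
qed

text \<open>The law of \<open>A\<close> applied to independent standard normals. Everything is read
  off the projections \<open>a \<bullet> x\<close>, each distributed as \<open>norm (a v* A)\<close>
  times a standard normal.\<close>

theorem multivariate_normal_exists:
  fixes A :: "real^'n^'n"
  obtains \<mu> where "multivariate_normal 0 (A ** transpose A) \<mu>"
    and "prob_space \<mu>" and "sets \<mu> = sets borel"
    and "\<And>a. (\<integral>x. iexp (a \<bullet> x) \<partial>\<mu>) = of_real (exp (- (norm (a v* A))\<^sup>2 / 2))"
proof -
  interpret S: prob_space std_normal_distribution by (rule prob_space_std_normal)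
  let ?N = "std_normal_product :: ('n \<Rightarrow> real) measure"
  interpret P: prob_space ?N
    by (intro prob_space_PiM prob_space_std_normal)
  define F where "F \<omega> = A *v (\<chi> i. \<omega> i)" for \<omega> :: "'n \<Rightarrow> real"
  have coord: "(\<lambda>\<omega>. \<omega> i) \<in> borel_measurable ?N" for i
  proof -
    have "(\<lambda>\<omega>. \<omega> i) \<in> measurable ?N std_normal_distribution" by measurable
    then show ?thesis by (simp cong: measurable_cong_sets)
  qed
  have [measurable]: "F \<in> borel_measurable ?N"
  proof (rule borel_measurable_euclidean_space[THEN iffD2], rule ballI)
    fix b :: "real^'n" assume "b \<in> Basis"
    then obtain i where b: "b = axis i 1" by (auto simp: Basis_vec_def)
    have "(\<lambda>\<omega>. F \<omega> \<bullet> b) = (\<lambda>\<omega>. \<Sum>j\<in>UNIV. A $ i $ j * \<omega> j)"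
      by (auto simp: b inner_axis F_def matrix_vector_mult_def)
    then show "(\<lambda>\<omega>. F \<omega> \<bullet> b) \<in> borel_measurable ?N"
      using coord by (auto intro!: borel_measurable_sum borel_measurable_times)
  qed
  define \<mu> where "\<mu> = distr ?N borel F"
  interpret \<mu>: prob_space \<mu> unfolding \<mu>_def by (rule P.prob_space_distr) simp
  have sets_\<mu>[measurable_cong]: "sets \<mu> = sets borel" by (simp add: \<mu>_def)
  have proj: "distr \<mu> borel (\<lambda>x. a \<bullet> x) = distr std_normal_distribution borel (\<lambda>x. norm (a v* A) * x)" for a
  proof -
    have "distr \<mu> borel (\<lambda>x. a \<bullet> x) = distr ?N borel ((\<lambda>x. a \<bullet> x) \<circ> F)"
      unfolding \<mu>_def by (rule distr_distr) auto
    also have "(\<lambda>x. a \<bullet> x) \<circ> F = (\<lambda>\<omega>. \<Sum>i\<in>UNIV. (a v* A) $ i * \<omega> i)"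
      unfolding comp_def F_def dot_lmul_matrix[symmetric] by (simp add: inner_vec_def)
    finally show ?thesis by (simp only: distr_std_normal_combination)
  qed
  have integ: "integral\<^sup>L \<mu> (\<lambda>x. h (a \<bullet> x)) = integral\<^sup>L std_normal_distribution (\<lambda>x. h (norm (a v* A) * x))"
    if [measurable]: "h \<in> borel_measurable borel" for h :: "real \<Rightarrow> 'b::{banach, second_countable_topology}" and a
  proof -
    have "integral\<^sup>L \<mu> (\<lambda>x. h (a \<bullet> x)) = integral\<^sup>L (distr \<mu> borel (\<lambda>x. a \<bullet> x)) h" by (rule integral_distr[symmetric]) auto
    also have "\<dots> = integral\<^sup>L std_normal_distribution (\<lambda>x. h (norm (a v* A) * x))"
      unfolding proj by (rule integral_distr) auto
    finally show ?thesis .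
  qed
  have intgb: "integrable \<mu> (\<lambda>x. (a \<bullet> x)^k)" for a k
  proof -
    have "integrable (distr \<mu> borel (\<lambda>x. a \<bullet> x)) (\<lambda>x. x^k)"
      unfolding proj by (subst integrable_distr_eq)
        (auto simp: power_mult_distrib intro!: integrable_mult_right integrable_std_normal_distribution_moment)
    then show ?thesis by (subst (asm) integrable_distr_eq) auto
  qed
  have m1: "(\<integral>x. a \<bullet> x \<partial>\<mu>) = 0" for a
    using integ[of "\<lambda>x. x" a] integral_std_normal_distribution_moment_odd[of 1] by simp
  have m2: "(\<integral>x. (a \<bullet> x)\<^sup>2 \<partial>\<mu>) = (norm (a v* A))\<^sup>2" for a
    using integ[of "\<lambda>x. x\<^sup>2" a] std_normal_distribution_even_moments(1)[of 1] by (simp add: power_mult_distrib)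
  have chr: "(\<integral>x. iexp (a \<bullet> x) \<partial>\<mu>) = of_real (exp (- (norm (a v* A))\<^sup>2 / 2))" for a
    using integ[of "iexp" a] fun_cong[OF char_std_normal_distribution, of "norm (a v* A)"]
    by (simp add: char_def)
  \<comment> \<open>Polarization: mixed moments come from the second moments of the projections
    along two axes and along their sum.\<close>
  have cov: "(\<integral>x. x $ i * x $ k \<partial>\<mu>) = (A ** transpose A) $ i $ k" for i k
  proof -
    let ?a = "axis i 1 :: real^'n" and ?c = "axis k 1 :: real^'n"
    have "(\<integral>x. x $ i * x $ k \<partial>\<mu>) = (\<integral>x. (((?a + ?c) \<bullet> x)\<^sup>2 - (?a \<bullet> x)\<^sup>2 - (?c \<bullet> x)\<^sup>2) / 2 \<partial>\<mu>)"
      by (rule Bochner_Integration.integral_cong)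
        (auto simp: inner_add_left inner_axis' power2_eq_square algebra_simps)
    also have "\<dots> = ((\<integral>x. ((?a + ?c) \<bullet> x)\<^sup>2 \<partial>\<mu>) - (\<integral>x. (?a \<bullet> x)\<^sup>2 \<partial>\<mu>) - (\<integral>x. (?c \<bullet> x)\<^sup>2 \<partial>\<mu>)) / 2"
      by (simp add: intgb)
    also have "\<dots> = ((norm ((?a + ?c) v* A))\<^sup>2 - (norm (?a v* A))\<^sup>2 - (norm (?c v* A))\<^sup>2) / 2"
      by (simp only: m2)
    also have "\<dots> = (?a v* A) \<bullet> (?c v* A)"
      by (simp add: vector_matrix_left_distrib power2_norm_eq_inner inner_add_left inner_add_right inner_commute)
    also have "\<dots> = (A ** transpose A) $ i $ k"
      by (simp add: inner_vec_def vector_matrix_mult_def axis_def matrix_matrix_mult_def transpose_def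
          if_distrib[of "\<lambda>x. x * _"] if_distrib[of "\<lambda>x. _ * x"] cong: if_cong)
    finally show ?thesis .
  qed
  show thesis
  proof (rule that)
    show "multivariate_normal 0 (A ** transpose A) \<mu>"
      unfolding multivariate_normal_def gaussian_law_def
    proof (intro conjI allI)
      show "\<exists>m v. v \<ge> 0 \<and> distr \<mu> borel (\<lambda>x. a \<bullet> x) = real_normal_law m v" for a
        unfolding proj distr_std_normal_scale[OF norm_ge_zero]
        by (intro exI[of _ 0] exI[of _ "(norm (a v* A))\<^sup>2"]) simp
      show "(\<integral>x. x $ i \<partial>\<mu>) = 0 $ i" for i using m1[of "axis i 1"] by (simp add: inner_axis')
      show "(\<integral>x. (x $ i - 0 $ i) * (x $ j - 0 $ j) \<partial>\<mu>) = (A ** transpose A) $ i $ j" for i j using cov by simp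
    qed (auto simp: sets_\<mu> \<mu>.prob_space_axioms)
  qed (auto simp: sets_\<mu> \<mu>.prob_space_axioms chr)
qed

text \<open>The orthogonal projection onto vectors of coordinate sum 0, divided by the square root
  of the dimension. A projection is symmetric and equals its square, so this is a square root of the
  limit covariance.\<close>

definition centering_matrix :: "real^'n^'n" where
  "centering_matrix = (\<chi> i j. ((if i = j then 1 else 0) - 1 / real CARD('n)) / sqrt (real CARD('n)))"

lemma centering_matrix_square:
  "centering_matrix ** transpose centering_matrix =
    (1 / real CARD('n)) *\<^sub>R mat 1 - (1 / (real CARD('n))\<^sup>2) *\<^sub>R (\<chi> i j. 1 :: real^'n^'n)"
proof -
  let ?d = "real CARD('n)"
  have "(\<Sum>k\<in>UNIV. (((if i = k then 1 else 0) - 1 / ?d) / sqrt ?d) * (((if j = k then 1 else 0) - 1 / ?d) / sqrt ?d)) =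
      (1 / ?d) * (if i = j then 1 else 0) - 1 / ?d\<^sup>2" for i j :: 'n
  proof -
    have "(\<Sum>k\<in>UNIV. (((if i = k then 1 else 0) - 1 / ?d) / sqrt ?d) * (((if j = k then 1 else 0) - 1 / ?d) / sqrt ?d)) =
      (\<Sum>k\<in>UNIV. ((if i = k then (if i = j then 1 else 0) else 0) - (if i = k then 1 / ?d else 0)
         - (if j = k then 1 / ?d else 0) + 1 / ?d\<^sup>2) / ?d)"
      by (rule sum.cong) (auto simp: field_simps power2_eq_square)
    also have "\<dots> = ((if i = j then 1 else 0) - 1 / ?d - 1 / ?d + ?d * (1 / ?d\<^sup>2)) / ?d"
      by (simp add: sum_divide_distrib[symmetric] sum.distrib sum_subtractf)
    also have "\<dots> = (1 / ?d) * (if i = j then 1 else 0) - 1 / ?d\<^sup>2"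
      by (simp add: field_simps power2_eq_square)
    finally show ?thesis .
  qed
  then show ?thesis
    by (simp add: centering_matrix_def matrix_matrix_mult_def transpose_def vec_eq_iff mat_def)
qed

lemma norm_centering_matrix:
  fixes a :: "real^'n"
  shows "(norm (a v* centering_matrix))\<^sup>2 =
    (\<Sum>i\<in>UNIV. (a $ i - (\<Sum>j\<in>UNIV. a $ j) / real CARD('n))\<^sup>2) / real CARD('n)"
proof -
  let ?d = "real CARD('n)"
  have "(a v* centering_matrix) $ i = (a $ i - (\<Sum>j\<in>UNIV. a $ j) / ?d) / sqrt ?d" for i
  proof -
    have "(a v* centering_matrix) $ i = (\<Sum>j\<in>UNIV. ((if j = i then a $ j else 0) - a $ j / ?d) / sqrt ?d)"
      unfolding vector_matrix_mult_def centering_matrix_def by (auto intro!: sum.cong simp: field_simps)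
    then show ?thesis by (simp add: sum_divide_distrib[symmetric] sum_subtractf)
  qed
  then show ?thesis
    by (simp add: norm_vec_def L2_set_def sum_nonneg power_divide sum_divide_distrib)
qed

section \<open>Convolution on a finite abelian group\<close>

text \<open>A variance is at least the part of it carried by two points. Keeping this part, instead
  of Jensen's inequality alone, is what makes convolution contract strictly.\<close>

lemma weighted_variance_ge_pair:
  fixes w v :: "'i \<Rightarrow> real"
  assumes "finite A" "\<And>x. x \<in> A \<Longrightarrow> 0 \<le> w x" "sum w A = 1" "a \<in> A" "b \<in> A"
  shows "(\<Sum>x\<in>A. w x * v x)\<^sup>2 \<le> (\<Sum>x\<in>A. w x * (v x)\<^sup>2) - w a * w b * (v a - v b)\<^sup>2"
proof -
  define m where "m = (\<Sum>x\<in>A. w x * v x)"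
  have "(\<Sum>x\<in>A. w x * (v x - m)\<^sup>2) = (\<Sum>x\<in>A. w x * (v x)\<^sup>2 - 2 * m * (w x * v x) + m\<^sup>2 * w x)"
    by (rule sum.cong) (auto simp: power2_eq_square algebra_simps)
  also have "\<dots> = (\<Sum>x\<in>A. w x * (v x)\<^sup>2) - 2 * m * m + m\<^sup>2"
    by (simp add: sum.distrib sum_subtractf sum_distrib_left[symmetric] m_def assms(3))
  finally have var: "(\<Sum>x\<in>A. w x * (v x - m)\<^sup>2) = (\<Sum>x\<in>A. w x * (v x)\<^sup>2) - m\<^sup>2"
    by (simp add: power2_eq_square)
  have "w a * w b * (v a - v b)\<^sup>2 \<le> (\<Sum>x\<in>A. w x * (v x - m)\<^sup>2)"
  proof (cases "a = b")
    case True
    then show ?thesis using assms by (auto intro!: sum_nonneg)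
  next
    case False
    have "sum w {a, b} \<le> sum w A" using assms by (intro sum_mono2) auto
    then have ab: "w a + w b \<le> 1" using False assms by simp
    have nn: "0 \<le> w a" "0 \<le> w b" using assms by auto
    \<comment> \<open>Cauchy-Schwarz for two weighted points with its defect written out;
      \<open>w a + w b \<le> 1\<close> then removes the leading factor.\<close>
    have "0 \<le> (w a * (v a - m) + w b * (v b - m))\<^sup>2" by simp
    also have "\<dots> = (w a + w b) * (w a * (v a - m)\<^sup>2 + w b * (v b - m)\<^sup>2) - w a * w b * (v a - v b)\<^sup>2"
      by (simp add: power2_eq_square algebra_simps)
    also have "\<dots> \<le> 1 * (w a * (v a - m)\<^sup>2 + w b * (v b - m)\<^sup>2) - w a * w b * (v a - v b)\<^sup>2"
      using ab nn by (intro diff_right_mono mult_right_mono) auto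
    also have "w a * (v a - m)\<^sup>2 + w b * (v b - m)\<^sup>2 = (\<Sum>x\<in>{a,b}. w x * (v x - m)\<^sup>2)" using False by simp
    also have "\<dots> \<le> (\<Sum>x\<in>A. w x * (v x - m)\<^sup>2)" using assms by (intro sum_mono2) auto
    finally show ?thesis by simp
  qed
  then show ?thesis using var unfolding m_def by linarith
qed

lemma L2_set_sum_le:
  "finite I \<Longrightarrow> L2_set (\<lambda>h. \<Sum>i\<in>I. f i h) A \<le> (\<Sum>i\<in>I. L2_set (f i) A)"
proof (induction rule: finite_induct)
  case (insert i I)
  then show ?case using L2_set_triangle_ineq[of "f i" "\<lambda>h. \<Sum>i\<in>I. f i h" A] by simp
qed (simp add: L2_set_def)

lemma L2_set_uminus: "L2_set (\<lambda>h. - f h) A = L2_set f A"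
  by (simp add: L2_set_def)

section \<open>Convolution and its powers\<close>

locale finite_comm_group = comm_group G for G (structure) +
  assumes finite_carrier [simp, intro]: "finite (carrier G)"
begin

abbreviation card_G :: real where "card_G \<equiv> real (order G)"

abbreviation l2 :: "('a \<Rightarrow> real) \<Rightarrow> real" where "l2 v \<equiv> L2_set v (carrier G)"

definition prob_weights :: "('a \<Rightarrow> real) \<Rightarrow> bool" where
  "prob_weights w \<longleftrightarrow> (\<forall>x\<in>carrier G. 0 \<le> w x) \<and> sum w (carrier G) = 1"

definition shift :: "'a \<Rightarrow> ('a \<Rightarrow> real) \<Rightarrow> 'a \<Rightarrow> real" where
  "shift x v h = v (inv x \<otimes> h)"

definition convol :: "('a \<Rightarrow> real) \<Rightarrow> ('a \<Rightarrow> real) \<Rightarrow> 'a \<Rightarrow> real" where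
  "convol w v h = (\<Sum>x\<in>carrier G. w x * v (inv x \<otimes> h))"

text \<open>The law of the product of \<open>m\<close> independent draws from \<open>w\<close>. Each
  new factor is multiplied on the left, which matches \<open>foldr\<close> on the list of
  draws.\<close>

definition conv_power :: "('a \<Rightarrow> real) \<Rightarrow> nat \<Rightarrow> 'a \<Rightarrow> real" where
  "conv_power w m = (convol w ^^ m) (\<lambda>h. if h = \<one> then 1 else 0)"

definition excess :: "('a \<Rightarrow> real) \<Rightarrow> 'a \<Rightarrow> real" where
  "excess w h = w h - 1 / card_G"

definition translate :: "'a set \<Rightarrow> 'a \<Rightarrow> 'a set" where
  "translate H c = {x \<in> carrier G. x \<otimes> inv c \<in> H}"

lemma card_G_pos: "card_G > 0"
  using order_gt_0_iff_finite by simp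

lemma carrier_nonempty [simp]: "carrier G \<noteq> {}"
  using one_closed by blast

lemma prob_weights_nonneg: "prob_weights w \<Longrightarrow> x \<in> carrier G \<Longrightarrow> 0 \<le> w x"
  by (simp add: prob_weights_def)

lemma prob_weights_sum: "prob_weights w \<Longrightarrow> sum w (carrier G) = 1"
  by (simp add: prob_weights_def)

lemma prob_weights_sum_compl:
  "prob_weights w \<Longrightarrow> A \<subseteq> carrier G \<Longrightarrow> sum w (carrier G - A) = 1 - sum w A"
  by (simp add: prob_weights_def sum_diff)

lemma cancel_left [simp]:
  assumes "x \<in> carrier G" "y \<in> carrier G"
  shows "inv x \<otimes> (x \<otimes> y) = y" "x \<otimes> (inv x \<otimes> y) = y"
  using assms by (simp_all add: m_assoc[symmetric])

lemma sum_shift: "x \<in> carrier G \<Longrightarrow> (\<Sum>h\<in>carrier G. F (inv x \<otimes> h)) = (\<Sum>h\<in>carrier G. F h)"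
  by (rule sum.reindex_bij_witness[of _ "\<lambda>y. x \<otimes> y" "\<lambda>h. inv x \<otimes> h"]) auto

lemma sum_shift_inv:
  assumes h: "h \<in> carrier G"
  shows "(\<Sum>x\<in>carrier G. F (inv x \<otimes> h)) = (\<Sum>x\<in>carrier G. F x)"
proof -
  have "h \<otimes> inv (inv x \<otimes> h) = x" if x: "x \<in> carrier G" for x
    using h x by (simp add: inv_mult_group)
  moreover have "inv (h \<otimes> inv y) \<otimes> h = y" if y: "y \<in> carrier G" for y
    using h y by (simp add: inv_mult_group m_assoc)
  ultimately show ?thesis
    using h by (intro sum.reindex_bij_witness[of _ "\<lambda>y. h \<otimes> inv y" "\<lambda>x. inv x \<otimes> h"]) auto
qed

lemma conv_power_0: "conv_power w 0 h = (if h = \<one> then 1 else 0)"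
  by (simp add: conv_power_def)

lemma conv_power_Suc: "conv_power w (Suc m) = convol w (conv_power w m)"
  by (simp add: conv_power_def)

lemma conv_power_1: "h \<in> carrier G \<Longrightarrow> conv_power w (Suc 0) h = w h"
proof -
  assume h: "h \<in> carrier G"
  have "inv x \<otimes> h = \<one> \<longleftrightarrow> x = h" if "x \<in> carrier G" for x
    using that h inv_equality[of "inv x" h] inv_equality[of h "inv x"] by (auto simp: m_comm)
  then have "conv_power w (Suc 0) h = (\<Sum>x\<in>carrier G. w x * (if x = h then 1 else 0))"
    by (auto simp: conv_power_Suc convol_def conv_power_0 intro!: sum.cong)
  also have "\<dots> = (\<Sum>x\<in>carrier G. if x = h then w x else 0)"
    by (rule sum.cong) auto
  finally show ?thesis using h by simp
qed

lemma conv_power_nonneg: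
  assumes "prob_weights w" "h \<in> carrier G" shows "0 \<le> conv_power w m h"
  using assms(2)
proof (induction m arbitrary: h)
  case (Suc m)
  then show ?case using prob_weights_nonneg[OF assms(1)]
    by (auto simp: conv_power_Suc convol_def intro!: sum_nonneg)
qed (simp add: conv_power_0)

text \<open>Conditioning on the first factor \<open>x\<close>: the product lands in \<open>C\<close>
  exactly when the rest lands in the preimage of \<open>C\<close> under multiplication by
  \<open>x\<close>.\<close>

lemma sum_convol:
  assumes "C \<subseteq> carrier G"
  shows "(\<Sum>h\<in>C. convol w v h) = (\<Sum>x\<in>carrier G. w x * (\<Sum>y\<in>{y\<in>carrier G. x \<otimes> y \<in> C}. v y))"
proof -
  have "(\<Sum>h\<in>C. convol w v h) = (\<Sum>x\<in>carrier G. \<Sum>h\<in>C. w x * v (inv x \<otimes> h))"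
    unfolding convol_def by (rule sum.swap)
  also have "\<dots> = (\<Sum>x\<in>carrier G. \<Sum>y\<in>{y\<in>carrier G. x \<otimes> y \<in> C}. w x * v y)"
  proof (rule sum.cong[OF refl])
    fix x assume x: "x \<in> carrier G"
    show "(\<Sum>h\<in>C. w x * v (inv x \<otimes> h)) = (\<Sum>y\<in>{y\<in>carrier G. x \<otimes> y \<in> C}. w x * v y)"
    proof -
      have "x \<otimes> (inv x \<otimes> h) = h" "inv x \<otimes> (x \<otimes> h) = h" "inv x \<otimes> h \<in> carrier G" if "h \<in> carrier G" for h
        using x that by simp_all
      then show ?thesis using assms
        by (intro sum.reindex_bij_witness[of _ "\<lambda>y. x \<otimes> y" "\<lambda>h. inv x \<otimes> h"]) (auto simp: subset_iff)
    qed
  qed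
  finally show ?thesis by (simp add: sum_distrib_left)
qed

lemma sum_conv_power:
  assumes "prob_weights w" shows "sum (conv_power w m) (carrier G) = 1"
proof (induction m)
  case 0 then show ?case by (simp add: conv_power_0)
next
  case (Suc m)
  have "{y \<in> carrier G. x \<otimes> y \<in> carrier G} = carrier G" if "x \<in> carrier G" for x using that by auto
  then show ?case using Suc
    by (simp add: conv_power_Suc sum_convol prob_weights_sum[OF assms])
qed

lemma prob_weights_conv_power: "prob_weights w \<Longrightarrow> prob_weights (conv_power w m)"
  unfolding prob_weights_def[of "conv_power w m"] using conv_power_nonneg sum_conv_power by blast

section \<open>Escape of convolution powers from subgroups and cosets\<close>

lemma conv_power_leave_subgroup_Suc:
  assumes w: "prob_weights w" and H: "subgroup H G"
  defines "b \<equiv> sum w (carrier G - H)"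
  shows "sum (conv_power w (Suc m)) (carrier G - H) \<ge>
    b + (1 - 2 * b) * sum (conv_power w m) (carrier G - H)"
proof -
  interpret H: subgroup H G by fact
  let ?out = "sum (conv_power w m) (carrier G - H)"
  have nn: "0 \<le> conv_power w m y" if "y \<in> carrier G" for y using conv_power_nonneg[OF w that] .
  have cm: "prob_weights (conv_power w m)" using prob_weights_conv_power[OF w] .
  have sub: "H \<subseteq> carrier G" by (rule H.subset)
  have inn: "sum (conv_power w m) H = 1 - ?out"
    using prob_weights_sum_compl[OF cm sub] by simp
  have exact: "sum (conv_power w (Suc m)) (carrier G - H) =
      (\<Sum>x\<in>carrier G. w x * (\<Sum>y\<in>{y\<in>carrier G. x \<otimes> y \<in> carrier G - H}. conv_power w m y))"
    by (simp add: conv_power_Suc sum_convol)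
  \<comment> \<open>Two ways out are counted: a first factor in \<open>H\<close> keeps an outside
    product outside, and a first factor outside \<open>H\<close> takes a product in \<open>H\<close>
    outside. Outside times outside is dropped.\<close>
  have lower: "(\<Sum>x\<in>carrier G. w x * (if x \<in> H then ?out else 1 - ?out)) \<le>
      (\<Sum>x\<in>carrier G. w x * (\<Sum>y\<in>{y\<in>carrier G. x \<otimes> y \<in> carrier G - H}. conv_power w m y))"
  proof (intro sum_mono mult_left_mono)
    fix x assume x: "x \<in> carrier G"
    show "(if x \<in> H then ?out else 1 - ?out) \<le> (\<Sum>y\<in>{y\<in>carrier G. x \<otimes> y \<in> carrier G - H}. conv_power w m y)"
    proof (cases "x \<in> H")
      case True
      have "x \<otimes> y \<notin> H" if y: "y \<in> carrier G - H" for y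
      proof
        assume "x \<otimes> y \<in> H"
        then have "inv x \<otimes> (x \<otimes> y) \<in> H" by (rule H.m_closed[OF H.m_inv_closed[OF True]])
        then show False using y x by simp
      qed
      then have "carrier G - H \<subseteq> {y\<in>carrier G. x \<otimes> y \<in> carrier G - H}" using x by auto
      then show ?thesis using True nn by (auto intro!: sum_mono2)
    next
      case False
      have "x \<otimes> y \<notin> H" if y: "y \<in> H" for y
      proof
        assume "x \<otimes> y \<in> H"
        then have "(x \<otimes> y) \<otimes> inv y \<in> H" by (rule H.m_closed[OF _ H.m_inv_closed[OF y]])
        moreover have "(x \<otimes> y) \<otimes> inv y = x" using subsetD[OF sub y] x by (simp add: m_assoc)
        ultimately show False using False by simp
      qed
      then have "H \<subseteq> {y\<in>carrier G. x \<otimes> y \<in> carrier G - H}" using x False sub by auto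
      then have "sum (conv_power w m) H \<le> (\<Sum>y\<in>{y\<in>carrier G. x \<otimes> y \<in> carrier G - H}. conv_power w m y)"
        using nn by (intro sum_mono2) auto
      then show ?thesis using False inn by simp
    qed
  qed (use prob_weights_nonneg[OF w] in auto)
  have "(\<Sum>x\<in>carrier G. w x * (if x \<in> H then ?out else 1 - ?out)) =
      (\<Sum>x\<in>H. w x * ?out) + (\<Sum>x\<in>carrier G - H. w x * (1 - ?out))"
    by (subst sum.subset_diff[OF sub]) (simp_all add: add.commute)
  also have "\<dots> = sum w H * ?out + b * (1 - ?out)"
    by (simp add: b_def sum_distrib_right)
  also have "sum w H = 1 - b" using prob_weights_sum_compl[OF w sub] by (simp add: b_def)
  also have "(1 - b) * ?out + b * (1 - ?out) = b + (1 - 2 * b) * ?out" by (simp add: algebra_simps)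
  finally show ?thesis using lower exact by linarith
qed

text \<open>With \<open>b\<close> the outside mass, two draws give at least
  \<open>2 * b - 2 * b^2\<close>, and \<open>b \<le> 1 / 20\<close> turns this into
  \<open>19 / 10 * b\<close>. Further factors do not fall below this value. A rate close to 2, not
  merely above 1, is needed for the square-root function in \<open>drift_inequality\<close>.\<close>

lemma conv_power_leave_subgroup:
  assumes w: "prob_weights w" and H: "subgroup H G"
    and b: "sum w (carrier G - H) \<le> 1 / 20" and m: "m \<ge> 2"
  shows "sum (conv_power w m) (carrier G - H) \<ge> 19 / 10 * sum w (carrier G - H)"
proof -
  let ?b = "sum w (carrier G - H)"
  have b0: "0 \<le> ?b" using prob_weights_nonneg[OF w] by (auto intro!: sum_nonneg)
  have sq: "?b * ?b \<le> ?b / 20" using mult_left_mono[OF b b0] by simp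
  show ?thesis using m
  proof (induction m rule: nat_induct_at_least)
    case base
    have "sum (conv_power w 1) (carrier G - H) = ?b" by (auto intro!: sum.cong simp: conv_power_1)
    then have "sum (conv_power w 2) (carrier G - H) \<ge> ?b + (1 - 2 * ?b) * ?b"
      using conv_power_leave_subgroup_Suc[OF w H, of 1] by (simp add: numeral_2_eq_2)
    then show ?case using sq by (simp add: algebra_simps)
  next
    case (Suc m)
    have "(1 - 2 * ?b) * (19 / 10 * ?b) \<le> (1 - 2 * ?b) * sum (conv_power w m) (carrier G - H)"
      using Suc.IH b by (intro mult_left_mono) auto
    moreover have "(1 - 2 * ?b) * (19 / 10 * ?b) = 19 / 10 * ?b - 38 / 10 * (?b * ?b)"
      by (simp add: left_diff_distrib)
    ultimately show ?case using conv_power_leave_subgroup_Suc[OF w H, of m] sq b0 by linarith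
  qed
qed

lemma translate_subset: "translate H c \<subseteq> carrier G"
  by (auto simp: translate_def)

text \<open>If all \<open>m\<close> draws lie in the coset of \<open>c\<close>, their product lies
  in the coset of \<open>c [^] m\<close>.\<close>

lemma conv_power_translate:
  assumes w: "prob_weights w" and H: "subgroup H G" and c: "c \<in> carrier G"
  shows "sum (conv_power w m) (translate H (c [^] m)) \<ge> (sum w (translate H c)) ^ m"
proof (induction m)
  case 0
  interpret H: subgroup H G by fact
  have "\<one> \<in> translate H \<one>" by (simp add: translate_def)
  then have "sum (conv_power w 0) {\<one>} \<le> sum (conv_power w 0) (translate H \<one>)"
    using translate_subset finite_subset[OF translate_subset finite_carrier]
    by (intro sum_mono2) (auto simp: conv_power_0)
  then show ?case by (simp add: conv_power_0)
next
  case (Suc m)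
  interpret H: subgroup H G by fact
  have nn: "0 \<le> conv_power w m y" if "y \<in> carrier G" for y using conv_power_nonneg[OF w that] .
  let ?K = "translate H c" and ?Km = "translate H (c [^] m)" and ?KS = "translate H (c [^] Suc m)"
  have mult: "x \<otimes> y \<in> ?KS" if "x \<in> ?K" "y \<in> ?Km" for x y
  proof -
    have xy: "x \<in> carrier G" "y \<in> carrier G" using that by (auto simp: translate_def)
    have "(x \<otimes> inv c) \<otimes> (y \<otimes> inv (c [^] m)) \<in> H" using that by (auto simp: translate_def)
    also have "(x \<otimes> inv c) \<otimes> (y \<otimes> inv (c [^] m)) = (x \<otimes> y) \<otimes> inv (c [^] Suc m)"
      using xy c by (simp add: inv_mult m_ac)
    finally show ?thesis using xy by (simp add: translate_def)
  qed
  have "sum w ?K ^ Suc m \<le> sum w ?K * sum (conv_power w m) ?Km"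
    using Suc prob_weights_nonneg[OF w] by (auto intro!: mult_left_mono sum_nonneg simp: translate_def)
  also have "\<dots> = (\<Sum>x\<in>?K. w x * sum (conv_power w m) ?Km)" by (simp add: sum_distrib_right)
  also have "\<dots> \<le> (\<Sum>x\<in>?K. w x * (\<Sum>y\<in>{y\<in>carrier G. x \<otimes> y \<in> ?KS}. conv_power w m y))"
    using mult nn prob_weights_nonneg[OF w] translate_subset[of H "c [^] m"] translate_subset[of H c]
    by (intro sum_mono mult_left_mono sum_mono2) auto
  also have "\<dots> \<le> (\<Sum>x\<in>carrier G. w x * (\<Sum>y\<in>{y\<in>carrier G. x \<otimes> y \<in> ?KS}. conv_power w m y))"
    using translate_subset[of H c] nn prob_weights_nonneg[OF w]
    by (intro sum_mono2) (auto intro!: mult_nonneg_nonneg sum_nonneg)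
  also have "\<dots> = sum (conv_power w (Suc m)) ?KS"
    unfolding conv_power_Suc by (rule sum_convol[symmetric, OF translate_subset])
  finally show ?case .
qed

text \<open>Bezout gives \<open>k * x = order G * y + 1\<close>, so \<open>c\<close> is a power of
  \<open>c [^] k\<close> by Lagrange's theorem.\<close>

lemma coprime_root_in_subgroup:
  assumes H: "subgroup H G" and c: "c \<in> carrier G" and k: "k > 0" "gcd k (order G) = 1"
    and ck: "c [^] k \<in> H"
  shows "c \<in> H"
proof -
  interpret H: subgroup H G by fact
  obtain e x y where e: "e dvd k" "e dvd order G" "k * x = order G * y + e"
    using bezout_add_strong_nat[of k "order G"] k by blast
  have "e dvd gcd k (order G)" using e by (intro gcd_greatest)
  then have "k * x = order G * y + 1" using e k by simp
  then have "(c [^] k) [^] x = (c [^] order G) [^] y \<otimes> c"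
    using c by (simp add: nat_pow_pow nat_pow_mult[symmetric])
  also have "\<dots> = c" using c by (simp add: pow_order_eq_1)
  finally have cc: "(c [^] k) [^] x = c" .
  have "(c [^] k) [^] x \<in> H" by (induction x) (use ck in auto)
  then show ?thesis unfolding cc .
qed

text \<open>The cosets of \<open>c [^] m\<close> and \<open>c\<close> are disjoint, because
  \<open>c [^] (m - 1) \<in> H\<close> would put \<open>c\<close> into \<open>H\<close>. By
  Bernoulli's inequality all \<open>m\<close> draws fall into the coset of \<open>c\<close> with
  probability at least \<open>1 - m * b\<close>, where \<open>b\<close> is the mass outside
  it.\<close>

lemma conv_power_leave_translate:
  assumes w: "prob_weights w" and H: "subgroup H G" and c: "c \<in> carrier G" "c \<notin> H"
    and m: "m \<ge> 2" "gcd (m - 1) (order G) = 1"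
  shows "sum (conv_power w m) (carrier G - translate H c) \<ge> 1 - real m * sum w (carrier G - translate H c)"
proof -
  interpret H: subgroup H G by fact
  let ?b = "sum w (carrier G - translate H c)"
  have K: "sum w (translate H c) = 1 - ?b" using prob_weights_sum_compl[OF w translate_subset[of H c]] by simp
  have b: "0 \<le> sum w (translate H c)" using prob_weights_nonneg[OF w] by (auto intro!: sum_nonneg simp: translate_def)
  have disj: "translate H (c [^] m) \<subseteq> carrier G - translate H c"
  proof
    fix x assume x: "x \<in> translate H (c [^] m)"
    then have xc: "x \<in> carrier G" by (simp add: translate_def)
    have "x \<notin> translate H c"
    proof
      assume "x \<in> translate H c"
      then have "(x \<otimes> inv c) \<otimes> inv (x \<otimes> inv (c [^] m)) \<in> H" using x by (auto simp: translate_def)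
      also have "(x \<otimes> inv c) \<otimes> inv (x \<otimes> inv (c [^] m)) = c [^] (m - 1)"
      proof -
        have "c [^] m = c \<otimes> c [^] (m - 1)"
          using m c by (cases m) (auto simp: m_comm)
        moreover have "(x \<otimes> inv c) \<otimes> inv (x \<otimes> inv (c [^] m)) = inv c \<otimes> (x \<otimes> (inv x \<otimes> c [^] m))"
          using xc c by (simp add: inv_mult m_comm[of x "inv c"] m_assoc)
        moreover have "x \<otimes> (inv x \<otimes> c [^] m) = c [^] m"
          using xc c by simp
        ultimately show ?thesis using c by simp
      qed
      finally show False using coprime_root_in_subgroup[OF H c(1) _ m(2)] m c by auto
    qed
    then show "x \<in> carrier G - translate H c" using xc by simp
  qed
  have "1 - real m * ?b \<le> (1 - ?b) ^ m"
    using Bernoulli_inequality[of "- ?b" m] b K by simp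
  also have "\<dots> \<le> sum (conv_power w m) (translate H (c [^] m))"
    using conv_power_translate[OF w H c(1), of m] by (simp add: K)
  also have "\<dots> \<le> sum (conv_power w m) (carrier G - translate H c)"
    using disj conv_power_nonneg[OF w] by (intro sum_mono2) auto
  finally show ?thesis .
qed

section \<open>Contraction in L2 under convolution\<close>

lemma l2_cong: "(\<And>h. h \<in> carrier G \<Longrightarrow> u h = v h) \<Longrightarrow> l2 u = l2 v"
  by (rule L2_set_cong) auto

lemma l2_shift: "x \<in> carrier G \<Longrightarrow> l2 (shift x v) = l2 v"
  unfolding L2_set_def shift_def by (subst sum_shift) auto

lemma shift_shift: "x \<in> carrier G \<Longrightarrow> y \<in> carrier G \<Longrightarrow> h \<in> carrier G \<Longrightarrow> shift x (shift y v) h = shift (x \<otimes> y) v h"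
  by (simp add: shift_def inv_mult_group m_assoc)

lemma l2_shift_diff:
  assumes "a \<in> carrier G" "b \<in> carrier G"
  shows "l2 (\<lambda>h. shift a v h - shift (a \<otimes> b) v h) = l2 (\<lambda>h. v h - shift b v h)"
proof -
  have "l2 (\<lambda>h. shift a v h - shift (a \<otimes> b) v h) = l2 (shift a (\<lambda>h. v h - shift b v h))"
    using assms by (intro l2_cong) (simp add: shift_shift[symmetric], simp add: shift_def)
  then show ?thesis using assms by (simp add: l2_shift)
qed

text \<open>Convolution averages shifts of \<open>v\<close>, all of the same norm. At each point the
  shifts by \<open>a\<close> and \<open>a \<otimes> b\<close> contribute to the variance of this
  average; summed over the group, their difference becomes that of \<open>v\<close> and its shift by
  \<open>b\<close>.\<close>

lemma l2_convol_le:
  assumes w: "prob_weights w" and a: "a \<in> carrier G" and b: "b \<in> carrier G"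
  shows "(l2 (convol w v))\<^sup>2 \<le> (l2 v)\<^sup>2 - w a * w (a \<otimes> b) * (l2 (\<lambda>h. v h - shift b v h))\<^sup>2"
proof -
  have sq: "(l2 u)\<^sup>2 = (\<Sum>h\<in>carrier G. (u h)\<^sup>2)" for u
    by (simp add: L2_set_def sum_nonneg)
  have "(l2 (convol w v))\<^sup>2 = (\<Sum>h\<in>carrier G. (\<Sum>x\<in>carrier G. w x * shift x v h)\<^sup>2)"
    by (simp add: sq convol_def shift_def)
  also have "\<dots> \<le> (\<Sum>h\<in>carrier G. (\<Sum>x\<in>carrier G. w x * (shift x v h)\<^sup>2)
      - w a * w (a \<otimes> b) * (shift a v h - shift (a \<otimes> b) v h)\<^sup>2)"
    using w a b by (intro sum_mono weighted_variance_ge_pair) (auto simp: prob_weights_def)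
  also have "\<dots> = (\<Sum>h\<in>carrier G. \<Sum>x\<in>carrier G. w x * (shift x v h)\<^sup>2)
      - w a * w (a \<otimes> b) * (l2 (\<lambda>h. shift a v h - shift (a \<otimes> b) v h))\<^sup>2"
    by (simp add: sum_subtractf sq sum_distrib_left)
  also have "(\<Sum>h\<in>carrier G. \<Sum>x\<in>carrier G. w x * (shift x v h)\<^sup>2) = (\<Sum>x\<in>carrier G. w x * (l2 (shift x v))\<^sup>2)"
    by (subst sum.swap) (simp add: sq sum_distrib_left)
  also have "\<dots> = (l2 v)\<^sup>2"
    using prob_weights_sum[OF w] by (simp add: l2_shift sum_distrib_right[symmetric])
  finally show ?thesis using a b by (simp add: l2_shift_diff)
qed

lemma l2_convol_le_l2:
  assumes "prob_weights w" shows "l2 (convol w v) \<le> l2 v"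
proof -
  have "0 \<le> w \<one> * w (\<one> \<otimes> \<one>) * (l2 (\<lambda>h. v h - shift \<one> v h))\<^sup>2"
    using prob_weights_nonneg[OF assms] by simp
  then have "(l2 (convol w v))\<^sup>2 \<le> (l2 v)\<^sup>2"
    using l2_convol_le[OF assms one_closed one_closed, of v] by linarith
  then show ?thesis by (rule power2_le_imp_le) (simp add: L2_set_nonneg)
qed

text \<open>\<open>L\<close> is a word length: a shift by a product of generators telescopes into
  shifts by single generators and inverses. It is chosen before \<open>v\<close> and
  \<open>\<eta>\<close>, which makes the later contraction constant uniform.\<close>

lemma generate_shift_bound:
  assumes T: "T \<subseteq> carrier G" and "h \<in> generate G T"
  shows "\<exists>L::nat. \<forall>v \<eta>. 0 \<le> \<eta> \<longrightarrow> (\<forall>t\<in>T. l2 (\<lambda>h. v h - shift t v h) \<le> \<eta>) \<longrightarrow> l2 (\<lambda>k. v k - shift h v k) \<le> real L * \<eta>"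
  using assms(2)
proof induction
  case one
  have "l2 (\<lambda>k. v k - shift \<one> v k) = l2 (\<lambda>k. 0)" for v by (rule l2_cong) (simp add: shift_def)
  then show ?case by (intro exI[of _ 0]) (simp add: L2_set_def)
next
  case (incl h)
  then show ?case by (intro exI[of _ 1]) auto
next
  case (inv h)
  then have h: "h \<in> carrier G" using T by auto
  have "l2 (\<lambda>k. v k - shift (inv h) v k) = l2 (\<lambda>k. v k - shift h v k)" for v
  proof -
    have "l2 (\<lambda>k. v k - shift (inv h) v k) = l2 (\<lambda>k. shift h v k - shift (h \<otimes> inv h) v k)"
      using h by (intro l2_shift_diff[symmetric]) auto
    also have "\<dots> = l2 (\<lambda>k. - (v k - shift h v k))"
      using h by (intro l2_cong) (simp, simp add: shift_def)
    finally show ?thesis by (simp only: L2_set_uminus)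
  qed
  then show ?case using inv by (intro exI[of _ 1]) auto
next
  case (eng a b)
  have ab: "a \<in> carrier G" "b \<in> carrier G" using eng.hyps generate_in_carrier[OF T] by auto
  obtain L :: nat where L: "\<And>v \<eta>. 0 \<le> \<eta> \<Longrightarrow> (\<forall>t\<in>T. l2 (\<lambda>h. v h - shift t v h) \<le> \<eta>) \<Longrightarrow> l2 (\<lambda>k. v k - shift a v k) \<le> real L * \<eta>"
    using eng.IH(1) by blast
  obtain M :: nat where M:
    "\<And>v \<eta>. 0 \<le> \<eta> \<Longrightarrow> (\<forall>t\<in>T. l2 (\<lambda>h. v h - shift t v h) \<le> \<eta>) \<Longrightarrow> l2 (\<lambda>k. v k - shift b v k) \<le> real M * \<eta>"
    using eng.IH(2) by blast
  show ?case
  proof (intro exI[of _ "L + M"] allI impI)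
    fix v \<eta> assume v: "0 \<le> \<eta>" "\<forall>t\<in>T. l2 (\<lambda>h. v h - shift t v h) \<le> \<eta>"
    have "l2 (\<lambda>k. v k - shift (a \<otimes> b) v k) = l2 (\<lambda>k. (v k - shift a v k) + (shift a v k - shift (a \<otimes> b) v k))"
      by simp
    also have "\<dots> \<le> l2 (\<lambda>k. v k - shift a v k) + l2 (\<lambda>k. shift a v k - shift (a \<otimes> b) v k)"
      by (rule L2_set_triangle_ineq)
    also have "\<dots> \<le> real L * \<eta> + real M * \<eta>"
      unfolding l2_shift_diff[OF ab] by (intro add_mono L M v)
    finally show "l2 (\<lambda>k. v k - shift (a \<otimes> b) v k) \<le> real (L + M) * \<eta>" by (simp add: distrib_right)
  qed
qed

text \<open>There are finitely many pairs of a set and an element generated by it, so one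
  \<open>L\<close> serves all of them.\<close>

lemma uniform_shift_bound:
  "\<exists>L::nat. L > 0 \<and> (\<forall>T v \<eta>. T \<subseteq> carrier G \<and> generate G T = carrier G \<and> 0 \<le> \<eta> \<and>
      (\<forall>t\<in>T. l2 (\<lambda>h. v h - shift t v h) \<le> \<eta>) \<longrightarrow>
      (\<forall>h\<in>carrier G. l2 (\<lambda>k. v k - shift h v k) \<le> real L * \<eta>))"
proof -
  let ?P = "\<lambda>T h L. \<forall>v \<eta>. 0 \<le> \<eta> \<longrightarrow> (\<forall>t\<in>T. l2 (\<lambda>h. v h - shift t v h) \<le> \<eta>) \<longrightarrow> l2 (\<lambda>k. v k - shift h v k) \<le> real L * \<eta>"
  let ?S = "{(T, h). T \<subseteq> carrier G \<and> h \<in> generate G T}"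
  have "\<forall>p\<in>?S. \<exists>L. ?P (fst p) (snd p) L"
    using generate_shift_bound by auto
  from bchoice[OF this] obtain l where l: "\<forall>p\<in>?S. ?P (fst p) (snd p) (l p)" ..
  have "?S \<subseteq> Pow (carrier G) \<times> carrier G" using generate_in_carrier by auto
  then have fin: "finite ?S" by (rule finite_subset) auto
  define L where "L = Suc (Max (insert 0 (l ` ?S)))"
  have lL: "l p \<le> L" if "p \<in> ?S" for p
    unfolding L_def by (intro le_SucI Max_ge) (use fin that in auto)
  show ?thesis
  proof (intro exI[of _ L] conjI allI impI ballI)
    show "L > 0" by (simp add: L_def)
    fix T v \<eta> h
    assume a: "T \<subseteq> carrier G \<and> generate G T = carrier G \<and> 0 \<le> \<eta> \<and>
      (\<forall>t\<in>T. l2 (\<lambda>h. v h - shift t v h) \<le> \<eta>)" "h \<in> carrier G"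
    then have Th: "(T, h) \<in> ?S" by auto
    have "l2 (\<lambda>k. v k - shift h v k) \<le> real (l (T, h)) * \<eta>" using bspec[OF l Th] a by simp
    also have "\<dots> \<le> real L * \<eta>" using lL[OF Th] a by (intro mult_right_mono) auto
    finally show "l2 (\<lambda>k. v k - shift h v k) \<le> real L * \<eta>" .
  qed
qed

text \<open>As \<open>v\<close> has sum 0, averaging \<open>v - shift x v\<close> over all
  \<open>x\<close> returns \<open>v\<close>.\<close>

lemma l2_le_shift_bound:
  assumes v: "sum v (carrier G) = 0" and "\<And>h. h \<in> carrier G \<Longrightarrow> l2 (\<lambda>k. v k - shift h v k) \<le> B"
  shows "l2 v \<le> B"
proof -
  have "l2 (\<lambda>k. card_G * v k) = l2 (\<lambda>k. \<Sum>x\<in>carrier G. v k - shift x v k)"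
    by (rule l2_cong) (simp add: sum_subtractf shift_def sum_shift_inv v order_def)
  also have "\<dots> \<le> (\<Sum>x\<in>carrier G. l2 (\<lambda>k. v k - shift x v k))" by (rule L2_set_sum_le) simp
  also have "\<dots> \<le> (\<Sum>x\<in>carrier G. B)" by (intro sum_mono assms)
  finally have "card_G * l2 v \<le> card_G * B"
    by (simp add: L2_set_right_distrib[symmetric] order_def)
  then show ?thesis using card_G_pos by simp
qed

text \<open>Distance from the obstruction to contraction: convolution with a law living on one coset
  of \<open>H\<close> merely shifts the functions that are constant on the cosets of
  \<open>H\<close>, and for proper \<open>H\<close> some of these are nonzero with sum 0.\<close>

definition spread :: "real \<Rightarrow> ('a \<Rightarrow> real) \<Rightarrow> bool" where
  "spread \<rho> w \<longleftrightarrow> (\<forall>H c. subgroup H G \<longrightarrow> H \<noteq> carrier G \<longrightarrow> c \<in> carrier G \<longrightarrow>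
     \<rho> \<le> sum w (carrier G - translate H c))"

text \<open>Points of weight below \<open>\<rho> / card_G\<close> carry less than
  \<open>\<rho>\<close> together. If the quotients of the heavy points by \<open>a\<close> generated
  a proper subgroup, its coset of \<open>a\<close> would miss only light points, against
  \<open>spread\<close>.\<close>

lemma spread_heavy_generate:
  assumes w: "prob_weights w" and s: "spread \<rho> w" and \<rho>: "0 < \<rho>" "\<rho> \<le> 1"
  obtains a where "a \<in> carrier G" "w a \<ge> \<rho> / card_G"
    "generate G {t \<in> carrier G. w (a \<otimes> t) \<ge> \<rho> / card_G} = carrier G"
proof -
  have "\<exists>a\<in>carrier G. w a \<ge> \<rho> / card_G"
  proof (rule ccontr)
    assume "\<not> ?thesis"
    then have "sum w (carrier G) < (\<Sum>a\<in>carrier G. \<rho> / card_G)"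
      by (intro sum_strict_mono) (auto simp: not_le)
    also have "\<dots> = \<rho>" using card_G_pos by (simp add: order_def)
    finally show False using prob_weights_sum[OF w] \<rho> by simp
  qed
  then obtain a where a: "a \<in> carrier G" "w a \<ge> \<rho> / card_G" by blast
  let ?T = "{t \<in> carrier G. w (a \<otimes> t) \<ge> \<rho> / card_G}"
  have "generate G ?T = carrier G"
  proof (rule ccontr)
    assume ne: "generate G ?T \<noteq> carrier G"
    have sg: "subgroup (generate G ?T) G" by (rule generate_is_subgroup) auto
    let ?O = "carrier G - translate (generate G ?T) a"
    have small: "w x < \<rho> / card_G" if "x \<in> ?O" for x
    proof (rule ccontr)
      assume "\<not> w x < \<rho> / card_G"
      moreover have "a \<otimes> (x \<otimes> inv a) = x" using a that by (simp add: m_comm[of x] m_assoc[symmetric])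
      ultimately have "x \<otimes> inv a \<in> ?T" using that a by auto
      then have "x \<otimes> inv a \<in> generate G ?T" by (rule generate.incl)
      then show False using that by (auto simp: translate_def)
    qed
    have "sum w ?O < \<rho>"
    proof (cases "?O = {}")
      case True
      show ?thesis unfolding True using \<rho> by simp
    next
      case False
      then have "sum w ?O < (\<Sum>x\<in>?O. \<rho> / card_G)" using small by (intro sum_strict_mono) auto
      also have "\<dots> \<le> (\<Sum>x\<in>carrier G. \<rho> / card_G)"
        using \<rho> by (intro sum_mono2) auto
      also have "\<dots> = \<rho>" using card_G_pos by (simp add: order_def)
      finally show ?thesis .
    qed
    moreover have "\<rho> \<le> sum w ?O" using s sg ne a(1) unfolding spread_def by simp
    ultimately show False by simp
  qed
  then show thesis using that a by blast
qed

text \<open>If convolution loses little norm, \<open>v\<close> is almost invariant under the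
  quotients of heavy points, hence under the group they generate, hence small because its sum is 0.
  The constant depends on \<open>\<rho>\<close> and the group only.\<close>

theorem spread_contraction:
  assumes \<rho>: "0 < \<rho>" "\<rho> \<le> 1"
  obtains \<kappa> where "0 < \<kappa>" "\<kappa> < 1" and
    "\<And>w v. prob_weights w \<Longrightarrow> spread \<rho> w \<Longrightarrow> sum v (carrier G) = 0 \<Longrightarrow> l2 (convol w v) \<le> (1 - \<kappa>) * l2 v"
proof -
  from uniform_shift_bound obtain L :: nat where L: "L > 0" and bound: "(\<forall>T v \<eta>. T \<subseteq> carrier G \<and> generate G T = carrier G \<and> 0 \<le> \<eta> \<and>
      (\<forall>t\<in>T. l2 (\<lambda>h. v h - shift t v h) \<le> \<eta>) \<longrightarrow>
      (\<forall>h\<in>carrier G. l2 (\<lambda>k. v k - shift h v k) \<le> real L * \<eta>))"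
    by (elim exE conjE) (rule that)
  \<comment> \<open>The final estimate is
    \<open>l2 v \<le> L * sqrt \<Delta> * card_G / \<rho>\<close> with \<open>\<Delta>\<close> the
    loss in squared norm; \<open>\<epsilon>\<close> comes from solving it for
    \<open>\<Delta>\<close>. Halving it passes from squares to norms, as
    \<open>1 - \<epsilon> \<le> (1 - \<epsilon> / 2)^2\<close>.\<close>
  define \<epsilon> where "\<epsilon> = (\<rho> / (card_G * real L))\<^sup>2"
  have cL: "card_G \<ge> 1" "real L \<ge> 1" using card_G_pos L by auto
  have "\<rho> / (card_G * real L) \<le> 1"
    using mult_mono[OF cL] \<rho> card_G_pos L by (simp add: divide_le_eq)
  moreover have "0 < \<rho> / (card_G * real L)" using \<rho> L card_G_pos by simp
  ultimately have \<epsilon>: "0 < \<epsilon>" "\<epsilon> \<le> 1" unfolding \<epsilon>_def by (intro zero_less_power power_le_one; linarith)+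
  show thesis
  proof (rule that[of "\<epsilon> / 2"])
    show "0 < \<epsilon> / 2" "\<epsilon> / 2 < 1" using \<epsilon> by auto
    fix w v :: "'a \<Rightarrow> real"
    assume w: "prob_weights w" and s: "spread \<rho> w" and v: "sum v (carrier G) = 0"
    define \<Delta> where "\<Delta> = (l2 v)\<^sup>2 - (l2 (convol w v))\<^sup>2"
    obtain a where a: "a \<in> carrier G" "w a \<ge> \<rho> / card_G"
      "generate G {t \<in> carrier G. w (a \<otimes> t) \<ge> \<rho> / card_G} = carrier G"
      using spread_heavy_generate[OF w s \<rho>] by blast
    have \<Delta>0: "0 \<le> \<Delta>"
      unfolding \<Delta>_def using power_mono[OF l2_convol_le_l2[OF w, of v], of 2] by (simp add: L2_set_nonneg)
    have t: "l2 (\<lambda>h. v h - shift t v h) \<le> sqrt \<Delta> * card_G / \<rho>"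
      if "t \<in> {t \<in> carrier G. w (a \<otimes> t) \<ge> \<rho> / card_G}" for t
    proof -
      have "(\<rho> / card_G * l2 (\<lambda>h. v h - shift t v h))\<^sup>2 = \<rho> / card_G * (\<rho> / card_G) * (l2 (\<lambda>h. v h - shift t v h))\<^sup>2"
        by (simp add: power2_eq_square)
      also have "\<dots> \<le> w a * w (a \<otimes> t) * (l2 (\<lambda>h. v h - shift t v h))\<^sup>2"
        using that a \<rho> card_G_pos prob_weights_nonneg[OF w] by (intro mult_right_mono mult_mono) auto
      also have "\<dots> \<le> \<Delta>" using l2_convol_le[OF w a(1), of t v] that by (simp add: \<Delta>_def)
      finally have "\<rho> / card_G * l2 (\<lambda>h. v h - shift t v h) \<le> sqrt \<Delta>" by (rule real_le_rsqrt)
      then show ?thesis using \<rho> card_G_pos by (simp add: field_simps)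
    qed
    have nn: "0 \<le> sqrt \<Delta> * card_G / \<rho>" using \<Delta>0 \<rho> by simp
    have "l2 v \<le> real L * (sqrt \<Delta> * card_G / \<rho>)"
    proof (rule l2_le_shift_bound[OF v])
      fix h assume "h \<in> carrier G"
      then show "l2 (\<lambda>k. v k - shift h v k) \<le> real L * (sqrt \<Delta> * card_G / \<rho>)"
        using bound[rule_format, of "{t \<in> carrier G. w (a \<otimes> t) \<ge> \<rho> / card_G}" "sqrt \<Delta> * card_G / \<rho>" v h] t nn a(3)
        by simp
    qed
    then have "\<rho> / (card_G * real L) * l2 v \<le> sqrt \<Delta>"
      using \<rho> card_G_pos L by (simp add: field_simps)
    then have "(\<rho> / (card_G * real L) * l2 v)\<^sup>2 \<le> (sqrt \<Delta>)\<^sup>2"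
      using \<rho> by (intro power_mono) (auto simp: L2_set_nonneg)
    then have "\<epsilon> * (l2 v)\<^sup>2 \<le> \<Delta>" using \<Delta>0 by (simp only: \<epsilon>_def power_mult_distrib real_sqrt_pow2)
    then have "(l2 (convol w v))\<^sup>2 \<le> (1 - \<epsilon>) * (l2 v)\<^sup>2" by (simp add: \<Delta>_def algebra_simps)
    also have "\<dots> \<le> (1 - \<epsilon> / 2)\<^sup>2 * (l2 v)\<^sup>2"
      by (intro mult_right_mono) (auto simp: power2_eq_square algebra_simps)
    also have "\<dots> = ((1 - \<epsilon> / 2) * l2 v)\<^sup>2" by (simp add: power_mult_distrib)
    finally show "l2 (convol w v) \<le> (1 - \<epsilon> / 2) * l2 v"
      by (rule power2_le_imp_le) (use \<epsilon> in \<open>simp add: L2_set_nonneg\<close>)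
  qed
qed

section \<open>Deviation from the uniform law\<close>

lemma sum_excess: "prob_weights w \<Longrightarrow> sum (excess w) (carrier G) = 0"
  using card_G_pos by (simp add: excess_def sum_subtractf prob_weights_sum order_def)

lemma excess_convol:
  assumes "prob_weights w" "h \<in> carrier G"
  shows "excess (convol w v) h = convol w (excess v) h"
  using prob_weights_sum[OF assms(1)]
  by (simp add: excess_def convol_def right_diff_distrib sum_subtractf sum_divide_distrib[symmetric])

text \<open>Convolution with \<open>w\<close> never increases the norm, so every draw size is
  controlled by the case of two draws.\<close>

lemma l2_excess_conv_power:
  assumes w: "prob_weights w" and "m \<ge> 2"
  shows "l2 (excess (conv_power w m)) \<le> l2 (convol w (excess w))"
  using assms(2)
proof (induction m rule: nat_induct_at_least)
  case base
  have "excess (conv_power w 2) h = convol w (excess w) h" if h: "h \<in> carrier G" for h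
  proof -
    have "excess (conv_power w 2) h = convol w (excess (conv_power w (Suc 0))) h"
      unfolding numeral_2_eq_2 conv_power_Suc[of w "Suc 0"] by (rule excess_convol[OF w h])
    also have "\<dots> = convol w (excess w) h"
      unfolding convol_def excess_def using h by (intro sum.cong) (auto simp: conv_power_1)
    finally show ?thesis .
  qed
  then show ?case by (intro eq_refl l2_cong)
next
  case (Suc m)
  have "l2 (excess (conv_power w (Suc m))) = l2 (convol w (excess (conv_power w m)))"
    unfolding conv_power_Suc by (intro l2_cong excess_convol[OF w])
  then show ?case using Suc.IH l2_convol_le_l2[OF w, of "excess (conv_power w m)"] by linarith
qed

text \<open>Write \<open>w\<close> as uniform plus \<open>f\<close>. The uniform part annihilates
  \<open>f\<close>, which has sum 0, so what remains is \<open>f\<close> convolved with itself;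
  Cauchy-Schwarz bounds it pointwise by the squared norm of \<open>f\<close>.\<close>

lemma l2_convol_excess_quadratic:
  assumes w: "prob_weights w"
  shows "l2 (convol w (excess w)) \<le> sqrt card_G * (l2 (excess w))\<^sup>2"
proof -
  have pt: "(convol w (excess w) h)\<^sup>2 \<le> ((l2 (excess w))\<^sup>2)\<^sup>2" if h: "h \<in> carrier G" for h
  proof -
    have "convol w (excess w) h = (\<Sum>x\<in>carrier G. excess w x * excess w (inv x \<otimes> h)) + (\<Sum>x\<in>carrier G. 1 / card_G * excess w (inv x \<otimes> h))"
      unfolding convol_def sum.distrib[symmetric] by (rule sum.cong) (auto simp: excess_def algebra_simps)
    also have "(\<Sum>x\<in>carrier G. 1 / card_G * excess w (inv x \<otimes> h)) = 0"
      unfolding sum_distrib_left[symmetric] using h by (simp add: sum_shift_inv sum_excess[OF w])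
    finally have eq: "convol w (excess w) h = (\<Sum>x\<in>carrier G. excess w x * excess w (inv x \<otimes> h))" by simp
    have "\<bar>convol w (excess w) h\<bar> \<le> (\<Sum>x\<in>carrier G. \<bar>excess w x\<bar> * \<bar>excess w (inv x \<otimes> h)\<bar>)"
      unfolding eq abs_mult[symmetric] by (rule sum_abs)
    also have "\<dots> \<le> l2 (excess w) * l2 (\<lambda>x. excess w (inv x \<otimes> h))" by (rule L2_set_mult_ineq)
    also have "l2 (\<lambda>x. excess w (inv x \<otimes> h)) = l2 (excess w)"
      unfolding L2_set_def using h by (simp add: sum_shift_inv[where F="\<lambda>x. (excess w x)\<^sup>2"])
    finally show ?thesis by (simp add: power2_eq_square[of "l2 _"] abs_le_square_iff[symmetric])
  qed
  have "(l2 (convol w (excess w)))\<^sup>2 = (\<Sum>h\<in>carrier G. (convol w (excess w) h)\<^sup>2)"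
    by (simp add: L2_set_def sum_nonneg)
  also have "\<dots> \<le> (\<Sum>h\<in>carrier G. ((l2 (excess w))\<^sup>2)\<^sup>2)" by (intro sum_mono pt)
  also have "\<dots> = (sqrt card_G * (l2 (excess w))\<^sup>2)\<^sup>2"
    by (simp add: power_mult_distrib order_def)
  finally show ?thesis by (rule power2_le_imp_le) simp
qed

section \<open>Convolution powers as sums over words\<close>

definition factorizations :: "nat \<Rightarrow> 'a \<Rightarrow> 'a list set" where
  "factorizations m h = {xs \<in> lists (carrier G). length xs = m \<and> foldr (\<otimes>) xs \<one> = h}"

lemma foldr_mult_closed: "xs \<in> lists (carrier G) \<Longrightarrow> foldr (\<otimes>) xs \<one> \<in> carrier G"
  by (induction xs) auto

lemma factorizations_Suc:
  assumes h: "h \<in> carrier G"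
  shows "factorizations (Suc m) h = (\<lambda>(x, xs). x # xs) ` (SIGMA x:carrier G. factorizations m (inv x \<otimes> h))"
proof (rule Set.set_eqI, rule iffI)
  fix ys assume "ys \<in> factorizations (Suc m) h"
  then obtain x xs where ys: "ys = x # xs" "x \<in> carrier G" "xs \<in> lists (carrier G)" "length xs = m"
      "x \<otimes> foldr (\<otimes>) xs \<one> = h"
    by (cases ys) (simp_all add: factorizations_def)
  then have "xs \<in> factorizations m (inv x \<otimes> h)"
    using foldr_mult_closed[OF ys(3)] by (auto simp: factorizations_def)
  then show "ys \<in> (\<lambda>(x, xs). x # xs) ` (SIGMA x:carrier G. factorizations m (inv x \<otimes> h))"
    using ys by (auto simp: image_iff)
next
  fix ys assume "ys \<in> (\<lambda>(x, xs). x # xs) ` (SIGMA x:carrier G. factorizations m (inv x \<otimes> h))"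
  then obtain x xs where "ys = x # xs" "x \<in> carrier G" "xs \<in> factorizations m (inv x \<otimes> h)" by auto
  then show "ys \<in> factorizations (Suc m) h" using h by (auto simp: factorizations_def)
qed

lemma finite_factorizations: "finite (factorizations m h)"
  by (rule finite_subset[OF _ finite_lists_length_eq[OF finite_carrier, of m]]) (auto simp: factorizations_def lists_eq_set)

lemma conv_power_factorizations:
  "h \<in> carrier G \<Longrightarrow> conv_power w m h = (\<Sum>xs\<in>factorizations m h. prod_list (map w xs))"
proof (induction m arbitrary: h)
  case 0
  have "factorizations 0 h = (if h = \<one> then {[]} else {})" by (auto simp: factorizations_def)
  then show ?case by (simp add: conv_power_0)
next
  case (Suc m)
  have "(\<Sum>xs\<in>factorizations (Suc m) h. prod_list (map w xs)) =
      (\<Sum>(x, xs)\<in>(SIGMA x:carrier G. factorizations m (inv x \<otimes> h)). w x * prod_list (map w xs))"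
    unfolding factorizations_Suc[OF Suc.prems]
    by (subst sum.reindex) (auto simp: inj_on_def intro!: sum.cong)
  also have "\<dots> = (\<Sum>x\<in>carrier G. \<Sum>xs\<in>factorizations m (inv x \<otimes> h). w x * prod_list (map w xs))"
    by (rule sum.Sigma[symmetric]) (auto simp: finite_factorizations)
  also have "\<dots> = (\<Sum>x\<in>carrier G. w x * conv_power w m (inv x \<otimes> h))"
    using Suc by (intro sum.cong) (auto simp: sum_distrib_left)
  finally show ?case by (simp add: conv_power_Suc convol_def)
qed

end

section \<open>The law of the label history\<close>

locale group_urn = finite_comm_group +
  fixes S0 :: "'a \<Rightarrow> nat" and I :: "nat set" and ms :: "nat \<Rightarrow> nat" and p :: "nat \<Rightarrow> real"
  assumes S0_pos: "(\<Sum>h\<in>carrier G. S0 h) \<ge> 1"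
    and S0_generates: "generate G {h \<in> carrier G. S0 h > 0} = carrier G"
    and finite_I [simp, intro]: "finite I"
    and ms_ge: "s \<in> I \<Longrightarrow> 2 \<le> ms s"
    and p_pos: "s \<in> I \<Longrightarrow> 0 < p s"
    and p_sum: "(\<Sum>s\<in>I. p s) = 1"
    and ms_coprime: "\<exists>s\<in>I. gcd (ms s - 1) (order G) = 1"
begin

text \<open>A history lists the labels added so far, the most recent one first.\<close>

definition init_total :: nat where
  "init_total = (\<Sum>h\<in>carrier G. S0 h)"

definition total :: "'a list \<Rightarrow> real" where
  "total z = real (init_total + length z)"

definition urn :: "'a list \<Rightarrow> 'a \<Rightarrow> real" where
  "urn z h = real (S0 h + count_list z h)"

definition content :: "'a list \<Rightarrow> 'a \<Rightarrow> real" where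
  "content z h = urn z h / total z"

definition law :: "'a list \<Rightarrow> 'a \<Rightarrow> real" where
  "law z h = (\<Sum>s\<in>I. p s * conv_power (content z) (ms s) h)"

text \<open>The probability of observing \<open>z\<close>, as \<open>history_prob\<close> confirms
  for the process.\<close>

primrec weight :: "'a list \<Rightarrow> real" where
  "weight [] = 1"
| "weight (h # z) = weight z * law z h"

definition hist :: "nat \<Rightarrow> 'a list set" where
  "hist n = {z \<in> lists (carrier G). length z = n}"

text \<open>Expectation over the histories of length \<open>n\<close>. The values range over a
  normed space so that real estimates and complex characteristic functions share one notion.\<close>

definition expect :: "nat \<Rightarrow> ('a list \<Rightarrow> 'v::real_normed_vector) \<Rightarrow> 'v" where
  "expect n F = (\<Sum>z\<in>hist n. weight z *\<^sub>R F z)"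

lemma init_total_pos: "init_total \<ge> 1"
  using S0_pos by (simp add: init_total_def)

lemma total_Cons [simp]: "total (h # z) = total z + 1"
  by (simp add: total_def)

lemma total_ge: "total z \<ge> 1"
  using init_total_pos by (simp add: total_def)

lemma total_pos: "total z > 0"
  using total_ge[of z] by linarith

lemma total_hist: "z \<in> hist n \<Longrightarrow> total z = real (init_total + n)"
  by (simp add: total_def hist_def)

lemma urn_Cons: "urn (x # z) h = urn z h + (if x = h then 1 else 0)"
  by (simp add: urn_def)

lemma urn_nonneg [simp]: "0 \<le> urn z h"
  by (simp add: urn_def)

lemma hist_0 [simp]: "hist 0 = {[]}"
  by (auto simp: hist_def)

lemma hist_lists: "z \<in> hist n \<Longrightarrow> z \<in> lists (carrier G)"
  by (simp add: hist_def)

lemma hist_Suc: "hist (Suc n) = (\<lambda>(z, h). h # z) ` (hist n \<times> carrier G)"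
  unfolding hist_def by (force simp: length_Suc_conv image_iff)

lemma finite_hist [simp]: "finite (hist n)"
  by (induction n) (auto simp: hist_Suc)

lemma sum_urn:
  assumes "z \<in> lists (carrier G)"
  shows "(\<Sum>h\<in>carrier G. urn z h) = total z"
  using assms by (induction z) (simp_all add: urn_Cons sum.distrib, simp add: urn_def total_def init_total_def)

lemma prob_weights_content:
  assumes "z \<in> lists (carrier G)" shows "prob_weights (content z)"
  using total_pos[of z] sum_urn[OF assms]
  by (simp add: prob_weights_def content_def sum_divide_distrib[symmetric])

lemma law_nonneg: "z \<in> lists (carrier G) \<Longrightarrow> h \<in> carrier G \<Longrightarrow> 0 \<le> law z h"
  unfolding law_def using conv_power_nonneg[OF prob_weights_content] p_pos
  by (intro sum_nonneg mult_nonneg_nonneg) (auto intro: less_imp_le)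

lemma sum_law_subset: "sum (law z) A = (\<Sum>s\<in>I. p s * sum (conv_power (content z) (ms s)) A)"
  unfolding law_def by (subst sum.swap) (simp add: sum_distrib_left)

lemma sum_law: "z \<in> lists (carrier G) \<Longrightarrow> sum (law z) (carrier G) = 1"
  by (simp add: sum_law_subset sum_conv_power[OF prob_weights_content] p_sum)

lemma prob_weights_law: "z \<in> lists (carrier G) \<Longrightarrow> prob_weights (law z)"
  by (simp add: prob_weights_def law_nonneg sum_law)

lemma weight_nonneg: "z \<in> lists (carrier G) \<Longrightarrow> 0 \<le> weight z"
  by (induction z) (auto intro!: mult_nonneg_nonneg law_nonneg)

lemma expect_0 [simp]: "expect 0 F = F []"
  by (simp add: expect_def)

text \<open>The tower property, conditioning on the first \<open>n\<close> labels.\<close>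

lemma expect_Suc:
  "expect (Suc n) F = expect n (\<lambda>z. \<Sum>h\<in>carrier G. law z h *\<^sub>R F (h # z))"
proof -
  have "expect (Suc n) F = (\<Sum>(z, h)\<in>hist n \<times> carrier G. weight (h # z) *\<^sub>R F (h # z))"
    unfolding expect_def hist_Suc by (subst sum.reindex) (auto simp: inj_on_def o_def intro!: sum.cong)
  then show ?thesis
    by (simp add: expect_def sum.cartesian_product[symmetric] scaleR_sum_right)
qed

lemma expect_cong: "(\<And>z. z \<in> hist n \<Longrightarrow> F z = F' z) \<Longrightarrow> expect n F = expect n F'"
  by (simp add: expect_def)

lemma expect_mono:
  fixes F :: "'a list \<Rightarrow> real"
  shows "(\<And>z. z \<in> hist n \<Longrightarrow> F z \<le> F' z) \<Longrightarrow> expect n F \<le> expect n F'"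
  unfolding expect_def by (intro sum_mono) (simp add: weight_nonneg hist_def mult_left_mono)

lemma expect_add: "expect n (\<lambda>z. F z + F' z) = expect n F + expect n F'"
  by (simp add: expect_def scaleR_add_right sum.distrib)

lemma expect_diff: "expect n (\<lambda>z. F z - F' z) = expect n F - expect n F'"
  by (simp add: expect_def scaleR_diff_right sum_subtractf)

lemma expect_cmult:
  fixes F :: "'a list \<Rightarrow> 'v::real_normed_algebra"
  shows "expect n (\<lambda>z. c * F z) = c * expect n F"
  by (simp add: expect_def sum_distrib_left)

lemma expect_sum: "expect n (\<lambda>z. \<Sum>i\<in>J. F i z) = (\<Sum>i\<in>J. expect n (F i))"
  unfolding expect_def scaleR_sum_right by (rule sum.swap)

lemma sum_weight: "sum weight (hist n) = 1"
proof (induction n)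
  case (Suc n)
  have "expect (Suc n) (\<lambda>z. 1::real) = expect n (\<lambda>z. 1)"
    unfolding expect_Suc by (rule expect_cong) (simp add: sum_law hist_def)
  then show ?case using Suc by (simp add: expect_def)
qed simp

lemma expect_const: "expect n (\<lambda>z. c) = c"
  by (simp add: expect_def scaleR_left.sum[symmetric] sum_weight)

lemma norm_expect_le: "norm (expect n F) \<le> expect n (\<lambda>z. norm (F z))"
  unfolding expect_def
  by (rule order_trans[OF norm_sum]) (auto intro!: sum_mono simp: weight_nonneg hist_def)

section \<open>Non-concentration on cosets\<close>

lemma drift_inequality:
  fixes N D J \<theta> :: real
  assumes N: "N \<ge> 1" and D: "D \<ge> 1" and J: "0 \<le> J" "J \<le> 1" and \<theta>: "0 < \<theta>"
    and jump: "D \<le> \<theta> * N \<Longrightarrow> 19 / 10 * (D / N) \<le> J"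
  shows "J * sqrt ((N + 1) / (D + 1)) + (1 - J) * sqrt ((N + 1) / D)
    \<le> (1 - 1 / (40 * N)) * sqrt (N / D) + 1 / sqrt \<theta> / N"
proof -
  let ?V = "sqrt (N / D)"
  have V0: "0 \<le> ?V" using N D by simp
  have "sqrt (1 + 1 / N) \<le> 1 + 1 / (2 * N)"
    using N by (intro real_le_lsqrt) (auto simp: power2_eq_square field_simps)
  moreover have "sqrt ((N + 1) / D) = ?V * sqrt (1 + 1 / N)"
    using N D by (simp add: real_sqrt_mult[symmetric] field_simps)
  ultimately have up: "sqrt ((N + 1) / D) \<le> ?V * (1 + 1 / (2 * N))"
    using V0 by (simp add: mult_left_mono)
  have q: "0 \<le> (D - 1) * (42 * D - 841 / 100)" using D by (intro mult_nonneg_nonneg) auto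
  \<comment> \<open>\<open>29 / 100\<close> is \<open>1 - 1 / sqrt 2\<close> rounded down, the value
    dictated by \<open>D = 1\<close>. Multiplied by the relative jump rate \<open>19 / 10\<close> it
    gives \<open>551 / 1000\<close>, just above the loss rate \<open>1 / 2\<close> caused by the
    growth of \<open>N\<close>.\<close>
  have "D / (D + 1) \<le> (1 - 29 / (100 * D))\<^sup>2"
  proof -
    have "D * D * D \<le> (D + 1) * (D - 29 / 100)\<^sup>2"
    proof -
      have "(D + 1) * (D - 29 / 100)\<^sup>2 - D * D * D = ((D - 1) * (42 * D - 841 / 100) + 82 / 100 * D) / 100"
        by (simp add: power2_eq_square field_simps)
      moreover have "0 \<le> ((D - 1) * (42 * D - 841 / 100) + 82 / 100 * D) / 100" using q D by simp
      ultimately have "0 \<le> (D + 1) * (D - 29 / 100)\<^sup>2 - D * D * D" by (simp only:)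
      then show ?thesis by (simp only: diff_ge_0_iff_ge)
    qed
    then have "D / (D + 1) \<le> (D - 29 / 100)\<^sup>2 / (D * D)"
      using D by (simp add: divide_simps mult_ac)
    also have "\<dots> = (1 - 29 / (100 * D))\<^sup>2" using D by (simp add: power2_eq_square field_simps)
    finally show ?thesis .
  qed
  then have s: "sqrt (D / (D + 1)) \<le> 1 - 29 / (100 * D)"
    using D by (intro real_le_lsqrt) (auto simp: field_simps)
  have "sqrt ((N + 1) / (D + 1)) = sqrt ((N + 1) / D) * sqrt (D / (D + 1))"
    using N D by (simp add: real_sqrt_mult[symmetric])
  also have "\<dots> \<le> sqrt ((N + 1) / D) * (1 - 29 / (100 * D))" using s N D by (intro mult_left_mono) auto
  finally have "J * sqrt ((N + 1) / (D + 1)) \<le> J * (sqrt ((N + 1) / D) * (1 - 29 / (100 * D)))"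
    using J by (intro mult_left_mono) auto
  then have "J * sqrt ((N + 1) / (D + 1)) + (1 - J) * sqrt ((N + 1) / D) \<le>
      sqrt ((N + 1) / D) * (1 - 29 / 100 * (J / D))"
    by (simp add: algebra_simps)
  also have "\<dots> \<le> ?V * (1 + 1 / (2 * N)) * (1 - 29 / 100 * (J / D))"
  proof (intro mult_right_mono up)
    have "J / D \<le> 1" using J D by simp
    then show "0 \<le> 1 - 29 / 100 * (J / D)" by simp
  qed
  \<comment> \<open>For small \<open>D\<close> the surplus \<open>551 / 1000 - 1 / 2\<close> exceeds
    \<open>1 / 40\<close>. Otherwise \<open>N / D\<close> is below \<open>1 / \<theta>\<close>, and
    the additive term pays for the growth.\<close>
  also have "\<dots> \<le> (1 - 1 / (40 * N)) * ?V + 1 / sqrt \<theta> / N"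
  proof (cases "D \<le> \<theta> * N")
    case True
    have "19 / 10 / N \<le> J / D" using jump[OF True] N D by (simp add: field_simps)
    then have "?V * (1 + 1 / (2 * N)) * (1 - 29 / 100 * (J / D)) \<le> ?V * (1 + 1 / (2 * N)) * (1 - 29 / 100 * (19 / 10 / N))"
      using V0 N by (intro mult_left_mono) auto
    also have "\<dots> = ?V * ((1 + 1 / (2 * N)) * (1 - 551 / 1000 / N))" by simp
    also have "\<dots> \<le> ?V * (1 - 1 / (40 * N))"
      using N V0 by (intro mult_left_mono) (auto simp: field_simps)
    finally show ?thesis using N \<theta> by (simp add: mult.commute add_increasing2)
  next
    case False
    then have "N / D \<le> 1 / \<theta>" using N D \<theta> by (simp add: field_simps)
    then have V1: "?V \<le> 1 / sqrt \<theta>" using real_sqrt_le_mono[of "N / D" "1 / \<theta>"] by (simp add: real_sqrt_divide)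
    have "?V * (1 + 1 / (2 * N)) * (1 - 29 / 100 * (J / D)) \<le> ?V * (1 + 1 / (2 * N)) * 1"
      using V0 N J D by (intro mult_left_mono) auto
    also have "\<dots> \<le> ?V * (1 - 1 / (40 * N)) + ?V / N" using V0 N by (simp add: field_simps)
    also have "\<dots> \<le> (1 - 1 / (40 * N)) * ?V + 1 / sqrt \<theta> / N"
      using divide_right_mono[OF V1, of N] N by (simp add: mult.commute)
    finally show ?thesis .
  qed
  finally show ?thesis .
qed

text \<open>\<open>sqrt (total z / D z)\<close> contracts in mean while \<open>D\<close> is a small fraction of the urn; since
  \<open>2 * (1 - 1 / sqrt 2) > 1 / 2\<close>, a relative jump rate slightly below 2 suffices even for \<open>D = 1\<close>.\<close>

lemma jump_count_tail:
  fixes D :: "'a list \<Rightarrow> real"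
  assumes A: "A \<subseteq> carrier G"
    and D: "\<And>h z. D (h # z) = D z + (if h \<in> A then 1 else 0)" "D [] \<ge> 1"
    and \<theta>: "0 < \<theta>"
    and jump: "\<And>z. z \<in> lists (carrier G) \<Longrightarrow> D z \<le> \<theta> * total z \<Longrightarrow> 19 / 10 * (D z / total z) \<le> sum (law z) A"
  obtains C where "0 \<le> C" "\<And>n r. r \<ge> 0 \<Longrightarrow> expect n (\<lambda>z. of_bool (D z < r * total z)) \<le> C * sqrt r"
proof -
  define V where "V z = sqrt (total z / D z)" for z
  have D1: "D z \<ge> 1" for z by (induction z) (use D in auto)
  \<comment> \<open>\<open>40 / sqrt \<theta>\<close> is the fixed point of the recursion from
    \<open>drift_inequality\<close>, so a bound by \<open>K\<close> is inherited from stage to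
    stage.\<close>
  define K where "K = max (V []) (40 / sqrt \<theta>)"
  have K0: "0 \<le> K" using \<theta> by (simp add: K_def le_max_iff_disj)
  have E: "expect n V \<le> K" for n
  proof (induction n)
    case 0 then show ?case by (simp add: K_def)
  next
    case (Suc n)
    define N where "N = real (init_total + n)"
    have N: "N \<ge> 1" using init_total_pos by (simp add: N_def)
    have "expect (Suc n) V \<le> expect n (\<lambda>z. (1 - 1 / (40 * N)) * V z + 1 / sqrt \<theta> / N)"
      unfolding expect_Suc
    proof (rule expect_mono)
      fix z assume z: "z \<in> hist n"
      have tz: "total z = N" using total_hist[OF z] by (simp add: N_def)
      have zl: "z \<in> lists (carrier G)" using z by (rule hist_lists)
      let ?J = "sum (law z) A"
      have J: "sum (law z) (carrier G - A) = 1 - ?J"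
        using prob_weights_sum_compl[OF prob_weights_law[OF zl] A] .
      have J01: "0 \<le> ?J" "0 \<le> 1 - ?J"
        unfolding J[symmetric] using A law_nonneg[OF zl] by (auto intro!: sum_nonneg)
      have "(\<Sum>h\<in>carrier G. law z h *\<^sub>R V (h # z)) = (\<Sum>h\<in>carrier G - A. law z h * V (h # z)) + (\<Sum>h\<in>A. law z h * V (h # z))"
        using A by (subst sum.subset_diff[OF A]) auto
      also have "\<dots> = (\<Sum>h\<in>carrier G - A. law z h * sqrt ((N + 1) / D z)) + (\<Sum>h\<in>A. law z h * sqrt ((N + 1) / (D z + 1)))"
        by (intro arg_cong2[where f="(+)"] sum.cong) (auto simp: V_def D tz)
      also have "\<dots> = ?J * sqrt ((N + 1) / (D z + 1)) + (1 - ?J) * sqrt ((N + 1) / D z)"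
        by (simp only: sum_distrib_right[symmetric] J)
      also have "\<dots> \<le> (1 - 1 / (40 * N)) * V z + 1 / sqrt \<theta> / N"
        unfolding V_def tz using N D1 J01 \<theta> jump[OF zl] by (intro drift_inequality) (auto simp: tz)
      finally show "(\<Sum>h\<in>carrier G. law z h *\<^sub>R V (h # z)) \<le> (1 - 1 / (40 * N)) * V z + 1 / sqrt \<theta> / N" .
    qed
    also have "\<dots> = (1 - 1 / (40 * N)) * expect n V + 1 / sqrt \<theta> / N"
      by (simp only: expect_add expect_cmult expect_const)
    also have "\<dots> \<le> (1 - 1 / (40 * N)) * K + 1 / sqrt \<theta> / N"
      using Suc N by (intro add_right_mono mult_left_mono) auto
    also have "1 / sqrt \<theta> / N \<le> 1 / (40 * N) * K"
    proof -
      have "40 / sqrt \<theta> \<le> K" by (simp add: K_def)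
      then have "1 / (40 * N) * (40 / sqrt \<theta>) \<le> 1 / (40 * N) * K" using N by (intro mult_left_mono) auto
      then show ?thesis by (simp add: mult.commute)
    qed
    finally show ?case by (simp add: algebra_simps)
  qed
  show thesis
  proof (rule that[OF K0])
    fix n and r :: real assume r: "r \<ge> 0"
    \<comment> \<open>Markov's inequality: \<open>D z < r * total z\<close> makes
      \<open>sqrt r * V z\<close> at least 1.\<close>
    have "expect n (\<lambda>z. of_bool (D z < r * total z)) \<le> expect n (\<lambda>z. sqrt r * V z)"
    proof (rule expect_mono)
      fix z
      show "of_bool (D z < r * total z) \<le> sqrt r * V z"
      proof (cases "D z < r * total z")
        case True
        then have "1 \<le> r * (total z / D z)" using D1[of z] by (simp add: field_simps)
        then show ?thesis using True by (simp add: V_def real_sqrt_mult[symmetric])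
      next
        case False
        then show ?thesis using r D1[of z] total_pos[of z] by (simp add: V_def)
      qed
    qed
    also have "\<dots> = sqrt r * expect n V" by (rule expect_cmult)
    also have "\<dots> \<le> sqrt r * K" using E r by (intro mult_left_mono) auto
    finally show "expect n (\<lambda>z. of_bool (D z < r * total z)) \<le> K * sqrt r" by (simp add: mult.commute)
  qed
qed

lemma translate_subgroup:
  assumes H: "subgroup H G" and c: "c \<in> H" shows "translate H c = H"
proof -
  interpret H: subgroup H G by fact
  have cG: "c \<in> carrier G" using c by simp
  have "x \<in> H" if x: "x \<in> carrier G" "x \<otimes> inv c \<in> H" for x
  proof -
    have "(x \<otimes> inv c) \<otimes> c \<in> H" using H.m_closed[OF x(2) c] .
    then show ?thesis using x(1) cG by (simp add: m_assoc)
  qed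
  then show ?thesis using c unfolding translate_def by auto
qed

lemma sum_urn_Cons:
  "A \<subseteq> carrier G \<Longrightarrow> sum (urn (h # z)) A = sum (urn z) A + (if h \<in> A then 1 else 0)"
  using finite_subset[of A "carrier G"] by (simp add: urn_Cons sum.distrib)

lemma sum_content: "sum (content z) A = sum (urn z) A / total z"
  by (simp add: content_def sum_divide_distrib)

text \<open>A subgroup is escaped at relative rate \<open>19 / 10\<close>, and the initial labels,
  which generate the group, supply a ball outside it. If \<open>c\<close> is not in
  \<open>H\<close>, the urn may start inside the coset, so the count outside starts from a
  fictitious ball; \<open>1 \<le> r * real n\<close> and the factor 2 absorb it.\<close>

lemma translate_tail:
  assumes H: "subgroup H G" "H \<noteq> carrier G" and c: "c \<in> carrier G"
  shows "\<exists>C\<ge>0. \<forall>n r. r > 0 \<longrightarrow> 1 \<le> r * real n \<longrightarrow>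
    expect n (\<lambda>z. of_bool (sum (content z) (carrier G - translate H c) < r)) \<le> C * sqrt (2 * r)"
proof -
  let ?A = "carrier G - translate H c"
  show ?thesis
  proof (cases "c \<in> H")
    case True
    then have A: "?A = carrier G - H" using translate_subgroup[OF H(1)] by simp
    define D where "D z = sum (urn z) ?A" for z
    obtain h where h: "h \<in> carrier G" "S0 h > 0" "h \<notin> H"
    proof -
      have "generate G {h \<in> carrier G. S0 h > 0} \<subseteq> H" if "{h \<in> carrier G. S0 h > 0} \<subseteq> H"
        using generate_subgroup_incl[OF that H(1)] .
      moreover have "H \<subseteq> carrier G" using subgroup.subset[OF H(1)] .
      ultimately show thesis using that H(2) S0_generates by blast
    qed
    have "1 \<le> urn [] h" using h by (simp add: urn_def)
    also have "\<dots> \<le> D []" unfolding D_def using h by (intro member_le_sum) (auto simp: A)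
    finally have D0: "1 \<le> D []" .
    obtain C where C: "0 \<le> C" "\<And>n r. r \<ge> 0 \<Longrightarrow> expect n (\<lambda>z. of_bool (D z < r * total z)) \<le> C * sqrt r"
    proof (rule jump_count_tail[of ?A D "1 / 20"])
      show "D (h # z) = D z + (if h \<in> ?A then 1 else 0)" for h z
        unfolding D_def by (rule sum_urn_Cons) auto
      fix z assume z: "z \<in> lists (carrier G)" and le: "D z \<le> 1 / 20 * total z"
      have w: "prob_weights (content z)" by (rule prob_weights_content[OF z])
      have b: "D z / total z = sum (content z) (carrier G - H)" by (simp add: D_def sum_content A)
      have le': "sum (content z) (carrier G - H) \<le> 1 / 20" unfolding b[symmetric] using le total_pos[of z] by (simp add: field_simps)
      have "(\<Sum>s\<in>I. p s * (19 / 10 * (D z / total z))) \<le> (\<Sum>s\<in>I. p s * sum (conv_power (content z) (ms s)) ?A)"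
        unfolding A b using p_pos conv_power_leave_subgroup[OF w H(1) le' ms_ge]
        by (intro sum_mono mult_left_mono) (auto intro: less_imp_le)
      then show "19 / 10 * (D z / total z) \<le> sum (law z) ?A"
        by (simp only: sum_law_subset sum_distrib_right[symmetric] p_sum mult_1_left)
    qed (use D0 in auto)
    have "expect n (\<lambda>z. of_bool (sum (content z) ?A < r)) \<le> C * sqrt (2 * r)" if r: "r > 0" for n r
    proof -
      have "expect n (\<lambda>z. of_bool (sum (content z) ?A < r)) = expect n (\<lambda>z. of_bool (D z < r * total z))"
        using total_pos by (intro expect_cong) (simp add: D_def sum_content field_simps)
      also have "\<dots> \<le> C * sqrt r" using r by (intro C(2)) simp
      also have "\<dots> \<le> C * sqrt (2 * r)" using C(1) r by (intro mult_left_mono) auto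
      finally show ?thesis .
    qed
    then show ?thesis using C(1) by blast
  next
    case False
    define D where "D z = 1 + sum (urn z) ?A" for z
    obtain s0 where s0: "s0 \<in> I" "gcd (ms s0 - 1) (order G) = 1" using ms_coprime by (elim bexE) (rule that)
    \<comment> \<open>With outside mass at most \<open>\<theta>\<close>, the draw size
      \<open>ms s0\<close> escapes with probability at least \<open>1 / 2\<close>. The next label is
      then outside with probability at least \<open>p s0 / 2\<close>, hence at least
      \<open>2 * \<theta>\<close>, which exceeds \<open>19 / 10\<close> times the relative
      count.\<close>
    define \<theta> where "\<theta> = min (p s0 / 4) (1 / (2 * real (ms s0)))"
    have m2: "ms s0 \<ge> 2" using ms_ge s0 by simp
    have \<theta>: "0 < \<theta>" "\<theta> \<le> p s0 / 4" "\<theta> * real (ms s0) \<le> 1 / 2"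
    proof -
      show "0 < \<theta>" using p_pos[OF s0(1)] m2 by (simp add: \<theta>_def)
      show "\<theta> \<le> p s0 / 4" by (simp add: \<theta>_def)
      have "\<theta> * real (ms s0) \<le> 1 / (2 * real (ms s0)) * real (ms s0)" unfolding \<theta>_def by (intro mult_right_mono) auto
      then show "\<theta> * real (ms s0) \<le> 1 / 2" using m2 by simp
    qed
    obtain C where C: "0 \<le> C" "\<And>n r. r \<ge> 0 \<Longrightarrow> expect n (\<lambda>z. of_bool (D z < r * total z)) \<le> C * sqrt r"
    proof (rule jump_count_tail[of ?A D \<theta>])
      show "D (h # z) = D z + (if h \<in> ?A then 1 else 0)" for h z
        unfolding D_def by (subst sum_urn_Cons) auto
      show "1 \<le> D []" unfolding D_def by (auto intro!: sum_nonneg)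
      fix z assume z: "z \<in> lists (carrier G)" and le: "D z \<le> \<theta> * total z"
      have w: "prob_weights (content z)" by (rule prob_weights_content[OF z])
      have dle: "D z / total z \<le> \<theta>" using le total_pos[of z] by (simp add: field_simps)
      have b: "sum (content z) ?A \<le> D z / total z" unfolding D_def sum_content using total_pos[of z] by (simp add: field_simps)
      have "real (ms s0) * sum (content z) ?A \<le> real (ms s0) * \<theta>" using b dle by (intro mult_left_mono) auto
      then have "1 / 2 \<le> sum (conv_power (content z) (ms s0)) ?A"
        using conv_power_leave_translate[OF w H(1) c False m2 s0(2)] \<theta>(3) by (simp add: mult.commute)
      then have "p s0 * (1 / 2) \<le> p s0 * sum (conv_power (content z) (ms s0)) ?A"
        using p_pos[OF s0(1)] by (intro mult_left_mono) auto
      also have "\<dots> \<le> sum (law z) ?A" unfolding sum_law_subset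
        using s0(1) conv_power_nonneg[OF w]
        by (intro member_le_sum) (auto intro!: mult_nonneg_nonneg[OF less_imp_le[OF p_pos]] sum_nonneg)
      finally show "19 / 10 * (D z / total z) \<le> sum (law z) ?A" using dle \<theta>(2) p_pos[OF s0(1)] by linarith
    qed (use \<theta> in auto)
    have "expect n (\<lambda>z. of_bool (sum (content z) ?A < r)) \<le> C * sqrt (2 * r)" if r: "r > 0" "1 \<le> r * real n" for n r
    proof -
      have "expect n (\<lambda>z. of_bool (sum (content z) ?A < r) :: real) \<le> expect n (\<lambda>z. of_bool (D z < (2 * r) * total z))"
      proof (rule expect_mono)
        fix z assume z: "z \<in> hist n"
        have "r * real n \<le> r * total z" using r total_hist[OF z] by (intro mult_left_mono) auto
        then have "1 \<le> r * total z" using r by linarith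
        then show "of_bool (sum (content z) ?A < r) \<le> (of_bool (D z < (2 * r) * total z) :: real)"
          using total_pos[of z] by (auto simp: D_def sum_content field_simps)
      qed
      also have "\<dots> \<le> C * sqrt (2 * r)" using r by (intro C(2)) simp
      finally show ?thesis .
    qed
    then show ?thesis using C(1) by blast
  qed
qed

text \<open>Union bound over the finitely many proper subgroups and coset representatives.\<close>

lemma not_spread_tail:
  "\<exists>C\<ge>0. \<forall>n r. r > 0 \<longrightarrow> 1 \<le> r * real n \<longrightarrow> expect n (\<lambda>z. of_bool (\<not> spread r (content z))) \<le> C * sqrt r"
proof -
  let ?S = "{(H, c). subgroup H G \<and> H \<noteq> carrier G \<and> c \<in> carrier G}"
  have "?S \<subseteq> Pow (carrier G) \<times> carrier G" using subgroup.subset by auto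
  then have fin: "finite ?S" by (rule finite_subset) auto
  have "\<forall>k\<in>?S. \<exists>C\<ge>0. \<forall>n r. r > 0 \<longrightarrow> 1 \<le> r * real n \<longrightarrow>
      expect n (\<lambda>z. of_bool (sum (content z) (carrier G - translate (fst k) (snd k)) < r)) \<le> C * sqrt (2 * r)"
    using translate_tail by auto
  from bchoice[OF this] obtain C where C: "\<forall>k\<in>?S. 0 \<le> C k \<and> (\<forall>n r. r > 0 \<longrightarrow> 1 \<le> r * real n \<longrightarrow>
      expect n (\<lambda>z. of_bool (sum (content z) (carrier G - translate (fst k) (snd k)) < r)) \<le> C k * sqrt (2 * r))" ..
  have "expect n (\<lambda>z. of_bool (\<not> spread r (content z))) \<le> sum C ?S * sqrt 2 * sqrt r"
    if r: "r > 0" "1 \<le> r * real n" for n r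
  proof -
    have "expect n (\<lambda>z. of_bool (\<not> spread r (content z)) :: real) \<le>
      expect n (\<lambda>z. \<Sum>k\<in>?S. of_bool (sum (content z) (carrier G - translate (fst k) (snd k)) < r))"
    proof (rule expect_mono)
      fix z
      show "of_bool (\<not> spread r (content z)) \<le> (\<Sum>k\<in>?S. of_bool (sum (content z) (carrier G - translate (fst k) (snd k)) < r) :: real)"
      proof (cases "spread r (content z)")
        case True then show ?thesis by (simp add: sum_nonneg)
      next
        case False
        then obtain H c where "subgroup H G" "H \<noteq> carrier G" "c \<in> carrier G"
            "sum (content z) (carrier G - translate H c) < r"
          unfolding spread_def not_all not_imp not_le by blast
        then have Hc: "(H, c) \<in> ?S" "sum (content z) (carrier G - translate H c) < r" by simp_all
        have "(of_bool (sum (content z) (carrier G - translate (fst (H,c)) (snd (H,c))) < r) :: real) \<le>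
          (\<Sum>k\<in>?S. of_bool (sum (content z) (carrier G - translate (fst k) (snd k)) < r))"
          by (rule member_le_sum[OF Hc(1)]) (use fin in auto)
        then show ?thesis using Hc(2) False by simp
      qed
    qed
    also have "\<dots> = (\<Sum>k\<in>?S. expect n (\<lambda>z. of_bool (sum (content z) (carrier G - translate (fst k) (snd k)) < r)))"
      by (rule expect_sum)
    also have "\<dots> \<le> (\<Sum>k\<in>?S. C k * sqrt (2 * r))" using C r by (intro sum_mono) blast
    also have "\<dots> = sum C ?S * sqrt 2 * sqrt r" by (simp add: sum_distrib_right[symmetric] real_sqrt_mult)
    finally show ?thesis .
  qed
  moreover have "0 \<le> sum C ?S * sqrt 2" using C by (intro mult_nonneg_nonneg sum_nonneg) auto
  ultimately show ?thesis by blast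
qed

section \<open>One-step drift of the imbalance\<close>

definition imbalance :: "'a list \<Rightarrow> real" where
  "imbalance z = (l2 (excess (content z)))\<^sup>2"

text \<open>Bounds the drift of \<open>imbalance\<close>: Cauchy-Schwarz is applied to the excesses
  of the next label's law and of the urn, the former dominated by the case of two draws.\<close>

definition cross :: "'a list \<Rightarrow> real" where
  "cross z = l2 (excess (content z)) * l2 (convol (content z) (excess (content z)))"

lemma l2_power2: "(l2 v)\<^sup>2 = (\<Sum>h\<in>carrier G. (v h)\<^sup>2)"
  by (simp add: L2_set_def sum_nonneg)

lemma imbalance_nonneg [simp]: "0 \<le> imbalance z"
  by (simp add: imbalance_def)

lemma imbalance_le_1:
  assumes "z \<in> lists (carrier G)" shows "imbalance z \<le> 1"
proof -
  have w: "prob_weights (content z)" by (rule prob_weights_content[OF assms])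
  have le1: "content z h \<le> 1" if "h \<in> carrier G" for h
    using member_le_sum[of h "carrier G" "content z"] that prob_weights_nonneg[OF w] prob_weights_sum[OF w] by simp
  have "imbalance z = (\<Sum>h\<in>carrier G. (content z h)\<^sup>2 - 2 / card_G * content z h + 1 / card_G\<^sup>2)"
    unfolding imbalance_def l2_power2 excess_def power2_diff by (intro sum.cong refl) (simp add: power_divide)
  also have "\<dots> = (\<Sum>h\<in>carrier G. (content z h)\<^sup>2) - 2 / card_G * 1 + card_G * (1 / card_G\<^sup>2)"
    by (simp only: sum.distrib sum_subtractf sum_distrib_left[symmetric] prob_weights_sum[OF w]) (simp add: order_def)
  also have "\<dots> \<le> (\<Sum>h\<in>carrier G. (content z h)\<^sup>2)" using card_G_pos by (simp add: power2_eq_square)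
  also have "\<dots> \<le> (\<Sum>h\<in>carrier G. content z h)"
    using le1 prob_weights_nonneg[OF w] by (intro sum_mono) (simp add: power2_eq_square mult_left_le)
  also have "\<dots> = 1" by (rule prob_weights_sum[OF w])
  finally show ?thesis .
qed

text \<open>Total times excess moves by the indicator of \<open>h\<close> minus
  \<open>1 / card_G\<close>, a vector of squared length \<open>1 - 1 / card_G\<close>. The excess is
  orthogonal to constants, so only its value at \<open>h\<close> appears in the mixed term.\<close>

lemma imbalance_Cons:
  assumes z: "z \<in> lists (carrier G)" and h: "h \<in> carrier G"
  shows "(total z + 1)\<^sup>2 * imbalance (h # z) =
    (total z)\<^sup>2 * imbalance z + 2 * total z * excess (content z) h + (1 - 1 / card_G)"
proof -
  let ?N = "total z" and ?f = "excess (content z)" and ?e = "\<lambda>x. (if h = x then 1 else 0) - 1 / card_G"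
  have N: "?N > 0" by (rule total_pos)
  have eq: "(?N + 1) * excess (content (h # z)) x = ?N * ?f x + ?e x" for x
  proof -
    have "(?N + 1) * content (h # z) x = ?N * content z x + (if h = x then 1 else 0)"
      using N by (simp add: content_def urn_Cons)
    then show ?thesis by (simp add: excess_def right_diff_distrib add_divide_distrib)
  qed
  have "(?N + 1)\<^sup>2 * imbalance (h # z) = (\<Sum>x\<in>carrier G. ((?N + 1) * excess (content (h # z)) x)\<^sup>2)"
    by (simp add: imbalance_def l2_power2 sum_distrib_left power_mult_distrib)
  also have "\<dots> = (\<Sum>x\<in>carrier G. ?N\<^sup>2 * (?f x)\<^sup>2 + 2 * ?N * (if h = x then ?f x else 0) - 2 * ?N / card_G * ?f x
      + (1 - 2 / card_G) * (if h = x then 1 else 0) + 1 / card_G\<^sup>2)"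
    unfolding eq by (intro sum.cong) (auto simp: power2_eq_square algebra_simps)
  also have "\<dots> = ?N\<^sup>2 * imbalance z + 2 * ?N * ?f h - 2 * ?N / card_G * 0 + (1 - 2 / card_G) + card_G * (1 / card_G\<^sup>2)"
    using h sum_excess[OF prob_weights_content[OF z]]
    by (simp only: sum.distrib sum_subtractf sum_distrib_left[symmetric]) (simp add: imbalance_def l2_power2 order_def)
  also have "\<dots> = ?N\<^sup>2 * imbalance z + 2 * ?N * ?f h + (1 - 1 / card_G)"
    using card_G_pos by (simp add: power2_eq_square)
  finally show ?thesis .
qed

lemma excess_law: "excess (law z) h = (\<Sum>s\<in>I. p s * excess (conv_power (content z) (ms s)) h)"
  by (simp add: excess_def law_def right_diff_distrib sum_subtractf sum_distrib_right[symmetric] p_sum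
      sum_divide_distrib[symmetric])

lemma sum_law_excess_le_cross:
  assumes z: "z \<in> lists (carrier G)"
  shows "(\<Sum>h\<in>carrier G. law z h * excess (content z) h) \<le> cross z"
proof -
  have w: "prob_weights (content z)" by (rule prob_weights_content[OF z])
  let ?f = "excess (content z)"
  have one: "(\<Sum>h\<in>carrier G. excess (conv_power (content z) (ms s)) h * ?f h) \<le> cross z" if s: "s \<in> I" for s
  proof -
    have "(\<Sum>h\<in>carrier G. excess (conv_power (content z) (ms s)) h * ?f h) \<le>
        (\<Sum>h\<in>carrier G. \<bar>excess (conv_power (content z) (ms s)) h\<bar> * \<bar>?f h\<bar>)"
      by (intro sum_mono) (metis abs_ge_self abs_mult)
    also have "\<dots> \<le> l2 (excess (conv_power (content z) (ms s))) * l2 ?f" by (rule L2_set_mult_ineq)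
    also have "\<dots> \<le> l2 (convol (content z) ?f) * l2 ?f"
      by (intro mult_right_mono l2_excess_conv_power[OF w ms_ge[OF s]]) (simp add: L2_set_nonneg)
    finally show ?thesis by (simp add: cross_def mult.commute)
  qed
  have "(\<Sum>h\<in>carrier G. law z h * ?f h) = (\<Sum>h\<in>carrier G. excess (law z) h * ?f h + 1 / card_G * ?f h)"
    by (intro sum.cong) (auto simp: excess_def algebra_simps)
  also have "\<dots> = (\<Sum>h\<in>carrier G. excess (law z) h * ?f h)"
    by (simp add: sum.distrib sum_distrib_left[symmetric] sum_divide_distrib[symmetric] sum_excess[OF w])
  also have "\<dots> = (\<Sum>s\<in>I. p s * (\<Sum>h\<in>carrier G. excess (conv_power (content z) (ms s)) h * ?f h))"
    unfolding excess_law sum_distrib_right sum_distrib_left by (subst sum.swap) (simp add: mult.assoc)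
  also have "\<dots> \<le> (\<Sum>s\<in>I. p s * cross z)" using one p_pos by (intro sum_mono mult_left_mono) (auto intro: less_imp_le)
  also have "\<dots> = cross z" by (simp add: sum_distrib_right[symmetric] p_sum)
  finally show ?thesis .
qed

lemma imbalance_step:
  assumes z: "z \<in> lists (carrier G)"
  shows "(\<Sum>h\<in>carrier G. law z h * imbalance (h # z)) \<le>
    ((total z)\<^sup>2 * imbalance z + 2 * total z * cross z + 1) / (total z + 1)\<^sup>2"
proof -
  let ?N = "total z"
  have N: "?N > 0" by (rule total_pos)
  have "(?N + 1)\<^sup>2 * (\<Sum>h\<in>carrier G. law z h * imbalance (h # z)) =
      (\<Sum>h\<in>carrier G. law z h * ((?N + 1)\<^sup>2 * imbalance (h # z)))"
    by (simp add: sum_distrib_left mult_ac)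
  also have "\<dots> = (\<Sum>h\<in>carrier G. law z h * (?N\<^sup>2 * imbalance z + (1 - 1 / card_G)) + 2 * ?N * (law z h * excess (content z) h))"
    by (intro sum.cong refl) (simp only: imbalance_Cons[OF z], simp add: algebra_simps)
  also have "\<dots> = ?N\<^sup>2 * imbalance z + (1 - 1 / card_G) + 2 * ?N * (\<Sum>h\<in>carrier G. law z h * excess (content z) h)"
    by (simp only: sum.distrib sum_distrib_right[symmetric] sum_distrib_left[symmetric] sum_law[OF z] mult_1_left)
  also have "\<dots> \<le> ?N\<^sup>2 * imbalance z + 1 + 2 * ?N * cross z"
    using N card_G_pos sum_law_excess_le_cross[OF z] by (intro add_mono mult_left_mono) auto
  finally show ?thesis using N by (simp add: pos_le_divide_eq mult.commute)
qed

lemma cross_le_imbalance: "z \<in> lists (carrier G) \<Longrightarrow> cross z \<le> imbalance z"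
  unfolding cross_def imbalance_def power2_eq_square
  by (intro mult_left_mono l2_convol_le_l2 prob_weights_content) (simp_all add: L2_set_nonneg)

text \<open>The threshold says that \<open>sqrt card_G\<close> times the norm of the excess is at
  most \<open>1 / 4\<close>, where the quadratic bound beats the trivial one. The factor
  \<open>1 / 4\<close> is below \<open>1 / 2\<close>, as the decay rate
  \<open>2 - 2 * (1 / 4)\<close> in \<open>calm_imbalance_bound\<close> has to exceed 1.\<close>

lemma cross_small:
  assumes z: "z \<in> lists (carrier G)" and "imbalance z \<le> 1 / (16 * card_G)"
  shows "cross z \<le> imbalance z / 4"
proof -
  let ?l = "l2 (excess (content z))"
  have "(sqrt card_G * ?l)\<^sup>2 \<le> (1 / 4)\<^sup>2"
    using assms(2) card_G_pos by (simp add: imbalance_def power_mult_distrib field_simps)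
  then have q: "sqrt card_G * ?l \<le> 1 / 4" by (rule power2_le_imp_le) simp
  have "cross z \<le> ?l * (sqrt card_G * ?l\<^sup>2)" unfolding cross_def
    by (intro mult_left_mono l2_convol_excess_quadratic prob_weights_content[OF z]) (simp add: L2_set_nonneg)
  also have "\<dots> = (sqrt card_G * ?l) * imbalance z" by (simp add: imbalance_def power2_eq_square)
  also have "\<dots> \<le> 1 / 4 * imbalance z" using q by (intro mult_right_mono) auto
  finally show ?thesis by simp
qed

text \<open>One \<open>sqrt card_G\<close> comes from Cauchy-Schwarz against the constant 1, the
  other from the quadratic bound.\<close>

lemma sum_abs_excess_law:
  assumes z: "z \<in> lists (carrier G)"
  shows "(\<Sum>h\<in>carrier G. \<bar>excess (law z) h\<bar>) \<le> card_G * imbalance z"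
proof -
  have w: "prob_weights (content z)" by (rule prob_weights_content[OF z])
  have one: "(\<Sum>h\<in>carrier G. \<bar>excess (conv_power (content z) (ms s)) h\<bar>) \<le> card_G * imbalance z" if s: "s \<in> I" for s
  proof -
    have "(\<Sum>h\<in>carrier G. \<bar>excess (conv_power (content z) (ms s)) h\<bar>) =
      (\<Sum>h\<in>carrier G. \<bar>excess (conv_power (content z) (ms s)) h\<bar> * \<bar>1\<bar>)" by simp
    also have "\<dots> \<le> l2 (excess (conv_power (content z) (ms s))) * l2 (\<lambda>h. 1)" by (rule L2_set_mult_ineq)
    also have "l2 (\<lambda>h. 1) = sqrt card_G" by (simp add: L2_set_def order_def)
    also have "l2 (excess (conv_power (content z) (ms s))) * sqrt card_G \<le> (sqrt card_G * imbalance z) * sqrt card_G"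
      using l2_excess_conv_power[OF w ms_ge[OF s]] l2_convol_excess_quadratic[OF w]
      by (intro mult_right_mono) (auto simp: imbalance_def)
    also have "\<dots> = card_G * imbalance z" by (simp add: mult_ac)
    finally show ?thesis .
  qed
  have "(\<Sum>h\<in>carrier G. \<bar>excess (law z) h\<bar>) \<le> (\<Sum>h\<in>carrier G. \<Sum>s\<in>I. p s * \<bar>excess (conv_power (content z) (ms s)) h\<bar>)"
    unfolding excess_law using less_imp_le[OF p_pos]
    by (intro sum_mono order_trans[OF sum_abs]) (auto simp: abs_mult intro!: sum_mono mult_right_mono)
  also have "\<dots> = (\<Sum>s\<in>I. p s * (\<Sum>h\<in>carrier G. \<bar>excess (conv_power (content z) (ms s)) h\<bar>))"
    by (subst sum.swap) (simp add: sum_distrib_left)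
  also have "\<dots> \<le> (\<Sum>s\<in>I. p s * (card_G * imbalance z))"
    using one p_pos by (intro sum_mono mult_left_mono) (auto intro: less_imp_le)
  also have "\<dots> = card_G * imbalance z" by (simp add: sum_distrib_right[symmetric] p_sum)
  finally show ?thesis .
qed

section \<open>The potential tends to 0 in mean\<close>

definition potential :: "'a list \<Rightarrow> real" where
  "potential z = imbalance z + 1 / total z"

lemma inverse_square_le:
  fixes N :: real assumes "N \<ge> 1" shows "1 / (N + 1)\<^sup>2 \<le> 1 / N - 1 / (N + 1)"
proof -
  have "1 / N - 1 / (N + 1) = 1 / (N * (N + 1))" using assms by (simp add: field_simps)
  moreover have "1 / (N + 1)\<^sup>2 \<le> 1 / (N * (N + 1))"
    using assms by (intro divide_left_mono) (auto simp: power2_eq_square)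
  ultimately show ?thesis by simp
qed

text \<open>With \<open>N = total z\<close>, the term \<open>1 / N\<close> falls by at least the
  noise \<open>1 / (N + 1)^2\<close> of one stage, which leaves a supermartingale. The parameter
  \<open>g\<close> is the amount by which \<open>cross\<close> falls short of its trivial
  bound.\<close>

lemma potential_step_gain:
  assumes z: "z \<in> lists (carrier G)" and gain: "cross z \<le> imbalance z - g"
  shows "(\<Sum>h\<in>carrier G. law z h * potential (h # z)) \<le> potential z - 2 * total z * g / (total z + 1)\<^sup>2"
proof -
  let ?N = "total z"
  have N: "?N \<ge> 1" by (rule total_ge)
  have "(\<Sum>h\<in>carrier G. law z h * potential (h # z)) =
      (\<Sum>h\<in>carrier G. law z h * imbalance (h # z)) + 1 / (?N + 1)"
    unfolding potential_def by (simp add: distrib_left sum.distrib sum_divide_distrib[symmetric] sum_law[OF z])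
  also have "(\<Sum>h\<in>carrier G. law z h * imbalance (h # z)) \<le> (?N\<^sup>2 * imbalance z + 2 * ?N * cross z + 1) / (?N + 1)\<^sup>2"
    by (rule imbalance_step[OF z])
  also have "\<dots> \<le> (?N\<^sup>2 * imbalance z + 2 * ?N * (imbalance z - g) + 1) / (?N + 1)\<^sup>2"
    using N gain by (intro divide_right_mono add_mono mult_left_mono) auto
  also have "\<dots> \<le> ((?N + 1)\<^sup>2 * imbalance z - 2 * ?N * g + 1) / (?N + 1)\<^sup>2"
    using imbalance_nonneg[of z] by (intro divide_right_mono zero_le_power2) (simp add: power2_eq_square algebra_simps)
  also have "\<dots> = imbalance z - 2 * ?N * g / (?N + 1)\<^sup>2 + 1 / (?N + 1)\<^sup>2"
    using N by (simp add: add_divide_distrib diff_divide_distrib)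
  finally show ?thesis using inverse_square_le[OF N] by (simp add: potential_def)
qed

lemma potential_step:
  "z \<in> lists (carrier G) \<Longrightarrow> (\<Sum>h\<in>carrier G. law z h * potential (h # z)) \<le> potential z"
  using potential_step_gain[of z 0] cross_le_imbalance[of z] by simp

lemma potential_nonneg [simp]: "0 \<le> potential z"
  using total_pos[of z] by (simp add: potential_def)

lemma expect_potential_Suc_le: "expect (Suc n) potential \<le> expect n potential"
  unfolding expect_Suc real_scaleR_def by (intro expect_mono potential_step hist_lists)

lemma expect_potential_antimono: "m \<le> n \<Longrightarrow> expect n potential \<le> expect m potential"
  by (induction n rule: dec_induct) (auto intro: order_trans[OF expect_potential_Suc_le])

lemma expect_nonneg:
  fixes F :: "'a list \<Rightarrow> real" shows "(\<And>z. z \<in> hist n \<Longrightarrow> 0 \<le> F z) \<Longrightarrow> 0 \<le> expect n F"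
  using expect_mono[of n "\<lambda>_. 0" F] by (simp add: expect_const)

text \<open>Of \<open>3 * e\<close>, one \<open>e\<close> covers the term \<open>1 / total z\<close>
  and one the probability of a badly spread urn; the remaining \<open>e\<close> of mean imbalance is
  contracted.\<close>

lemma expect_potential_gain:
  assumes e: "e > 0"
  obtains \<kappa> n1 where "\<kappa> > 0"
    "\<And>n. n \<ge> n1 \<Longrightarrow> expect n potential \<ge> 3 * e \<Longrightarrow>
      expect (Suc n) potential \<le> expect n potential - \<kappa> / real (init_total + Suc n)"
proof -
  obtain C where C: "0 \<le> C" "\<And>n r. r > 0 \<Longrightarrow> 1 \<le> r * real n \<Longrightarrow> expect n (\<lambda>z. of_bool (\<not> spread r (content z))) \<le> C * sqrt r"
    using not_spread_tail by blast
  \<comment> \<open>Makes the failure probability \<open>C * sqrt r\<close> at most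
    \<open>e\<close>; \<open>C + 1\<close> avoids a division by 0.\<close>
  define r where "r = min 1 ((e / (C + 1))\<^sup>2)"
  have r: "0 < r" "r \<le> 1" using e C(1) by (auto simp: r_def)
  have "sqrt r \<le> e / (C + 1)"
    using e C(1) by (intro real_le_lsqrt) (auto simp: r_def)
  then have "C * sqrt r \<le> C * (e / (C + 1))" using C(1) by (intro mult_left_mono) auto
  also have "\<dots> \<le> e" using C(1) e by (simp add: field_simps)
  finally have Cr: "C * sqrt r \<le> e" .
  obtain k where k: "0 < k" "k < 1" and contr:
    "\<And>w v. prob_weights w \<Longrightarrow> spread r w \<Longrightarrow> sum v (carrier G) = 0 \<Longrightarrow> l2 (convol w v) \<le> (1 - k) * l2 v"
    using spread_contraction[OF r] by (metis (no_types, lifting))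
  define n1 where "n1 = nat \<lceil>max (1 / r) (1 / e)\<rceil>"
  show thesis
  proof (rule that[of "k * e" n1])
    show "0 < k * e" using k e by simp
    fix n assume n: "n \<ge> n1" and big: "expect n potential \<ge> 3 * e"
    have nr: "real n \<ge> 1 / r" "real n \<ge> 1 / e"
      using n unfolding n1_def by linarith+
    have rn: "1 \<le> r * real n" using nr(1) r by (simp add: field_simps)
    define N where "N = real (init_total + n)"
    have N: "N \<ge> 1" "N \<ge> 1 / e" using init_total_pos nr by (auto simp: N_def)
    define B where "B z = (of_bool (\<not> spread r (content z)) :: real)" for z
    have step: "(\<Sum>h\<in>carrier G. law z h *\<^sub>R potential (h # z)) \<le>
        potential z - 2 * N * k / (N + 1)\<^sup>2 * (imbalance z - B z)" if z: "z \<in> hist n" for z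
    proof -
      have zl: "z \<in> lists (carrier G)" by (rule hist_lists[OF z])
      have w: "prob_weights (content z)" by (rule prob_weights_content[OF zl])
      have tz: "total z = N" using total_hist[OF z] by (simp add: N_def)
      \<comment> \<open>One formula for both cases: on a badly spread urn
        \<open>imbalance z - B z\<close> is not positive, because the imbalance is at most
        1.\<close>
      have "cross z \<le> imbalance z - k * (imbalance z - B z)"
      proof (cases "spread r (content z)")
        case True
        have "cross z \<le> l2 (excess (content z)) * ((1 - k) * l2 (excess (content z)))"
          unfolding cross_def by (intro mult_left_mono contr[OF w True sum_excess[OF w]]) (simp add: L2_set_nonneg)
        then show ?thesis using True by (simp add: B_def imbalance_def power2_eq_square algebra_simps)
      next
        case False
        have "k * (imbalance z - B z) \<le> 0" using False k imbalance_le_1[OF zl] by (simp add: B_def mult_le_0_iff)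
        then show ?thesis using cross_le_imbalance[OF zl] by linarith
      qed
      from potential_step_gain[OF zl this] show ?thesis by (simp add: tz mult.assoc)
    qed
    have "expect (Suc n) potential \<le> expect n (\<lambda>z. potential z - 2 * N * k / (N + 1)\<^sup>2 * (imbalance z - B z))"
      unfolding expect_Suc by (rule expect_mono) (rule step)
    also have "\<dots> = expect n potential - 2 * N * k / (N + 1)\<^sup>2 * (expect n imbalance - expect n B)"
      by (simp only: expect_diff expect_cmult)
    finally have 1: "expect (Suc n) potential \<le> expect n potential - 2 * N * k / (N + 1)\<^sup>2 * (expect n imbalance - expect n B)" .
    have "expect n potential = expect n (\<lambda>z. imbalance z + 1 / N)"
      by (rule expect_cong) (simp add: potential_def total_hist N_def)
    then have "expect n potential = expect n imbalance + 1 / N" by (simp only: expect_add expect_const)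
    moreover have "1 / N \<le> e" using N e by (simp add: field_simps)
    moreover have "expect n B \<le> e" unfolding B_def using C(2)[OF r(1) rn] Cr by linarith
    ultimately have eb: "e \<le> expect n imbalance - expect n B" using big by linarith
    have "k / (N + 1) \<le> 2 * N * k / (N + 1)\<^sup>2"
    proof -
      have "k / (N + 1) = k * (N + 1) / (N + 1)\<^sup>2" using N by (simp add: power2_eq_square)
      also have "\<dots> \<le> k * (2 * N) / (N + 1)\<^sup>2" using N k by (intro divide_right_mono mult_left_mono) auto
      finally show ?thesis by (simp add: mult_ac)
    qed
    then have "k / (N + 1) * e \<le> 2 * N * k / (N + 1)\<^sup>2 * (expect n imbalance - expect n B)"
      using eb e k N by (intro mult_mono) auto
    then show "expect (Suc n) potential \<le> expect n potential - k * e / real (init_total + Suc n)"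
      using 1 by (simp add: N_def add_ac)
  qed
qed

text \<open>A mean potential bounded away from 0 would drop by a multiple of \<open>1 / N\<close> at
  every late stage, contradicting the divergence of the harmonic series. Monotonicity extends one
  small value to all later times.\<close>

lemma expect_potential_tendsto_0: "(\<lambda>n. expect n potential) \<longlonglongrightarrow> 0"
proof (rule LIMSEQ_I)
  fix e :: real assume e: "e > 0"
  have "\<exists>n. expect n potential < 3 * (e / 3)"
  proof (rule ccontr)
    assume "\<not> ?thesis"
    then have big: "expect n potential \<ge> 3 * (e / 3)" for n by (simp add: not_less)
    have e3: "e / 3 > 0" using e by simp
    obtain \<kappa> n1 where \<kappa>: "\<kappa> > 0" and dec: "\<And>n. n \<ge> n1 \<Longrightarrow> expect n potential \<ge> 3 * (e / 3) \<Longrightarrow>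
      expect (Suc n) potential \<le> expect n potential - \<kappa> / real (init_total + Suc n)"
      by (rule expect_potential_gain[OF e3]) (rule that)
    define a where "a j = 1 / real (j + (init_total + n1 + 1))" for j
    have a0: "0 \<le> a j" for j by (simp add: a_def)
    have "expect (n1 + k) potential \<le> expect n1 potential - \<kappa> * sum a {..<k}" for k
    proof (induction k)
      case (Suc k)
      have "expect (Suc (n1 + k)) potential \<le> expect (n1 + k) potential - \<kappa> / real (init_total + Suc (n1 + k))"
        by (rule dec) (use big in auto)
      also have "\<kappa> / real (init_total + Suc (n1 + k)) = \<kappa> * a k" by (simp add: a_def add_ac)
      finally show ?case using Suc by (simp add: algebra_simps)
    qed simp
    moreover have "0 \<le> expect (n1 + k) potential" for k by (rule expect_nonneg) simp
    ultimately have "\<kappa> * sum a {..<k} \<le> expect n1 potential" for k by (smt (verit))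
    then have "sum a {..<k} \<le> expect n1 potential / \<kappa>" for k using \<kappa> by (simp add: field_simps)
    from this[of "Suc _", unfolded lessThan_Suc_atMost] have "summable a"
      by (rule bounded_imp_summable[OF a0])
    then have "summable (\<lambda>j. (\<lambda>n. 1 / real n) (j + (init_total + n1 + 1)))" unfolding a_def .
    then have "summable (\<lambda>n. 1 / real n)" by (subst (asm) summable_iff_shift)
    then show False using not_summable_harmonic[where 'a=real] by (simp add: inverse_eq_divide)
  qed
  then obtain n0 where "expect n0 potential < e" by auto
  then have "expect n potential < e" if "n \<ge> n0" for n using expect_potential_antimono[OF that] by linarith
  moreover have "0 \<le> expect n potential" for n by (rule expect_nonneg) simp
  ultimately show "\<exists>no. \<forall>n\<ge>no. norm (expect n potential - 0) < e" by auto
qed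

section \<open>The rate 1 / n below the threshold\<close>

abbreviation threshold :: real where "threshold \<equiv> 1 / (16 * card_G)"

text \<open>The event that a stopping time, the first passage above the threshold from time
  \<open>K\<close> on, has not yet occurred, encoded as a predicate of histories.\<close>

primrec calm :: "nat \<Rightarrow> 'a list \<Rightarrow> bool" where
  "calm K [] \<longleftrightarrow> (K = 0 \<longrightarrow> imbalance [] \<le> threshold)"
| "calm K (h # z) \<longleftrightarrow> calm K z \<and> (K \<le> Suc (length z) \<longrightarrow> imbalance (h # z) \<le> threshold)"

lemma calm_imbalance: "calm K z \<Longrightarrow> K \<le> length z \<Longrightarrow> imbalance z \<le> threshold"
  by (cases z) auto

lemma calm_early: "length z < K \<Longrightarrow> calm K z"
  by (induction z) auto

lemma not_calm_first: "\<not> calm K z \<Longrightarrow> length z = K \<Longrightarrow> imbalance z > threshold"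
  by (cases z) (auto simp: calm_early)

lemma threshold_pos: "threshold > 0"
  using card_G_pos by simp

text \<open>Doob's maximal inequality for the supermartingale \<^const>\<open>potential\<close>.\<close>

lemma not_calm_bound:
  "expect n (\<lambda>z. of_bool (\<not> calm K z)) \<le> expect K potential / threshold"
proof (cases "K \<le> n")
  case False
  have "expect n (\<lambda>z. of_bool (\<not> calm K z)) = expect n (\<lambda>z. 0::real)"
    using False by (intro expect_cong) (simp add: hist_def calm_early)
  then show ?thesis using threshold_pos by (simp add: expect_const expect_nonneg)
next
  case True
  \<comment> \<open>The potential frozen at \<open>threshold\<close> from the stopping time on. At
    that time the potential itself is larger, so freezing preserves the supermartingale
    property.\<close>
  define \<Phi> where "\<Phi> z = (if calm K z then potential z else threshold)" for z
  have \<Phi>_le: "\<Phi> z \<le> potential z" if "\<not> calm K z \<Longrightarrow> imbalance z > threshold" for z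
    using that total_pos[of z] by (auto simp: \<Phi>_def potential_def intro: less_imp_le add_increasing2)
  have "expect n \<Phi> \<le> expect K potential" using True
  proof (induction n rule: dec_induct)
    case base
    show ?case by (rule expect_mono) (rule \<Phi>_le, simp add: hist_def not_calm_first)
  next
    case (step n)
    have "expect (Suc n) \<Phi> \<le> expect n \<Phi>" unfolding expect_Suc real_scaleR_def
    proof (rule expect_mono)
      fix z assume z: "z \<in> hist n"
      have zl: "z \<in> lists (carrier G)" and len: "length z = n" using z by (auto simp: hist_def)
      show "(\<Sum>h\<in>carrier G. law z h * \<Phi> (h # z)) \<le> \<Phi> z"
      proof (cases "calm K z")
        case True
        have "(\<Sum>h\<in>carrier G. law z h * \<Phi> (h # z)) \<le> (\<Sum>h\<in>carrier G. law z h * potential (h # z))"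
          using True law_nonneg[OF zl] by (intro sum_mono mult_left_mono \<Phi>_le) auto
        also have "\<dots> \<le> potential z" by (rule potential_step[OF zl])
        finally show ?thesis using True by (simp add: \<Phi>_def)
      next
        case False
        then show ?thesis by (simp add: \<Phi>_def sum_divide_distrib[symmetric] sum_law[OF zl])
      qed
    qed
    then show ?case using step.IH by linarith
  qed
  moreover have "expect n (\<lambda>z. threshold * of_bool (\<not> calm K z)) \<le> expect n \<Phi>"
    by (rule expect_mono) (simp add: \<Phi>_def)
  ultimately have "threshold * expect n (\<lambda>z. of_bool (\<not> calm K z)) \<le> expect K potential"
    by (simp only: expect_cmult)
  then show ?thesis using threshold_pos by (simp only: pos_le_divide_eq mult.commute)
qed

text \<open>With \<open>N\<close> balls, a calm imbalance is multiplied by at most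
  \<open>(N^2 + N / 2) / (N + 1)^2\<close> in mean, up to noise \<open>1 / (N + 1)^2\<close>. A
  bound \<open>c / N\<close> reproduces itself once \<open>c / 2 \<ge> 1\<close>. Since
  \<open>c\<close> also exceeds the number of balls at stage \<open>K\<close>, the trivial bound 1
  settles the earlier stages.\<close>

lemma calm_imbalance_bound:
  "expect n (\<lambda>z. of_bool (calm K z) * imbalance z) \<le> (real (init_total + K) + 2) / real (init_total + n)"
proof (induction n)
  case 0
  have "of_bool (calm K []) * imbalance [] \<le> 1" using imbalance_le_1[of "[]"] by simp
  also have "1 \<le> (real (init_total + K) + 2) / real (init_total + 0)" using init_total_pos by simp
  finally show ?case by simp
next
  case (Suc n)
  define c where "c = real (init_total + K) + 2"
  define N where "N = real (init_total + n)"
  have N: "N \<ge> 1" using init_total_pos by (simp add: N_def)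
  show ?case
  proof (cases "K \<le> n")
    case False
    have "expect (Suc n) (\<lambda>z. of_bool (calm K z) * imbalance z) \<le> expect (Suc n) (\<lambda>z. 1)"
      by (rule expect_mono) (auto simp: hist_def imbalance_le_1 intro: mult_le_one)
    also have "\<dots> \<le> c / real (init_total + Suc n)" using False by (simp add: expect_const c_def divide_simps)
    finally show ?thesis by (simp add: c_def)
  next
    case True
    have "expect (Suc n) (\<lambda>z. of_bool (calm K z) * imbalance z) \<le>
        expect n (\<lambda>z. (N\<^sup>2 + N / 2) / (N + 1)\<^sup>2 * (of_bool (calm K z) * imbalance z) + 1 / (N + 1)\<^sup>2)"
      unfolding expect_Suc real_scaleR_def
    proof (rule expect_mono)
      fix z assume z: "z \<in> hist n"
      have zl: "z \<in> lists (carrier G)" and len: "length z = n" using z by (auto simp: hist_def)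
      have tz: "total z = N" using total_hist[OF z] by (simp add: N_def)
      show "(\<Sum>h\<in>carrier G. law z h * (of_bool (calm K (h # z)) * imbalance (h # z))) \<le>
          (N\<^sup>2 + N / 2) / (N + 1)\<^sup>2 * (of_bool (calm K z) * imbalance z) + 1 / (N + 1)\<^sup>2"
      proof (cases "calm K z")
        case False
        then show ?thesis using N by simp
      next
        case calm: True
        have small: "imbalance z \<le> threshold" using calm_imbalance[OF calm] True len by simp
        have "(\<Sum>h\<in>carrier G. law z h * (of_bool (calm K (h # z)) * imbalance (h # z))) \<le> (\<Sum>h\<in>carrier G. law z h * imbalance (h # z))"
          using law_nonneg[OF zl] by (intro sum_mono mult_left_mono) auto
        also have "\<dots> \<le> (N\<^sup>2 * imbalance z + 2 * N * cross z + 1) / (N + 1)\<^sup>2"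
          using imbalance_step[OF zl] by (simp only: tz)
        also have "\<dots> \<le> (N\<^sup>2 * imbalance z + 2 * N * (imbalance z / 4) + 1) / (N + 1)\<^sup>2"
          using cross_small[OF zl small] N by (intro divide_right_mono add_mono mult_left_mono) auto
        also have "\<dots> = (N\<^sup>2 + N / 2) / (N + 1)\<^sup>2 * imbalance z + 1 / (N + 1)\<^sup>2"
          by (simp add: add_divide_distrib algebra_simps)
        finally show ?thesis using calm by simp
      qed
    qed
    also have "\<dots> = (N\<^sup>2 + N / 2) / (N + 1)\<^sup>2 * expect n (\<lambda>z. of_bool (calm K z) * imbalance z) + 1 / (N + 1)\<^sup>2"
      by (simp only: expect_add expect_cmult expect_const)
    also have "\<dots> \<le> (N\<^sup>2 + N / 2) / (N + 1)\<^sup>2 * (c / N) + 1 / (N + 1)\<^sup>2"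
      using Suc N by (intro add_right_mono mult_left_mono) (auto simp: c_def N_def)
    also have "\<dots> = (c * N + c / 2 + 1) / (N + 1)\<^sup>2"
    proof -
      have e: "(N\<^sup>2 + N / 2) * (c / N) = c * N + c / 2" using N by (simp add: power2_eq_square field_simps)
      show ?thesis unfolding times_divide_eq_left e by (simp only: add_divide_distrib)
    qed
    also have "\<dots> \<le> (c * (N + 1)) / (N + 1)\<^sup>2"
      by (intro divide_right_mono zero_le_power2) (simp add: c_def distrib_left)
    also have "\<dots> = c / (N + 1)" using N by (simp add: power2_eq_square)
    finally show ?thesis by (simp add: c_def N_def add_ac)
  qed
qed

section \<open>Comparison of characteristic functions\<close>

definition uniform_char :: "('a \<Rightarrow> real) \<Rightarrow> real \<Rightarrow> complex" where
  "uniform_char v \<theta> = (\<Sum>h\<in>carrier G. iexp (\<theta> * v h)) / card_G"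

lemma norm_uniform_char: "norm (uniform_char v \<theta>) \<le> 1"
proof -
  have "norm (\<Sum>h\<in>carrier G. iexp (\<theta> * v h)) \<le> (\<Sum>h\<in>carrier G. 1)"
    by (rule order_trans[OF norm_sum]) simp
  then show ?thesis using card_G_pos by (simp add: uniform_char_def norm_divide order_def)
qed

lemma norm_iexp_diff_1: "norm (iexp x - 1) \<le> \<bar>x\<bar>"
  using iexp_approx1[of x 0] by simp

text \<open>The excess of \<open>law z\<close> sums to 0, so \<open>iexp\<close> may be replaced by
  \<open>iexp - 1\<close>; this gains the factor \<open>\<theta>\<close> over the L1 bound.\<close>

lemma law_char_approx:
  assumes z: "z \<in> lists (carrier G)" and \<theta>: "0 \<le> \<theta>" and B: "\<And>h. h \<in> carrier G \<Longrightarrow> \<bar>v h\<bar> \<le> B" "0 \<le> B"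
  shows "norm ((\<Sum>h\<in>carrier G. of_real (law z h) * iexp (\<theta> * v h)) - uniform_char v \<theta>) \<le> \<theta> * B * card_G * imbalance z"
proof -
  have "(\<Sum>h\<in>carrier G. of_real (law z h) * iexp (\<theta> * v h)) - uniform_char v \<theta> =
      (\<Sum>h\<in>carrier G. of_real (excess (law z) h) * iexp (\<theta> * v h))"
    by (simp add: uniform_char_def excess_def left_diff_distrib sum_subtractf sum_divide_distrib)
  also have "\<dots> = (\<Sum>h\<in>carrier G. of_real (excess (law z) h) * (iexp (\<theta> * v h) - 1)) + of_real (\<Sum>h\<in>carrier G. excess (law z) h)"
    by (simp add: right_diff_distrib sum_subtractf)
  also have "(\<Sum>h\<in>carrier G. excess (law z) h) = 0" by (rule sum_excess[OF prob_weights_law[OF z]])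
  finally have eq: "(\<Sum>h\<in>carrier G. of_real (law z h) * iexp (\<theta> * v h)) - uniform_char v \<theta> =
      (\<Sum>h\<in>carrier G. of_real (excess (law z) h) * (iexp (\<theta> * v h) - 1))" by simp
  have "norm (\<Sum>h\<in>carrier G. of_real (excess (law z) h) * (iexp (\<theta> * v h) - 1)) \<le>
      (\<Sum>h\<in>carrier G. \<bar>excess (law z) h\<bar> * (\<theta> * B))"
  proof (rule sum_norm_le)
    fix h assume h: "h \<in> carrier G"
    have "norm (iexp (\<theta> * v h) - 1) \<le> \<theta> * B"
      using norm_iexp_diff_1[of "\<theta> * v h"] mult_left_mono[OF B(1)[OF h] \<theta>] \<theta> by (simp add: abs_mult)
    then show "norm (of_real (excess (law z) h) * (iexp (\<theta> * v h) - 1)) \<le> \<bar>excess (law z) h\<bar> * (\<theta> * B)"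
      by (simp only: norm_mult norm_of_real mult_left_mono abs_ge_zero)
  qed
  also have "\<dots> = (\<theta> * B) * (\<Sum>h\<in>carrier G. \<bar>excess (law z) h\<bar>)" by (simp add: sum_distrib_left mult.commute)
  also have "\<dots> \<le> (\<theta> * B) * (card_G * imbalance z)"
    using \<theta> B(2) by (intro mult_left_mono sum_abs_excess_law[OF z]) auto
  finally show ?thesis unfolding eq by (simp add: mult.assoc)
qed

text \<open>Telescoping comparison with the characteristic function of a sum of \<open>n\<close> independent uniform labels;
  the process is stopped when it ceases to be calm.\<close>

lemma char_comparison:
  assumes \<theta>: "0 \<le> \<theta>" and B: "\<And>h. h \<in> carrier G \<Longrightarrow> \<bar>v h\<bar> \<le> B" "0 \<le> B"
  shows "norm (expect n (\<lambda>z. iexp (\<theta> * sum_list (map v z))) - uniform_char v \<theta> ^ n) \<le>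
    2 * expect n (\<lambda>z. of_bool (\<not> calm K z)) + \<theta> * B * card_G * (\<Sum>k<n. expect k (\<lambda>z. of_bool (calm K z) * imbalance z))"
proof -
  define F where "F z = iexp (\<theta> * sum_list (map v z))" for z
  define I where "I z = (of_bool (calm K z) :: real)" for z
  define \<psi> where "\<psi> = uniform_char v \<theta>"
  define S where "S n = \<theta> * B * card_G * (\<Sum>k<n. expect k (\<lambda>z. I z * imbalance z))" for n
  have F1: "norm (F z) = 1" for z by (simp add: F_def)
  have F_Cons: "F (h # z) = iexp (\<theta> * v h) * F z" for h z
    by (simp add: F_def distrib_left exp_add)
  have I01: "0 \<le> I z" "I z \<le> 1" "I (h # z) \<le> I z" for z h by (auto simp: I_def)
  \<comment> \<open>The stopped mass and the local errors in \<open>S\<close> accumulate side by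
    side. As \<open>\<psi>\<close> has modulus at most 1, earlier errors are not amplified.\<close>
  have stopped: "norm (expect n (\<lambda>z. of_real (I z) * F z) - \<psi> ^ n) \<le> (1 - expect n I) + S n" for n
  proof (induction n)
    case 0
    show ?case by (auto simp: S_def I_def F_def)
  next
    case (Suc n)
    \<comment> \<open>\<open>R\<close> is the error due to a next label that is not uniform,
      \<open>Q\<close> the contribution of the mass stopped at this stage.\<close>
    define R where "R z = (\<Sum>h\<in>carrier G. of_real (law z h) * iexp (\<theta> * v h)) - \<psi>" for z
    define Q where "Q z = (\<Sum>h\<in>carrier G. of_real (law z h * (I z - I (h # z))) * F (h # z))" for z
    have step: "(\<Sum>h\<in>carrier G. law z h *\<^sub>R (of_real (I (h # z)) * F (h # z))) =
        \<psi> * (of_real (I z) * F z) + (of_real (I z) * F z * R z - Q z)" for z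
    proof -
      have "(\<Sum>h\<in>carrier G. law z h *\<^sub>R (of_real (I (h # z)) * F (h # z))) =
        (\<Sum>h\<in>carrier G. of_real (I z) * F z * (of_real (law z h) * iexp (\<theta> * v h)) - of_real (law z h * (I z - I (h # z))) * F (h # z))"
        by (intro sum.cong refl) (simp add: F_Cons scaleR_conv_of_real algebra_simps)
      also have "\<dots> = of_real (I z) * F z * (R z + \<psi>) - Q z"
        by (simp add: sum_subtractf sum_distrib_left[symmetric] R_def Q_def)
      finally show ?thesis by (simp add: algebra_simps)
    qed
    have eq: "expect (Suc n) (\<lambda>z. of_real (I z) * F z) - \<psi> ^ Suc n =
        \<psi> * (expect n (\<lambda>z. of_real (I z) * F z) - \<psi> ^ n) + (expect n (\<lambda>z. of_real (I z) * F z * R z) - expect n Q)"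
      unfolding expect_Suc step by (simp only: expect_add expect_diff expect_cmult) (simp add: right_diff_distrib)
    have 1: "norm (expect n (\<lambda>z. of_real (I z) * F z * R z)) \<le> \<theta> * B * card_G * expect n (\<lambda>z. I z * imbalance z)"
    proof -
      have "norm (expect n (\<lambda>z. of_real (I z) * F z * R z)) \<le> expect n (\<lambda>z. norm (of_real (I z) * F z * R z))"
        by (rule norm_expect_le)
      also have "\<dots> \<le> expect n (\<lambda>z. \<theta> * B * card_G * (I z * imbalance z))"
      proof (rule expect_mono)
        fix z assume z: "z \<in> hist n"
        have "norm (R z) \<le> \<theta> * B * card_G * imbalance z"
          unfolding R_def \<psi>_def by (rule law_char_approx[OF hist_lists[OF z] \<theta> B])
        then have "I z * norm (R z) \<le> I z * (\<theta> * B * card_G * imbalance z)" using I01 by (intro mult_left_mono)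
        then show "norm (of_real (I z) * F z * R z) \<le> \<theta> * B * card_G * (I z * imbalance z)"
          using I01(1)[of z] by (simp add: norm_mult F1 mult_ac)
      qed
      finally show ?thesis by (simp only: expect_cmult)
    qed
    have 2: "norm (expect n Q) \<le> expect n I - expect (Suc n) I"
    proof -
      have "norm (expect n Q) \<le> expect n (\<lambda>z. norm (Q z))" by (rule norm_expect_le)
      also have "\<dots> \<le> expect n (\<lambda>z. I z - (\<Sum>h\<in>carrier G. law z h *\<^sub>R I (h # z)))"
      proof (rule expect_mono)
        fix z assume z: "z \<in> hist n"
        have zl: "z \<in> lists (carrier G)" by (rule hist_lists[OF z])
        have "norm (Q z) \<le> (\<Sum>h\<in>carrier G. law z h * (I z - I (h # z)))"
          unfolding Q_def using law_nonneg[OF zl] I01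
          by (intro sum_norm_le) (simp only: norm_mult F1 norm_of_real abs_mult, simp)
        also have "\<dots> = I z - (\<Sum>h\<in>carrier G. law z h *\<^sub>R I (h # z))"
          by (simp add: right_diff_distrib sum_subtractf sum_distrib_right[symmetric] sum_law[OF zl])
        finally show "norm (Q z) \<le> I z - (\<Sum>h\<in>carrier G. law z h *\<^sub>R I (h # z))" .
      qed
      finally show ?thesis by (simp only: expect_diff expect_Suc[of n I])
    qed
    have "norm (\<psi> * (expect n (\<lambda>z. of_real (I z) * F z) - \<psi> ^ n)) \<le> 1 * norm (expect n (\<lambda>z. of_real (I z) * F z) - \<psi> ^ n)"
      unfolding norm_mult \<psi>_def by (intro mult_right_mono norm_uniform_char) auto
    then have "norm (expect (Suc n) (\<lambda>z. of_real (I z) * F z) - \<psi> ^ Suc n) \<le>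
        ((1 - expect n I) + S n) + (\<theta> * B * card_G * expect n (\<lambda>z. I z * imbalance z) + (expect n I - expect (Suc n) I))"
      unfolding eq using Suc 1 2
        norm_triangle_ineq[of "\<psi> * (expect n (\<lambda>z. of_real (I z) * F z) - \<psi> ^ n)" "expect n (\<lambda>z. of_real (I z) * F z * R z) - expect n Q"]
        norm_triangle_ineq4[of "expect n (\<lambda>z. of_real (I z) * F z * R z)" "expect n Q"]
      by linarith
    also have "\<dots> = (1 - expect (Suc n) I) + S (Suc n)" by (simp add: S_def algebra_simps)
    finally show ?case .
  qed
  \<comment> \<open>Removing the indicator costs the stopped mass a second time, hence the factor
    2.\<close>
  have "norm (expect n F - expect n (\<lambda>z. of_real (I z) * F z)) \<le> expect n (\<lambda>z. norm (F z - of_real (I z) * F z))"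
    unfolding expect_diff[symmetric] by (rule norm_expect_le)
  also have "\<dots> = expect n (\<lambda>z. 1 - I z)"
    by (rule expect_cong) (simp add: I_def F1)
  also have "\<dots> = 1 - expect n I" by (simp only: expect_diff expect_const)
  finally have 3: "norm (expect n F - expect n (\<lambda>z. of_real (I z) * F z)) \<le> 1 - expect n I" .
  have "expect n (\<lambda>z. of_bool (\<not> calm K z)) = expect n (\<lambda>z. 1 - I z)"
    by (rule expect_cong) (simp add: I_def)
  also have "\<dots> = 1 - expect n I" by (simp only: expect_diff expect_const)
  finally have 4: "expect n (\<lambda>z. of_bool (\<not> calm K z)) = 1 - expect n I" .
  have "norm (expect n F - \<psi> ^ n) \<le> norm (expect n F - expect n (\<lambda>z. of_real (I z) * F z)) + norm (expect n (\<lambda>z. of_real (I z) * F z) - \<psi> ^ n)"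
    using norm_triangle_ineq[of "expect n F - expect n (\<lambda>z. of_real (I z) * F z)" "expect n (\<lambda>z. of_real (I z) * F z) - \<psi> ^ n"] by simp
  then show ?thesis using 3 stopped[of n] 4
    unfolding F_def[symmetric] \<psi>_def[symmetric] S_def I_def[symmetric] by (simp add: F_def[abs_def])
qed

lemma harmonic_over_sqrt: "(\<lambda>n. harm n / sqrt (real n)) \<longlonglongrightarrow> (0::real)"
proof -
  have "(\<lambda>n. (harm n - ln (real n)) * (1 / sqrt (real n)) + ln (real n) / sqrt (real n)) \<longlonglongrightarrow> euler_mascheroni * 0 + (0::real)"
    by (intro tendsto_add tendsto_mult euler_mascheroni_LIMSEQ) real_asymp+
  then show ?thesis by (simp add: diff_divide_distrib add_divide_distrib)
qed

text \<open>\<open>K\<close> is fixed first to make the stopping probability small. The bounds of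
  order \<open>1 / k\<close> on the calm imbalances then sum to a multiple of \<open>harm n\<close>,
  which the frequency \<open>1 / sqrt n\<close> beats.\<close>

lemma char_difference_tendsto_0:
  "(\<lambda>n. expect n (\<lambda>z. iexp (1 / sqrt (real n) * sum_list (map v z))) - uniform_char v (1 / sqrt (real n)) ^ n) \<longlonglongrightarrow> 0"
proof (rule metric_LIMSEQ_I)
  fix e :: real assume e: "e > 0"
  define B where "B = Max (insert 0 ((\<lambda>h. \<bar>v h\<bar>) ` carrier G))"
  have B: "\<bar>v h\<bar> \<le> B" if "h \<in> carrier G" for h unfolding B_def by (intro Max_ge) (use that in auto)
  have B0: "0 \<le> B" unfolding B_def by (intro Max_ge) auto
  have "\<forall>\<^sub>F K in sequentially. expect K potential < e * threshold / 4"
    using e threshold_pos by (intro order_tendstoD(2)[OF expect_potential_tendsto_0]) auto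
  then obtain K where K: "expect K potential < e * threshold / 4" by (auto simp: eventually_sequentially)
  then have K': "2 * (expect K potential / threshold) < e / 2" using threshold_pos by (simp add: field_simps)
  define c where "c = real (init_total + K) + 2"
  have c0: "0 \<le> c" by (simp add: c_def)
  \<comment> \<open>This includes \<open>n = 0\<close>: quotients by \<open>sqrt 0\<close> are 0,
    and the two terms of the difference are both 1.\<close>
  have bound: "dist (expect n (\<lambda>z. iexp (1 / sqrt (real n) * sum_list (map v z))) - uniform_char v (1 / sqrt (real n)) ^ n) 0
      < e / 2 + B * card_G * c * (harm n / sqrt (real n))" for n
  proof -
    have "(\<Sum>k<n. expect k (\<lambda>z. of_bool (calm K z) * imbalance z)) \<le> (\<Sum>k<n. c * inverse (real (Suc k)))"
    proof (rule sum_mono)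
      fix k
      have "expect k (\<lambda>z. of_bool (calm K z) * imbalance z) \<le> c / real (init_total + k)"
        unfolding c_def by (rule calm_imbalance_bound)
      also have "\<dots> \<le> c / real (Suc k)" using c0 init_total_pos by (intro divide_left_mono) auto
      finally show "expect k (\<lambda>z. of_bool (calm K z) * imbalance z) \<le> c * inverse (real (Suc k))"
        by (simp only: divide_inverse)
    qed
    also have "\<dots> = c * harm n"
      unfolding sum_distrib_left[symmetric] harm_def
      by (simp add: sum.atLeast1_atMost_eq)
    finally have h: "(\<Sum>k<n. expect k (\<lambda>z. of_bool (calm K z) * imbalance z)) \<le> c * harm n" .
    have "norm (expect n (\<lambda>z. iexp (1 / sqrt (real n) * sum_list (map v z))) - uniform_char v (1 / sqrt (real n)) ^ n) \<le>
      2 * expect n (\<lambda>z. of_bool (\<not> calm K z)) + 1 / sqrt (real n) * B * card_G * (\<Sum>k<n. expect k (\<lambda>z. of_bool (calm K z) * imbalance z))"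
      by (rule char_comparison) (use B B0 in auto)
    also have "\<dots> \<le> 2 * (expect K potential / threshold) + 1 / sqrt (real n) * B * card_G * (c * harm n)"
      using h B0 by (intro add_mono mult_left_mono not_calm_bound) auto
    also have "\<dots> < e / 2 + 1 / sqrt (real n) * B * card_G * (c * harm n)" using K' by simp
    finally show ?thesis by (simp add: mult_ac)
  qed
  have "(\<lambda>n. B * card_G * c * (harm n / sqrt (real n))) \<longlonglongrightarrow> B * card_G * c * 0"
    by (intro tendsto_mult tendsto_const harmonic_over_sqrt)
  then have "\<forall>\<^sub>F n in sequentially. B * card_G * c * (harm n / sqrt (real n)) < e / 2"
    using e by (intro order_tendstoD(2)) auto
  then obtain n0 where "\<And>n. n \<ge> n0 \<Longrightarrow> B * card_G * c * (harm n / sqrt (real n)) < e / 2"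
    by (auto simp: eventually_sequentially)
  then show "\<exists>no. \<forall>n\<ge>no. dist (expect n (\<lambda>z. iexp (1 / sqrt (real n) * sum_list (map v z))) - uniform_char v (1 / sqrt (real n)) ^ n) 0 < e"
    using bound by (intro exI[of _ n0]) (smt (verit) field_sum_of_halves)
qed

text \<open>The central limit theorem for independent uniform labels. On the unit disc
  \<open>|a^n - b^n| \<le> n * |a - b|\<close>, which turns a third-order Taylor error of order
  \<open>n^(-3/2)\<close> into one of order \<open>1 / sqrt n\<close>.\<close>

lemma uniform_char_power_tendsto:
  assumes v: "sum v (carrier G) = 0"
  shows "(\<lambda>n. uniform_char v (1 / sqrt (real n)) ^ n) \<longlonglongrightarrow> of_real (exp (- (\<Sum>h\<in>carrier G. (v h)\<^sup>2) / card_G / 2))"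
proof -
  define a where "a = (\<Sum>h\<in>carrier G. (v h)\<^sup>2) / card_G"
  define B where "B = (\<Sum>h\<in>carrier G. \<bar>v h\<bar> ^ 3)"
  have a0: "0 \<le> a" by (simp add: a_def sum_nonneg)
  have approx: "norm (uniform_char v \<theta> - (1 - of_real (\<theta>\<^sup>2 * a / 2))) \<le> \<bar>\<theta>\<bar> ^ 3 * B" for \<theta>
  proof -
    have "uniform_char v \<theta> - (1 - of_real (\<theta>\<^sup>2 * a / 2)) =
        (\<Sum>h\<in>carrier G. iexp (\<theta> * v h) - (1 + \<i> * of_real (\<theta> * v h) - of_real ((\<theta> * v h)\<^sup>2 / 2))) / card_G"
    proof -
      have "(\<Sum>h\<in>carrier G. of_real (\<theta> * v h)) = complex_of_real (\<theta> * sum v (carrier G))"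
        by (simp add: sum_distrib_left)
      then have lin: "(\<Sum>h\<in>carrier G. \<i> * of_real (\<theta> * v h)) = 0" unfolding sum_distrib_left[symmetric] v by simp
      have "(\<Sum>h\<in>carrier G. complex_of_real ((\<theta> * v h)\<^sup>2 / 2)) = of_real (\<Sum>h\<in>carrier G. \<theta>\<^sup>2 / 2 * (v h)\<^sup>2)"
        by (simp add: power_mult_distrib)
      also have "\<dots> = of_real (card_G * (\<theta>\<^sup>2 * a / 2))"
        unfolding sum_distrib_left[symmetric] using card_G_pos by (simp add: a_def)
      finally have quad: "(\<Sum>h\<in>carrier G. complex_of_real ((\<theta> * v h)\<^sup>2 / 2)) = of_real (card_G * (\<theta>\<^sup>2 * a / 2))" .
      have "(\<Sum>h\<in>carrier G. iexp (\<theta> * v h) - (1 + \<i> * of_real (\<theta> * v h) - of_real ((\<theta> * v h)\<^sup>2 / 2))) =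
         (\<Sum>h\<in>carrier G. iexp (\<theta> * v h)) - of_real card_G + of_real (card_G * (\<theta>\<^sup>2 * a / 2))"
        unfolding sum_subtractf sum.distrib lin quad by (simp add: order_def)
      then show ?thesis using card_G_pos unfolding uniform_char_def
        by (simp add: add_divide_distrib diff_divide_distrib)
    qed
    also have "norm \<dots> \<le> (\<Sum>h\<in>carrier G. \<bar>\<theta> * v h\<bar> ^ 3) / card_G"
    proof -
      have "norm (iexp x - (1 + \<i> * of_real x - of_real (x\<^sup>2 / 2))) \<le> \<bar>x\<bar> ^ 3" for x
      proof -
        have "norm (iexp x - (\<Sum>k\<le>2. (\<i> * of_real x)^k / fact k)) \<le> \<bar>x\<bar>^(Suc 2) / fact (Suc 2)" by (rule iexp_approx1)
        also have "(\<Sum>k\<le>2. (\<i> * complex_of_real x)^k / fact k) = 1 + \<i> * of_real x - of_real (x\<^sup>2 / 2)"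
        proof -
          have "sum g {..2} = g 0 + g 1 + g 2" for g :: "nat \<Rightarrow> complex" by (simp add: numeral_2_eq_2)
          then show ?thesis by (simp add: power_mult_distrib)
        qed
        also have "\<bar>x\<bar>^(Suc 2) / fact (Suc 2) = \<bar>x\<bar> ^ 3 / 6" by (simp add: eval_nat_numeral)
        also have "\<dots> \<le> \<bar>x\<bar> ^ 3" using zero_le_power[OF abs_ge_zero, of x 3] by linarith
        finally show ?thesis .
      qed
      then have "norm (\<Sum>h\<in>carrier G. iexp (\<theta> * v h) - (1 + \<i> * of_real (\<theta> * v h) - of_real ((\<theta> * v h)\<^sup>2 / 2))) \<le> (\<Sum>h\<in>carrier G. \<bar>\<theta> * v h\<bar> ^ 3)"
        by (intro sum_norm_le)
      then show ?thesis using card_G_pos by (simp only: norm_divide norm_of_real abs_of_pos) (intro divide_right_mono, auto)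
    qed
    also have "\<dots> \<le> (\<Sum>h\<in>carrier G. \<bar>\<theta> * v h\<bar> ^ 3) / 1"
      using card_G_pos by (intro divide_left_mono) (auto intro!: sum_nonneg simp: Suc_leI)
    also have "\<dots> = \<bar>\<theta>\<bar> ^ 3 * B" by (simp add: B_def abs_mult power_mult_distrib sum_distrib_left)
    finally show ?thesis .
  qed
  have main: "\<forall>\<^sub>F n in sequentially. norm (uniform_char v (1 / sqrt (real n)) ^ n - of_real ((1 + (- a / 2) / real n) ^ n)) \<le> B / sqrt (real n)"
  proof (rule eventually_sequentiallyI)
    \<comment> \<open>\<open>a \<le> n\<close> keeps \<open>1 - a / (2 * n)\<close> in the unit
      disc.\<close>
    fix n :: nat assume n: "n \<ge> nat \<lceil>a\<rceil> + 1"
    then have n0: "real n > 0" and na: "a \<le> real n" by linarith+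
    let ?\<theta> = "1 / sqrt (real n)"
    have th: "?\<theta>\<^sup>2 = 1 / real n" using n0 by (simp add: power_divide)
    have le1: "norm (1 - complex_of_real (?\<theta>\<^sup>2 * a / 2)) \<le> 1"
    proof -
      have "norm (complex_of_real (1 - ?\<theta>\<^sup>2 * a / 2)) \<le> 1" unfolding norm_of_real th
        using n0 na a0 by (auto simp: abs_le_iff field_simps)
      then show ?thesis by simp
    qed
    have "norm (uniform_char v ?\<theta> ^ n - (1 - of_real (?\<theta>\<^sup>2 * a / 2)) ^ n) \<le> n * norm (uniform_char v ?\<theta> - (1 - of_real (?\<theta>\<^sup>2 * a / 2)))"
      by (rule norm_power_diff[OF norm_uniform_char le1])
    also have "\<dots> \<le> n * (\<bar>?\<theta>\<bar> ^ 3 * B)" by (intro mult_left_mono approx) simp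
    also have "\<dots> = B / sqrt (real n)"
      using n0 by (simp add: power_divide power3_eq_cube)
    finally show "norm (uniform_char v ?\<theta> ^ n - of_real ((1 + (- a / 2) / real n) ^ n)) \<le> B / sqrt (real n)"
      by (simp add: th mult.commute)
  qed
  have "(\<lambda>n. B / sqrt (real n)) \<longlonglongrightarrow> 0" by real_asymp
  from Lim_null_comparison[OF main this]
  have d: "(\<lambda>n. uniform_char v (1 / sqrt (real n)) ^ n - of_real ((1 + (- a / 2) / real n) ^ n)) \<longlonglongrightarrow> 0" .
  have "(\<lambda>n. complex_of_real ((1 + (- a / 2) / real n) ^ n)) \<longlonglongrightarrow> of_real (exp (- a / 2))"
    by (intro tendsto_of_real tendsto_exp_limit_sequentially)
  from tendsto_add[OF d this] show ?thesis by (simp add: a_def)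
qed

theorem expect_char_tendsto:
  assumes "sum v (carrier G) = 0"
  shows "(\<lambda>n. expect n (\<lambda>z. iexp (1 / sqrt (real n) * sum_list (map v z)))) \<longlonglongrightarrow>
    of_real (exp (- (\<Sum>h\<in>carrier G. (v h)\<^sup>2) / card_G / 2))"
  using tendsto_add[OF char_difference_tendsto_0[of v] uniform_char_power_tendsto[OF assms]] by simp

end

section \<open>The urn as a random process\<close>

locale urn_process = group_urn G S0 I ms p + prob_space P
  for G (structure) and S0 :: "'a \<Rightarrow> nat" and I ms p and P :: "'w measure" +
  fixes X :: "nat \<Rightarrow> 'w \<Rightarrow> 'a list"
  assumes X_measurable: "i \<ge> 1 \<Longrightarrow> X i \<in> P \<rightarrow>\<^sub>M count_space (lists (carrier G))"
    and uniform: "uniform_draws P G S0 X"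
    and inj_ms: "inj_on ms I"
    and size_prob: "i \<ge> 1 \<Longrightarrow> s \<in> I \<Longrightarrow> measure P {\<omega> \<in> space P. draw_size X i \<omega> = ms s} = p s"
begin

section \<open>The law of the observed labels\<close>

primrec history :: "nat \<Rightarrow> 'w \<Rightarrow> 'a list" where
  "history 0 \<omega> = []"
| "history (Suc n) \<omega> = added_label G X (Suc n) \<omega> # history n \<omega>"

lemma X_lists: "i \<ge> 1 \<Longrightarrow> \<omega> \<in> space P \<Longrightarrow> X i \<omega> \<in> lists (carrier G)"
  using measurable_space[OF X_measurable] by simp

lemma added_label_closed: "i \<ge> 1 \<Longrightarrow> \<omega> \<in> space P \<Longrightarrow> added_label G X i \<omega> \<in> carrier G"
  unfolding added_label_def by (rule foldr_mult_closed[OF X_lists])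

lemma history_hist: "\<omega> \<in> space P \<Longrightarrow> history n \<omega> \<in> hist n"
  by (induction n) (auto simp: hist_def added_label_closed)

lemma urn_count_history: "real (urn_count G S0 X n h \<omega>) = urn (history n \<omega>) h"
  by (induction n) (auto simp: urn_count_def urn_def)

definition generators :: "nat \<Rightarrow> 'w set set" where
  "generators n = {X i -` A \<inter> space P |i A. i \<in> {1..n} \<and> A \<subseteq> lists (carrier G)}"

lemma generatorsI: "1 \<le> i \<Longrightarrow> i \<le> n \<Longrightarrow> A \<subseteq> lists (carrier G) \<Longrightarrow> X i -` A \<inter> space P \<in> generators n"
  by (auto simp: generators_def)

lemma generators_Pow: "generators n \<subseteq> Pow (space P)"
  by (auto simp: generators_def)

lemma space_draw_history: "space (draw_history P G X n) = space P"
  unfolding draw_history_def generators_def[symmetric] by (rule space_measure_of[OF generators_Pow])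

lemma sets_draw_history: "sets (draw_history P G X n) = sigma_sets (space P) (generators n)"
  unfolding draw_history_def generators_def[symmetric] by (rule sets_measure_of[OF generators_Pow])

lemma X_event: "i \<ge> 1 \<Longrightarrow> A \<subseteq> lists (carrier G) \<Longrightarrow> X i -` A \<inter> space P \<in> events"
  using measurable_sets[OF X_measurable, of i A] by simp

lemma subalgebra_draw_history: "subalgebra P (draw_history P G X n)"
  unfolding subalgebra_def space_draw_history sets_draw_history
  by (intro conjI refl sets.sigma_sets_subset) (auto simp: generators_def X_event)

lemma added_label_event_draw_history:
  assumes "1 \<le> i" "i \<le> n"
  shows "{\<omega> \<in> space P. added_label G X i \<omega> = h} \<in> sets (draw_history P G X n)"
proof -
  have "{\<omega> \<in> space P. added_label G X i \<omega> = h} = X i -` {xs \<in> lists (carrier G). foldr (\<otimes>) xs \<one> = h} \<inter> space P"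
    using X_lists[OF assms(1)] by (auto simp: added_label_def)
  also have "\<dots> \<in> generators n" using assms by (intro generatorsI) auto
  finally show ?thesis unfolding sets_draw_history by (rule sigma_sets.Basic)
qed

lemma history_event_draw_history:
  "k \<le> n \<Longrightarrow> {\<omega> \<in> space P. history k \<omega> = z} \<in> sets (draw_history P G X n)"
proof (induction k arbitrary: z)
  case 0
  have "{\<omega> \<in> space P. history 0 \<omega> = z} = (if z = [] then space (draw_history P G X n) else {})"
    by (auto simp: space_draw_history)
  then show ?case by (simp del: history.simps)
next
  case (Suc k)
  show ?case
  proof (cases z)
    case (Cons h z')
    have "{\<omega> \<in> space P. history (Suc k) \<omega> = z} = {\<omega> \<in> space P. added_label G X (Suc k) \<omega> = h} \<inter> {\<omega> \<in> space P. history k \<omega> = z'}"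
      by (auto simp: Cons)
    also have "\<dots> \<in> sets (draw_history P G X n)"
      using Suc by (intro sets.Int added_label_event_draw_history) auto
    finally show ?thesis .
  qed simp
qed

lemma draw_history_events: "A \<in> sets (draw_history P G X n) \<Longrightarrow> A \<in> events"
  using subalgebra_draw_history[of n] by (auto simp: subalgebra_def)

text \<open>The event that the history equals \<open>z\<close> belongs to the past, and the
  conditional probability of the draw is constant on it, so integrating over this event gives a
  product.\<close>

lemma draw_prob:
  assumes s: "s \<in> I" and xs: "xs \<in> lists (carrier G)" "length xs = ms s" and z: "z \<in> hist n"
  shows "prob {\<omega> \<in> space P. history n \<omega> = z \<and> X (Suc n) \<omega> = xs} =
    prob {\<omega> \<in> space P. history n \<omega> = z} * (p s * prod_list (map (content z) xs))"
proof -
  let ?F = "draw_history P G X n" and ?E = "{\<omega> \<in> space P. history n \<omega> = z}"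
    and ?B = "{\<omega> \<in> space P. X (Suc n) \<omega> = xs}"
  interpret F: finite_measure_subalgebra P ?F
    by unfold_locales (rule subalgebra_draw_history)
  have E: "?E \<in> sets ?F" by (rule history_event_draw_history) simp
  have E': "?E \<in> events" by (rule draw_history_events[OF E])
  have "?B = X (Suc n) -` {xs} \<inter> space P" by auto
  then have B: "?B \<in> events" using X_event[of "Suc n" "{xs}"] xs by simp
  have size: "measure P {\<omega> \<in> space P. draw_size X (Suc n) \<omega> = ms s} = p s" by (rule size_prob[OF _ s]) simp
  have "AE \<omega> in P. real_cond_exp P ?F (indicator ?B) \<omega> =
      p s * (\<Prod>l<ms s. real (urn_count G S0 X n (xs ! l) \<omega>) / real (n + (\<Sum>h\<in>carrier G. S0 h)))"
    using uniform[unfolded uniform_draws_def, rule_format, of "Suc n" "ms s" xs] size p_pos[OF s] xs by simp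
  then have ae: "AE \<omega> in P. \<omega> \<in> ?E \<longrightarrow> real_cond_exp P ?F (indicator ?B) \<omega> = p s * prod_list (map (content z) xs)"
  proof eventually_elim
    case (elim \<omega>)
    show ?case
    proof
      assume "\<omega> \<in> ?E"
      then have hz: "history n \<omega> = z" by simp
      have "prod_list (map (content z) xs) = (\<Prod>l<ms s. content z (xs ! l))"
        using xs by (simp add: prod.list_conv_set_nth lessThan_atLeast0)
      moreover have "content z x = real (urn_count G S0 X n x \<omega>) / real (n + (\<Sum>h\<in>carrier G. S0 h))" for x
        unfolding content_def urn_count_history hz total_hist[OF z] by (simp add: init_total_def add.commute)
      ultimately show "real_cond_exp P ?F (indicator ?B) \<omega> = p s * prod_list (map (content z) xs)"
        using elim by simp
    qed
  qed
  have "prob {\<omega> \<in> space P. history n \<omega> = z \<and> X (Suc n) \<omega> = xs} = prob (?E \<inter> ?B)"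
    by (rule arg_cong[where f=prob]) auto
  also have "\<dots> = (\<integral>\<omega>\<in>?E. indicator ?B \<omega> \<partial>P)"
    using E' B by (simp add: set_lebesgue_integral_def indicator_inter_arith[symmetric])
  also have "\<dots> = (\<integral>\<omega>\<in>?E. real_cond_exp P ?F (indicator ?B) \<omega> \<partial>P)"
    by (intro F.real_cond_exp_intA integrable_real_indicator B E) (simp add: emeasure_eq_measure)
  also have "\<dots> = (\<integral>\<omega>\<in>?E. p s * prod_list (map (content z) xs) \<partial>P)"
    using E' ae by (intro set_lebesgue_integral_cong_AE) auto
  also have "\<dots> = prob ?E * (p s * prod_list (map (content z) xs))"
    using E' by (simp add: set_lebesgue_integral_def)
  finally show ?thesis .
qed

lemma size_event: "i \<ge> 1 \<Longrightarrow> {\<omega> \<in> space P. draw_size X i \<omega> = m} \<in> events"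
proof -
  assume i: "i \<ge> 1"
  have "{\<omega> \<in> space P. draw_size X i \<omega> = m} = X i -` {xs \<in> lists (carrier G). length xs = m} \<inter> space P"
    using X_lists[OF i] by (auto simp: draw_size_def)
  then show ?thesis using X_event[OF i, of "{xs \<in> lists (carrier G). length xs = m}"] by auto
qed

text \<open>The prescribed sizes are distinct and their probabilities sum to 1, so every other size
  is null.\<close>

lemma AE_size:
  assumes i: "i \<ge> 1" shows "AE \<omega> in P. draw_size X i \<omega> \<in> ms ` I"
proof -
  have "prob (\<Union>s\<in>I. {\<omega> \<in> space P. draw_size X i \<omega> = ms s}) = (\<Sum>s\<in>I. prob {\<omega> \<in> space P. draw_size X i \<omega> = ms s})"
    using inj_ms size_event[OF i] by (intro finite_measure_finite_Union) (auto simp: disjoint_family_on_def inj_on_def)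
  also have "\<dots> = 1" using size_prob[OF i] p_sum by simp
  finally have "AE \<omega> in P. \<omega> \<in> (\<Union>s\<in>I. {\<omega> \<in> space P. draw_size X i \<omega> = ms s})"
    using size_event[OF i] by (subst (asm) prob_eq_1) auto
  then show ?thesis by eventually_elim auto
qed

lemma history_event: "{\<omega> \<in> space P. history n \<omega> = z} \<in> events"
  by (rule draw_history_events[OF history_event_draw_history[OF order_refl]])

text \<open>Sum over the words of admissible length with product \<open>h\<close>; the length
  determines the index \<open>s\<close>, which makes the events disjoint. Words of other lengths are
  null, so the decomposition holds almost everywhere.\<close>

lemma label_prob:
  assumes h: "h \<in> carrier G" and z: "z \<in> hist n"
  shows "prob {\<omega> \<in> space P. history (Suc n) \<omega> = h # z} = prob {\<omega> \<in> space P. history n \<omega> = z} * law z h"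
proof -
  define S where "S = (SIGMA s:I. factorizations (ms s) h)"
  define B where "B sx = {\<omega> \<in> space P. history n \<omega> = z \<and> X (Suc n) \<omega> = snd sx}" for sx :: "nat \<times> 'a list"
  have finS: "finite S" unfolding S_def by (intro finite_SigmaI) (auto simp: finite_factorizations)
  have Bm: "B sx \<in> events" if "sx \<in> S" for sx
  proof -
    have "snd sx \<in> lists (carrier G)" using that by (auto simp: S_def factorizations_def)
    then have "X (Suc n) -` {snd sx} \<inter> space P \<in> events" by (intro X_event) auto
    then have "{\<omega> \<in> space P. history n \<omega> = z} \<inter> (X (Suc n) -` {snd sx} \<inter> space P) \<in> events"
      by (rule sets.Int[OF history_event])
    moreover have "{\<omega> \<in> space P. history n \<omega> = z} \<inter> (X (Suc n) -` {snd sx} \<inter> space P) = B sx" by (auto simp: B_def)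
    ultimately show ?thesis by simp
  qed
  have disj: "disjoint_family_on B S"
    unfolding disjoint_family_on_def B_def S_def factorizations_def
    using inj_ms by (auto simp: inj_on_def)
  have "AE \<omega> in P. draw_size X (Suc n) \<omega> \<in> ms ` I" by (rule AE_size) simp
  then have "AE \<omega> in P. \<omega> \<in> {\<omega> \<in> space P. history (Suc n) \<omega> = h # z} \<longleftrightarrow> \<omega> \<in> (\<Union>sx\<in>S. B sx)"
    using AE_space
  proof eventually_elim
    case (elim \<omega>)
    then obtain s where s: "s \<in> I" "length (X (Suc n) \<omega>) = ms s" by (auto simp: draw_size_def)
    have "X (Suc n) \<omega> \<in> lists (carrier G)" using elim by (intro X_lists) auto
    then have "added_label G X (Suc n) \<omega> = h \<longleftrightarrow> (s, X (Suc n) \<omega>) \<in> S"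
      using s by (auto simp: S_def factorizations_def added_label_def)
    moreover have "\<omega> \<in> (\<Union>sx\<in>S. B sx) \<longleftrightarrow> history n \<omega> = z \<and> (s, X (Suc n) \<omega>) \<in> S"
    proof
      assume "\<omega> \<in> (\<Union>sx\<in>S. B sx)"
      then obtain s' xs where "(s', xs) \<in> S" "\<omega> \<in> B (s', xs)" by auto
      then show "history n \<omega> = z \<and> (s, X (Suc n) \<omega>) \<in> S"
        using s by (auto simp: B_def S_def factorizations_def)
    next
      assume "history n \<omega> = z \<and> (s, X (Suc n) \<omega>) \<in> S"
      then show "\<omega> \<in> (\<Union>sx\<in>S. B sx)"
        using elim by (intro UN_I[of "(s, X (Suc n) \<omega>)"]) (auto simp: B_def)
    qed
    ultimately show ?case using elim by auto
  qed
  then have "prob {\<omega> \<in> space P. history (Suc n) \<omega> = h # z} = prob (\<Union>sx\<in>S. B sx)"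
    by (intro finite_measure_eq_AE history_event sets.finite_UN finS Bm)
  also have "\<dots> = (\<Sum>sx\<in>S. prob (B sx))"
    using finS Bm disj by (intro finite_measure_finite_Union) auto
  also have "\<dots> = (\<Sum>(s, xs)\<in>S. prob {\<omega> \<in> space P. history n \<omega> = z} * (p s * prod_list (map (content z) xs)))"
    by (intro sum.cong refl) (auto simp: B_def S_def factorizations_def intro!: draw_prob[OF _ _ _ z])
  also have "\<dots> = (\<Sum>s\<in>I. \<Sum>xs\<in>factorizations (ms s) h. prob {\<omega> \<in> space P. history n \<omega> = z} * (p s * prod_list (map (content z) xs)))"
    unfolding S_def by (rule sum.Sigma[symmetric]) (auto simp: finite_factorizations)
  also have "\<dots> = prob {\<omega> \<in> space P. history n \<omega> = z} * law z h"
    by (simp add: law_def conv_power_factorizations[OF h] sum_distrib_left)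
  finally show ?thesis .
qed

lemma history_prob: "z \<in> hist n \<Longrightarrow> prob {\<omega> \<in> space P. history n \<omega> = z} = weight z"
proof (induction n arbitrary: z)
  case 0
  then show ?case by (simp add: prob_space)
next
  case (Suc n)
  then obtain h z' where z: "z = h # z'" "h \<in> carrier G" "z' \<in> hist n" by (auto simp: hist_Suc)
  then show ?case using label_prob[OF z(2,3)] Suc.IH[OF z(3)] by simp
qed

lemma integral_history:
  fixes F :: "'a list \<Rightarrow> complex"
  shows "(\<integral>\<omega>. F (history n \<omega>) \<partial>P) = expect n F"
proof -
  have "(\<integral>\<omega>. F (history n \<omega>) \<partial>P) = (\<integral>\<omega>. (\<Sum>z\<in>hist n. indicator {\<omega> \<in> space P. history n \<omega> = z} \<omega> *\<^sub>R F z) \<partial>P)"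
  proof (rule Bochner_Integration.integral_cong[OF refl])
    fix \<omega> assume w: "\<omega> \<in> space P"
    have "(\<Sum>z\<in>hist n. indicator {\<omega> \<in> space P. history n \<omega> = z} \<omega> *\<^sub>R F z) = (\<Sum>z\<in>hist n. if z = history n \<omega> then F z else 0)"
      using w by (intro sum.cong) auto
    then show "F (history n \<omega>) = (\<Sum>z\<in>hist n. indicator {\<omega> \<in> space P. history n \<omega> = z} \<omega> *\<^sub>R F z)"
      using history_hist[OF w] by simp
  qed
  also have "\<dots> = (\<Sum>z\<in>hist n. \<integral>\<omega>. indicator {\<omega> \<in> space P. history n \<omega> = z} \<omega> *\<^sub>R F z \<partial>P)"
    by (intro Bochner_Integration.integral_sum integrable_scaleR_left)
      (auto intro!: integrable_real_indicator history_event simp: emeasure_eq_measure)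
  also have "\<dots> = (\<Sum>z\<in>hist n. prob {\<omega> \<in> space P. history n \<omega> = z} *\<^sub>R F z)"
    by (intro sum.cong refl, subst integral_scaleR_left)
      (auto intro!: integrable_real_indicator simp: emeasure_eq_measure history_event)
  also have "\<dots> = expect n F" by (simp add: expect_def history_prob)
  finally show ?thesis .
qed

lemma urn_count_measurable: "(\<lambda>\<omega>. real (urn_count G S0 X n h \<omega>)) \<in> borel_measurable P"
proof -
  have "Measurable.pred P (\<lambda>\<omega>. added_label G X i \<omega> = h)" if "i \<in> {1..n}" for i
    unfolding pred_def using that draw_history_events[OF added_label_event_draw_history[of i n h]] by simp
  then show ?thesis unfolding urn_count_def of_nat_add of_nat_sum
    by (intro borel_measurable_add borel_measurable_const borel_measurable_sum) simp
qed

section \<open>The vector of rescaled counts\<close>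

context
  fixes g :: "'n::finite \<Rightarrow> 'a"
  assumes g: "bij_betw g UNIV (carrier G)"
begin

definition scaled_counts :: "nat \<Rightarrow> 'w \<Rightarrow> real^'n" where
  "scaled_counts n \<omega> = (1 / sqrt (real n)) *\<^sub>R
    ((\<chi> i. real (urn_count G S0 X n (g i) \<omega>)) - (real n / card_G) *\<^sub>R (\<chi> i. 1))"

text \<open>The change that one stage causes in the inner product of \<open>t\<close> with the
  centered counts, as a function of the new label.\<close>

definition centered :: "real^'n \<Rightarrow> 'a \<Rightarrow> real" where
  "centered t h = t $ inv_into UNIV g h - (\<Sum>i\<in>UNIV. t $ i) / card_G"

lemma card_index: "real CARD('n) = card_G"
  using bij_betw_same_card[OF g] by (simp add: order_def)

lemma sum_index: "(\<Sum>i\<in>UNIV. F (g i)) = (\<Sum>h\<in>carrier G. F h)"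
  by (rule sum.reindex_bij_betw[OF g])

lemma centered_g: "centered t (g i) = t $ i - (\<Sum>i\<in>UNIV. t $ i) / card_G"
  using g by (simp add: centered_def bij_betw_def)

lemma sum_centered: "sum (centered t) (carrier G) = 0"
  unfolding sum_index[of "centered t", symmetric] centered_g
  using card_G_pos by (simp add: sum_subtractf card_index)

lemma sum_centered_power2:
  "(\<Sum>h\<in>carrier G. (centered t h)\<^sup>2) / card_G = (norm (t v* centering_matrix))\<^sup>2"
  unfolding sum_index[of "\<lambda>h. (centered t h)\<^sup>2", symmetric] centered_g norm_centering_matrix card_index ..

lemma scaled_counts_measurable: "scaled_counts n \<in> borel_measurable P"
proof (rule borel_measurable_euclidean_space[THEN iffD2], rule ballI)
  fix b :: "real^'n" assume "b \<in> Basis"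
  then obtain i where b: "b = axis i 1" by (auto simp: Basis_vec_def)
  have "(\<lambda>\<omega>. scaled_counts n \<omega> \<bullet> b) = (\<lambda>\<omega>. 1 / sqrt (real n) * (real (urn_count G S0 X n (g i) \<omega>) - real n / card_G))"
    by (auto simp: b inner_axis scaled_counts_def)
  then show "(\<lambda>\<omega>. scaled_counts n \<omega> \<bullet> b) \<in> borel_measurable P"
    using urn_count_measurable[of n "g i"] by simp
qed

lemma sum_list_centered:
  assumes "z \<in> hist n"
  shows "sum_list (map (centered t) z) = (\<Sum>i\<in>UNIV. t $ i * (real (count_list z (g i)) - real n / card_G))"
proof -
  have z: "set z \<subseteq> carrier G" and n: "length z = n" using assms by (auto simp: hist_def)
  have len: "(\<Sum>i\<in>UNIV. real (count_list z (g i))) = real n"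
    unfolding sum_index[of "\<lambda>h. real (count_list z h)"]
    using sum_list_map_eq_sum_count2[OF z finite_carrier, of "\<lambda>_. 1"] n
    by (simp add: sum_list_triv flip: of_nat_sum)
  have "sum_list (map (centered t) z) = (\<Sum>h\<in>carrier G. real (count_list z h) * centered t h)"
  proof -
    have "sum_list (map (centered t) xs) = (\<Sum>h\<in>carrier G. real (count_list xs h) * centered t h)"
      if "set xs \<subseteq> carrier G" for xs
      using that
    proof (induction xs)
      case (Cons a xs)
      have "(\<Sum>h\<in>carrier G. real (count_list (a # xs) h) * centered t h) =
          (\<Sum>h\<in>carrier G. real (count_list xs h) * centered t h + (if h = a then centered t h else 0))"
        by (intro sum.cong) (auto simp: distrib_right)
      then show ?case using Cons by (simp add: sum.distrib)
    qed simp
    then show ?thesis using z .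
  qed
  also have "\<dots> = (\<Sum>i\<in>UNIV. real (count_list z (g i)) * (t $ i - (\<Sum>i\<in>UNIV. t $ i) / card_G))"
    unfolding sum_index[of "\<lambda>h. real (count_list z h) * centered t h", symmetric] centered_g ..
  also have "\<dots> = (\<Sum>i\<in>UNIV. t $ i * real (count_list z (g i))) - real n * ((\<Sum>i\<in>UNIV. t $ i) / card_G)"
    by (simp only: right_diff_distrib sum_subtractf sum_distrib_right[symmetric] len) (simp add: mult.commute)
  also have "\<dots> = (\<Sum>i\<in>UNIV. t $ i * (real (count_list z (g i)) - real n / card_G))"
    by (simp add: right_diff_distrib sum_subtractf sum_divide_distrib sum_distrib_left sum_distrib_right mult_ac)
  finally show ?thesis .
qed

text \<open>Splits off the initial composition, a fixed number divided by \<open>sqrt n\<close> that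
  vanishes in the limit.\<close>

lemma inner_scaled_counts:
  assumes "\<omega> \<in> space P"
  shows "t \<bullet> scaled_counts n \<omega> = 1 / sqrt (real n) * (\<Sum>i\<in>UNIV. t $ i * real (S0 (g i)))
    + 1 / sqrt (real n) * sum_list (map (centered t) (history n \<omega>))"
proof -
  have "t \<bullet> scaled_counts n \<omega> = 1 / sqrt (real n) * (\<Sum>i\<in>UNIV. t $ i * (urn (history n \<omega>) (g i) - real n / card_G))"
    by (simp add: scaled_counts_def inner_vec_def urn_count_history sum_distrib_left mult_ac)
  also have "(\<Sum>i\<in>UNIV. t $ i * (urn (history n \<omega>) (g i) - real n / card_G)) =
      (\<Sum>i\<in>UNIV. t $ i * real (S0 (g i))) + (\<Sum>i\<in>UNIV. t $ i * (real (count_list (history n \<omega>) (g i)) - real n / card_G))"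
    by (simp add: urn_def sum.distrib[symmetric] algebra_simps)
  finally show ?thesis by (simp add: sum_list_centered[OF history_hist[OF assms]] distrib_left)
qed

lemma char_scaled_counts_tendsto:
  "(\<lambda>n. \<integral>\<omega>. iexp (t \<bullet> scaled_counts n \<omega>) \<partial>P) \<longlonglongrightarrow> of_real (exp (- (norm (t v* centering_matrix))\<^sup>2 / 2))"
proof -
  let ?c = "\<Sum>i\<in>UNIV. t $ i * real (S0 (g i))"
  have "(\<integral>\<omega>. iexp (t \<bullet> scaled_counts n \<omega>) \<partial>P) =
      iexp (1 / sqrt (real n) * ?c) * expect n (\<lambda>z. iexp (1 / sqrt (real n) * sum_list (map (centered t) z)))" for n
  proof -
    have "(\<integral>\<omega>. iexp (t \<bullet> scaled_counts n \<omega>) \<partial>P) =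
        (\<integral>\<omega>. iexp (1 / sqrt (real n) * ?c) * iexp (1 / sqrt (real n) * sum_list (map (centered t) (history n \<omega>))) \<partial>P)"
      by (rule Bochner_Integration.integral_cong[OF refl])
        (simp only: inner_scaled_counts of_real_add distrib_left exp_add)
    then show ?thesis
      using integral_history[of "\<lambda>z. iexp (1 / sqrt (real n) * sum_list (map (centered t) z))" n]
      by (simp only: integral_mult_right_zero)
  qed
  moreover have "(\<lambda>n. 1 / sqrt (real n) * ?c) \<longlonglongrightarrow> 0 * ?c"
    by (intro tendsto_mult tendsto_const) real_asymp
  then have "(\<lambda>n. iexp (1 / sqrt (real n) * ?c)) \<longlonglongrightarrow> iexp (0 * ?c)"
    by (rule isCont_tendsto_compose[OF isCont_iexp])
  from tendsto_mult[OF this expect_char_tendsto[OF sum_centered[of t]]]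
  have "(\<lambda>n. iexp (1 / sqrt (real n) * ?c) * expect n (\<lambda>z. iexp (1 / sqrt (real n) * sum_list (map (centered t) z))))
      \<longlonglongrightarrow> of_real (exp (- (norm (t v* centering_matrix))\<^sup>2 / 2))"
    by (simp add: sum_centered_power2[symmetric])
  ultimately show ?thesis by (simp only:)
qed

theorem scaled_counts_converge:
  "\<exists>\<mu>. multivariate_normal 0 ((1 / card_G) *\<^sub>R mat 1 - (1 / card_G\<^sup>2) *\<^sub>R (\<chi> i j. 1) :: real^'n^'n) \<mu> \<and>
    converges_in_distribution P scaled_counts \<mu>"
proof -
  obtain \<mu> where \<mu>: "multivariate_normal 0 (centering_matrix ** transpose centering_matrix :: real^'n^'n) \<mu>"
    "prob_space \<mu>" "sets \<mu> = sets borel"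
    "\<And>a. (\<integral>x. iexp (a \<bullet> x) \<partial>\<mu>) = of_real (exp (- (norm (a v* centering_matrix))\<^sup>2 / 2))"
    by (rule multivariate_normal_exists[of centering_matrix]) (rule that)
  have "converges_in_distribution P scaled_counts \<mu>"
    by (rule converges_in_distribution_charI[OF scaled_counts_measurable \<mu>(2,3)])
      (simp only: \<mu>(4) char_scaled_counts_tendsto)
  then show ?thesis using \<mu>(1) unfolding centering_matrix_square card_index by blast
qed

end

end

theorem theorem2p5:
  fixes d n0 c C :: nat
    and P :: "'w measure"
    and G :: "('a, 'b) monoid_scheme"
    and g :: "'n::finite \<Rightarrow> 'a"
    and S0 :: "'a \<Rightarrow> nat"
    and X :: "nat \<Rightarrow> 'w \<Rightarrow> 'a list"
    and ms :: "nat \<Rightarrow> nat" and p :: "nat \<Rightarrow> real"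
  assumes "d \<ge> 2"
    and "comm_group G" and "finite (carrier G)" and "order G = d"
    and "bij_betw g UNIV (carrier G)"
    and "(\<Sum>h\<in>carrier G. S0 h) = n0" and "n0 \<ge> 1"
    and "generate G {h \<in> carrier G. S0 h > 0} = carrier G"
    and "prob_space P"
    and "\<And>i. i \<ge> 1 \<Longrightarrow> X i \<in> P \<rightarrow>\<^sub>M count_space (lists (carrier G))"
    and "uniform_draws P G S0 X"
    and "c \<ge> 1" and "C \<ge> 2"
    and "strict_mono_on {1..c} ms"
    and "\<And>s. s \<in> {1..c} \<Longrightarrow> 2 \<le> ms s \<and> ms s \<le> C"
    and "prob_space.indep_vars P (\<lambda>_. count_space UNIV) (draw_size X) {1..}"
    and "\<And>i s. i \<ge> 1 \<Longrightarrow> s \<in> {1..c} \<Longrightarrow>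
           measure P {\<omega> \<in> space P. draw_size X i \<omega> = ms s} = p s"
    and "\<And>s. s \<in> {1..c} \<Longrightarrow> p s > 0" and "(\<Sum>s = 1..c. p s) = 1"
    and "\<exists>s\<in>{1..c}. gcd (ms s - 1) d = 1"
  shows "\<exists>\<mu>. multivariate_normal 0
                ((1 / real d) *\<^sub>R mat 1 - (1 / (real d)\<^sup>2) *\<^sub>R (\<chi> i j. 1) :: real^'n^'n) \<mu> \<and>
             converges_in_distribution P
               (\<lambda>n \<omega>. (1 / sqrt (real n)) *\<^sub>R
                  ((\<chi> i. real (urn_count G S0 X n (g i) \<omega>)) - (real n / real d) *\<^sub>R (\<chi> i. 1))) \<mu>"
proof -
  \<comment> \<open>Strict monotonicity of \<open>ms\<close> supplies the distinctness of the draw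
    sizes.\<close>
  have "urn_process G S0 {1..c} ms p P X"
    unfolding urn_process_def group_urn_def finite_comm_group_def finite_comm_group_axioms_def
      group_urn_axioms_def urn_process_axioms_def
    using assms strict_mono_on_imp_inj_on[OF assms(14)] by auto
  then interpret urn_process G S0 "{1..c}" ms p P X .
  show ?thesis
    using scaled_counts_converge[OF assms(5)] assms(4)
    unfolding scaled_counts_def[OF assms(5), abs_def] by simp
qed

end
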